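(* Let $A_1$ be bounded, let $l\in\{+1,-1\}$, let $\Gamma^l\subset D^l$ be an admissible contour with $\mathcal{V}_0(B,\Gamma^l)<\frac14 d^2(\Gamma^l)$, let $Z^{(l)}=A_1+X^{(l)}$, suppose that $\operatorname{dist}\bigl(\operatorname{spec}(Z^{(l)}),D^l\bigr)>0$, and let $$Y^{(l)}=\int_{\Delta_0}\mathsf{E}_0(d\mu)\,B\,(Z^{(l)}-\mu)^{-1}\in\mathcal{B}(\mathfrak{A}_1,\mathfrak{A}_0).$$ Then the operator $\widehat{Y}^{(l)}=(Y^{(l)})^*$ is a strong solution of the operator Riccati equation $$\widehat{Y}A_0-A_1\widehat{Y}+\widehat{Y}B\widehat{Y}=-B^*.$$ The graphs $$\mathfrak{L}_0^{(l)}=\mathcal{G}(\widehat{Y}^{(l)})=\{x_0\oplus\widehat{Y}^{(l)}x_0\,:\,x_0\in\mathfrak{A}_0\},\qquad \mathfrak{L}_1^{(l)}=\mathcal{G}(Y^{(l)})=\{Y^{(l)}x_1\oplus x_1\,:\,x_1\in\mathfrak{A}_1\}$$ are mutually $J$-orthogonal invariant subspaces of the block operator matrix $L$. That is, $\langle Jx,y\rangle=0$ for all $x\in\mathcal{G}(\widehat{Y}^{(l)})$, $y\in\mathcal{G}(Y^{(l)})$; $Lx\in\mathcal{G}(\widehat{Y}^{(l)})$ whenever $x\in\operatorname{Dom}(L)\cap\mathcal{G}(\widehat{Y}^{(l)})$; and $Ly\in\mathcal{G}(Y^{(l)})$ whenever $y\in\operatorname{Dom}(L)\cap\mathcal{G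}(Y^{(l)})$.
   Context: Let $A_0$, $A_1$ be self-adjoint operators in complex Hilbert spaces $\mathfrak{A}_0$, $\mathfrak{A}_1$, with spectra $\sigma_0$, $\sigma_1$, and let $B$ be a bounded operator from $\mathfrak{A}_1$ to $\mathfrak{A}_0$. On $\mathfrak{H}=\mathfrak{A}_0\oplus\mathfrak{A}_1$ set $$L=\begin{pmatrix}A_0&B\\-B^*&A_1\end{pmatrix},\quad \operatorname{Dom}(L)=\operatorname{Dom}(A_0)\oplus\operatorname{Dom}(A_1),\qquad J=\begin{pmatrix}I&0\\0&-I\end{pmatrix}.$$ $\mathcal{B}(\mathfrak{M},\mathfrak{N})$ denotes the bounded operators from $\mathfrak{M}$ to $\mathfrak{N}$, $\mathcal{B}(\mathfrak{M})=\mathcal{B}(\mathfrak{M},\mathfrak{M})$. Standing assumptions: the whole spectrum $\sigma_0$ is absolutely continuous and equals the closure of a single interval $\Delta_0=(\mu_0^{(1)},\mu_0^{(2)})$, $-\infty\le\mu_0^{(1)}<\mu_0^{(2)}\le\infty$, and $\sigma_1\subset\Delta_0$. Let $\mathsf{E}_0$ be the spectral measure of $A_0$, $\mathsf{E}^0(\mu)=\mathsf{E}_0((-\infty,\mu))$, and $K_B(\mu)=B^*\mathsf{E}^0(\mu)B$. It is assumed that $K_B$ is differentiable on $\Delta_0$ in operator norm and that its derivative $K_B'$ admits analytic continuation from $\Delta_0$ to a simply connected domain $D^-\subset\mathbb{C}^-$ (lower half-plane) whose boundary includes $\Delta_0$. Then $K_B'$ also continues analytically to the domain $D^+\subset\mathbb{C}^+$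 symmetric to $D^-$ about the real axis, with $[K_B'(\mu)]^*=K_B'(\bar\mu)$ on $D^\pm$. If an end point $\mu_0^{(k)}$ is finite, it is assumed that $\|K_B'(\mu)\|\le C|\mu-\mu_0^{(k)}|^\gamma$ for $\mu\in D^\pm$ near $\mu_0^{(k)}$, with some $C>0$, $\gamma\in(-1,0]$. The index $l=\pm1$ in $D^l$ is identified with the sign $\pm$. A contour $\Gamma^l$ is a rectifiable Jordan curve obtained by a continuous deformation of $\Delta_0$, lying in $D^l$, with the (finite) end points fixed, oriented from $\mu_0^{(1)}$ to $\mu_0^{(2)}$. It is called admissible if $\mathcal{V}_0(B,\Gamma^l):=\int_{\Gamma^l}|d\mu|\,\|K_B'(\mu)\|<\infty$ ($|d\mu|$ is arc length). Put $d(\Gamma^l)=\operatorname{dist}(\sigma_1,\Gamma^l)$. For $Z=A_1+X$, $X\in\mathcal{B}(\mathfrak{A}_1)$, with spectrum not intersecting $\Gamma^l$, set $W_1(Z,\Gamma^l)=-\int_{\Gamma^l}d\mu\,K_B'(\mu)(Z-\mu)^{-1}$. If $\mathcal{V}_0(B,\Gamma^l)<\frac14d^2(\Gamma^l)$, the operator $X^{(l)}$ is the unique solution $X\in\mathcal{B}(\mathfrak{A}_1)$ of $X=W_1(A_1+X,\Gamma^l)$ with $\|X\|\le\frac{d(\Gamma^l)}2-\sqrt{\frac{d^2(\Gamma^l)}4-\mathcal{V}_0(B,\Gamma^l)}$; for fixed $l$ it does not depend on the choice of such a contour. The integral defining $Y^{(l)}$ is understood in the strong sense. Strong solution: $\widehat{Y}\in\mathcal{B}(\mathfrak{A}_0,\mathfrak{A}_1)$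 is a strong solution of $\widehat{Y}A_0-A_1\widehat{Y}+\widehat{Y}B\widehat{Y}=-B^*$ if $\widehat{Y}$ maps $\operatorname{Dom}(A_0)$ into $\operatorname{Dom}(A_1)$ and $\widehat{Y}A_0x-A_1\widehat{Y}x+\widehat{Y}B\widehat{Y}x=-B^*x$ for all $x\in\operatorname{Dom}(A_0)$.
   Formalization: If an end point of Δ₀ is infinite, the deformation of Δ₀ into Γ is also required to stay near infinity there and to have connecting arcs arbitrarily far out along which ∫|dμ|‖K_B'(μ)‖/|μ| is arbitrarily small; without this the claim can fail. *)

theory Defs
  imports "HOL-Analysis.Analysis"
begin

section \<open>Complex Hilbert spaces\<close>

text \<open>The inner product is linear in the first argument.\<close>

class complex_hilbert_space = banach +
  fixes scaleC :: "complex \<Rightarrow> 'a \<Rightarrow> 'a" (infixr \<open>*\<^sub>C\<close> 75)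
    and cinner :: "'a \<Rightarrow> 'a \<Rightarrow> complex"
  assumes scaleC_add_right: "c *\<^sub>C (x + y) = c *\<^sub>C x + c *\<^sub>C y"
    and scaleC_add_left: "(c + d) *\<^sub>C x = c *\<^sub>C x + d *\<^sub>C x"
    and scaleC_scaleC: "c *\<^sub>C d *\<^sub>C x = (c * d) *\<^sub>C x"
    and scaleR_scaleC: "r *\<^sub>R x = complex_of_real r *\<^sub>C x"
    and cinner_commute: "cinner x y = cnj (cinner y x)"
    and cinner_add_left: "cinner (x + y) z = cinner x z + cinner y z"
    and cinner_scaleC_left: "cinner (c *\<^sub>C x) y = c * cinner x y"
    and cinner_norm: "cinner x x = complex_of_real ((norm x)\<^sup>2)"

instantiation prod :: (complex_hilbert_space, complex_hilbert_space) complex_hilbert_space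
begin

definition scaleC_prod :: "complex \<Rightarrow> 'a \<times> 'b \<Rightarrow> 'a \<times> 'b"
  where "scaleC_prod c x = (c *\<^sub>C fst x, c *\<^sub>C snd x)"

definition cinner_prod :: "'a \<times> 'b \<Rightarrow> 'a \<times> 'b \<Rightarrow> complex"
  where "cinner_prod x y = cinner (fst x) (fst y) + cinner (snd x) (snd y)"

instance
proof
  fix c d :: complex and r :: real and x y z :: "'a \<times> 'b"
  show "c *\<^sub>C (x + y) = c *\<^sub>C x + c *\<^sub>C y" "(c + d) *\<^sub>C x = c *\<^sub>C x + d *\<^sub>C x"
    "c *\<^sub>C d *\<^sub>C x = (c * d) *\<^sub>C x"
    by (simp_all add: scaleC_prod_def scaleC_add_right scaleC_add_left scaleC_scaleC)
  show "r *\<^sub>R x = complex_of_real r *\<^sub>C x"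
    by (cases x) (simp add: scaleC_prod_def scaleR_scaleC)
  show "cinner x y = cnj (cinner y x)"
    unfolding cinner_prod_def complex_cnj_add using cinner_commute by metis
  show "cinner (x + y) z = cinner x z + cinner y z"
    by (simp add: cinner_prod_def cinner_add_left)
  show "cinner (c *\<^sub>C x) y = c * cinner x y"
    by (simp add: cinner_prod_def scaleC_prod_def cinner_scaleC_left algebra_simps)
  show "cinner x x = complex_of_real ((norm x)\<^sup>2)"
    by (simp add: cinner_prod_def cinner_norm norm_prod_def)
qed

end

definition csubspace :: "'a::complex_hilbert_space set \<Rightarrow> bool"
  where "csubspace S \<longleftrightarrow>
    0 \<in> S \<and> (\<forall>x\<in>S. \<forall>y\<in>S. x + y \<in> S) \<and> (\<forall>c. \<forall>x\<in>S. c *\<^sub>C x \<in> S)"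

definition bounded_clinear :: "('a::complex_hilbert_space \<Rightarrow> 'b::complex_hilbert_space) \<Rightarrow> bool"
  where "bounded_clinear f \<longleftrightarrow> bounded_linear f \<and> (\<forall>c x. f (c *\<^sub>C x) = c *\<^sub>C f x)"

definition cadjoint ::
  "('a::complex_hilbert_space \<Rightarrow> 'b::complex_hilbert_space) \<Rightarrow> 'b \<Rightarrow> 'a"
  where "cadjoint f = (THE g. \<forall>x y. cinner (f x) y = cinner x (g y))"


section \<open>Self-adjoint operators, spectra and spectral measures\<close>

text \<open>An unbounded operator is given by its domain \<open>D\<close> and a function whose values outside \<open>D\<close>
  are irrelevant. The last conjunct says that the graph of the adjoint is the graph of the operator.\<close>

definition selfadjoint_op ::
  "'a::complex_hilbert_space set \<Rightarrow> ('a \<Rightarrow> 'a) \<Rightarrow> bool"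
  where "selfadjoint_op D A \<longleftrightarrow>
    csubspace D \<and> closure D = UNIV \<and>
    (\<forall>x\<in>D. \<forall>y\<in>D. A (x + y) = A x + A y) \<and> (\<forall>c. \<forall>x\<in>D. A (c *\<^sub>C x) = c *\<^sub>C A x) \<and>
    (\<forall>y z. (\<forall>x\<in>D. cinner (A x) y = cinner x z) \<longleftrightarrow> y \<in> D \<and> A y = z)"

definition spectrum ::
  "'a::complex_hilbert_space set \<Rightarrow> ('a \<Rightarrow> 'a) \<Rightarrow> complex set"
  where "spectrum D A = {z. \<not> (\<exists>R. bounded_clinear R \<and>
      (\<forall>y. R y \<in> D \<and> A (R y) - z *\<^sub>C R y = y) \<and> (\<forall>x\<in>D. R (A x - z *\<^sub>C x) = x))}"

text \<open>\<open>(Z - z)\<^sup>-\<^sup>1\<close> for an everywhere defined operator \<open>Z\<close>; meaningful for \<open>z\<close> outside the spectrum.\<close>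

definition resolvent ::
  "('a::complex_hilbert_space \<Rightarrow> 'a) \<Rightarrow> complex \<Rightarrow> 'a \<Rightarrow> 'a"
  where "resolvent Z z = inv (\<lambda>x. Z x - z *\<^sub>C x)"

definition projection_valued_measure ::
  "(real set \<Rightarrow> 'a::complex_hilbert_space \<Rightarrow> 'a) \<Rightarrow> bool"
  where "projection_valued_measure E \<longleftrightarrow>
    (\<forall>S\<in>sets borel. bounded_clinear (E S) \<and> (\<forall>x. E S (E S x) = E S x) \<and>
        (\<forall>x y. cinner (E S x) y = cinner x (E S y))) \<and>
    (\<forall>x. E UNIV x = x) \<and>
    (\<forall>F x. range F \<subseteq> sets borel \<longrightarrow> disjoint_family F \<longrightarrow>
        (\<lambda>n. E (F n) x) sums E (\<Union>n. F n) x)"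

definition scalar_spectral_measure ::
  "(real set \<Rightarrow> 'a::complex_hilbert_space \<Rightarrow> 'a) \<Rightarrow> 'a \<Rightarrow> real measure"
  where "scalar_spectral_measure E x =
    measure_of UNIV (sets borel) (\<lambda>S. ennreal (Re (cinner (E S x) x)))"

text \<open>\<open>A = \<integral> t E(dt)\<close>, stated through the quadratic form, which determines \<open>A\<close> by polarization.\<close>

definition spectral_measure_of ::
  "(real set \<Rightarrow> 'a::complex_hilbert_space \<Rightarrow> 'a) \<Rightarrow> 'a set \<Rightarrow> ('a \<Rightarrow> 'a) \<Rightarrow> bool"
  where "spectral_measure_of E D A \<longleftrightarrow>
    projection_valued_measure E \<and>
    D = {x. (\<integral>\<^sup>+t. ennreal (t\<^sup>2) \<partial>scalar_spectral_measure E x) < \<infinity>} \<and>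
    (\<forall>x\<in>D. cinner (A x) x = complex_of_real (\<integral>t. t \<partial>scalar_spectral_measure E x))"


section \<open>Operator-valued functions and Stieltjes integrals\<close>

definition has_op_derivative_real ::
  "(real \<Rightarrow> 'a::complex_hilbert_space \<Rightarrow> 'b::complex_hilbert_space) \<Rightarrow> ('a \<Rightarrow> 'b) \<Rightarrow> real \<Rightarrow> bool"
  where "has_op_derivative_real K K1 t \<longleftrightarrow> bounded_clinear K1 \<and>
    ((\<lambda>h. onorm (\<lambda>x. (1 / h) *\<^sub>R (K (t + h) x - K t x) - K1 x)) \<longlongrightarrow> 0) (at 0)"

definition op_holomorphic_on ::
  "(complex \<Rightarrow> 'a::complex_hilbert_space \<Rightarrow> 'b::complex_hilbert_space) \<Rightarrow> complex set \<Rightarrow> bool"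
  where "op_holomorphic_on K S \<longleftrightarrow> (\<forall>z\<in>S. \<exists>K1. bounded_clinear K1 \<and>
    ((\<lambda>h. onorm (\<lambda>x. (1 / h) *\<^sub>C (K (z + h) x - K z x) - K1 x)) \<longlongrightarrow> 0) (at 0))"

definition op_continuous_on ::
  "complex set \<Rightarrow> (complex \<Rightarrow> 'a::complex_hilbert_space \<Rightarrow> 'b::complex_hilbert_space) \<Rightarrow> bool"
  where "op_continuous_on S K \<longleftrightarrow>
    (\<forall>z\<in>S. ((\<lambda>w. onorm (\<lambda>x. K w x - K z x)) \<longlongrightarrow> 0) (at z within S))"

text \<open>Riemann-Stieltjes integral over \<open>[a,b]\<close>: limit, as the mesh tends to 0, of the sums of
  \<open>\<phi> s u v\<close> over the tagged subintervals \<open>s \<in> [u,v]\<close> of a division. Here \<open>\<phi> s u v\<close> is a value at the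
  tag \<open>s\<close> times an increment over \<open>[u,v]\<close>.\<close>

definition has_rs_integral ::
  "(real \<Rightarrow> real \<Rightarrow> real \<Rightarrow> 'v::real_normed_vector) \<Rightarrow> 'v \<Rightarrow> real \<Rightarrow> real \<Rightarrow> bool"
  where "has_rs_integral \<phi> I a b \<longleftrightarrow>
    (\<forall>e>0. \<exists>\<delta>>0. \<forall>p. p tagged_division_of {a..b} \<and> (\<forall>(s, k)\<in>p. diameter k < \<delta>) \<longrightarrow>
        norm ((\<Sum>(s, k)\<in>p. \<phi> s (Inf k) (Sup k)) - I) < e)"

text \<open>Filters of real points approaching the (possibly infinite) end points of an open interval.\<close>

definition lower_end :: "ereal \<Rightarrow> real filter"
  where "lower_end \<alpha> = filtermap real_of_ereal (at_right \<alpha>)"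

definition upper_end :: "ereal \<Rightarrow> real filter"
  where "upper_end \<beta> = filtermap real_of_ereal (at_left \<beta>)"

definition has_improper_rs_integral ::
  "(real \<Rightarrow> real \<Rightarrow> real \<Rightarrow> 'v::real_normed_vector) \<Rightarrow> 'v \<Rightarrow> ereal \<Rightarrow> ereal \<Rightarrow> bool"
  where "has_improper_rs_integral \<phi> I \<alpha> \<beta> \<longleftrightarrow>
    (\<exists>P. (\<forall>a\<in>einterval \<alpha> \<beta>. \<forall>b\<in>einterval \<alpha> \<beta>. a \<le> b \<longrightarrow> has_rs_integral \<phi> (P (a, b)) a b) \<and>
         (P \<longlongrightarrow> I) (lower_end \<alpha> \<times>\<^sub>F upper_end \<beta>))"

text \<open>\<open>\<integral> E(dt) F(t) x\<close>, the strong operator-valued Stieltjes integral over \<open>(\<alpha>,\<beta>)\<close> applied to \<open>x\<close>.\<close>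

definition has_spectral_integral ::
  "(real set \<Rightarrow> 'a::complex_hilbert_space \<Rightarrow> 'a) \<Rightarrow> ereal \<Rightarrow> ereal \<Rightarrow>
    (real \<Rightarrow> 'b::complex_hilbert_space \<Rightarrow> 'a) \<Rightarrow> 'b \<Rightarrow> 'a \<Rightarrow> bool"
  where "has_spectral_integral E \<alpha> \<beta> F x y \<longleftrightarrow>
    has_improper_rs_integral (\<lambda>s u v. E {u..<v} (F s x)) y \<alpha> \<beta>"

definition spectral_integral ::
  "(real set \<Rightarrow> 'a::complex_hilbert_space \<Rightarrow> 'a) \<Rightarrow> ereal \<Rightarrow> ereal \<Rightarrow>
    (real \<Rightarrow> 'b::complex_hilbert_space \<Rightarrow> 'a) \<Rightarrow> 'b \<Rightarrow> 'a"
  where "spectral_integral E \<alpha> \<beta> F x = (THE y. has_spectral_integral E \<alpha> \<beta> F x y)"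


section \<open>Contours\<close>

text \<open>A curve is parametrized by an interval of the real line, \<open>(\<alpha>,\<beta>)\<close> itself in the case of the
  contours obtained by deforming it.\<close>

definition rectifiable_on :: "real set \<Rightarrow> (real \<Rightarrow> complex) \<Rightarrow> bool"
  where "rectifiable_on S \<gamma> \<longleftrightarrow>
    (\<exists>M. \<forall>a b p. {a..b} \<subseteq> S \<and> p division_of {a..b} \<longrightarrow>
        (\<Sum>k\<in>p. norm (\<gamma> (Sup k) - \<gamma> (Inf k))) \<le> M)"

text \<open>\<open>\<integral> |d\<mu>| f(\<mu>)\<close> along \<open>\<gamma>\<close>. For continuous \<open>f\<close> and rectifiable \<open>\<gamma>\<close> the sums with chord lengths
  converge to the integral with respect to arc length.\<close>

definition arc_length_form ::
  "(complex \<Rightarrow> real) \<Rightarrow> (real \<Rightarrow> complex) \<Rightarrow> real \<Rightarrow> real \<Rightarrow> real \<Rightarrow> real"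
  where "arc_length_form f \<gamma> s u v = f (\<gamma> s) * norm (\<gamma> v - \<gamma> u)"

text \<open>\<open>V\<^sub>0(B,\<Gamma>) = V\<close>, in particular it is finite, i.e. the contour is admissible.
  \<open>K\<close> is the function \<open>K\<^sub>B'\<close>.\<close>

definition has_variation ::
  "(complex \<Rightarrow> 'b::complex_hilbert_space \<Rightarrow> 'b) \<Rightarrow> ereal \<Rightarrow> ereal \<Rightarrow> (real \<Rightarrow> complex) \<Rightarrow> real \<Rightarrow> bool"
  where "has_variation K \<alpha> \<beta> \<gamma> V \<longleftrightarrow>
    has_improper_rs_integral (arc_length_form (\<lambda>z. onorm (K z)) \<gamma>) V \<alpha> \<beta>"

text \<open>\<open>W = W\<^sub>1(Z,\<Gamma>) = - \<integral> d\<mu> K(\<mu>) (Z - \<mu>)\<^sup>-\<^sup>1\<close>, evaluated at vectors.\<close>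

definition is_W1 ::
  "(complex \<Rightarrow> 'b::complex_hilbert_space \<Rightarrow> 'b) \<Rightarrow> ereal \<Rightarrow> ereal \<Rightarrow> (real \<Rightarrow> complex) \<Rightarrow>
    ('b \<Rightarrow> 'b) \<Rightarrow> ('b \<Rightarrow> 'b) \<Rightarrow> bool"
  where "is_W1 K \<alpha> \<beta> \<gamma> Z W \<longleftrightarrow>
    (\<forall>x. has_improper_rs_integral
      (\<lambda>s u v. (\<gamma> v - \<gamma> u) *\<^sub>C K (\<gamma> s) (resolvent Z (\<gamma> s) x)) (- W x) \<alpha> \<beta>)"

text \<open>The deformation \<open>H\<close> keeps the end point \<open>e\<close> of the interval fixed; \<open>F\<close> is the filter of points of the
  interval approaching \<open>e\<close>. At a finite end point this is continuity of the deformation up to \<open>e\<close>.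
  An infinite end point stays at infinity, and there are arcs \<open>t \<mapsto> H (t, x)\<close>, arbitrarily far out,
  along which the integral of \<open>|d\<mu>| \<parallel>K(\<mu>)\<parallel> / |\<mu>|\<close> is arbitrarily small. The resolvent of a bounded
  operator decays like \<open>1 / |\<mu>|\<close>, so this is what makes the contributions of the connecting arcs
  vanish (as in Jordan's lemma). Without it, integrals of the form
  \<open>\<integral> d\<mu> K(\<mu>) (Z - \<mu>)\<^sup>-\<^sup>1\<close> may change under a deformation, because \<open>K\<close> may grow
  arbitrarily fast between two unbounded contours along both of which it is integrable.\<close>

definition fixes_end ::
  "(complex \<Rightarrow> 'b::complex_hilbert_space \<Rightarrow> 'b) \<Rightarrow> (real \<times> real \<Rightarrow> complex) \<Rightarrow>
    real filter \<Rightarrow> ereal \<Rightarrow> bool"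
  where "fixes_end K H F e \<longleftrightarrow>
    (if \<bar>e\<bar> \<noteq> \<infinity>
     then uniform_limit {0..1} (\<lambda>x t. H (t, x)) (\<lambda>t. complex_of_real (real_of_ereal e)) F
     else (\<forall>r. \<forall>\<^sub>F x in F. \<forall>t\<in>{0..1}. r \<le> norm (H (t, x))) \<and>
          (\<forall>\<epsilon>>0. \<exists>\<^sub>F x in F. rectifiable_on {0..1} (\<lambda>t. H (t, x)) \<and>
             (\<exists>v<\<epsilon>. has_rs_integral
                (arc_length_form (\<lambda>z. onorm (K z) / norm z) (\<lambda>t. H (t, x))) v 0 1)))"

text \<open>\<open>\<gamma>\<close> parametrizes, by \<open>(\<alpha>,\<beta>)\<close> and hence with the orientation from \<open>\<alpha>\<close> to \<open>\<beta>\<close>, a rectifiable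
  Jordan curve in \<open>D\<close> that arises from \<open>(\<alpha>,\<beta>)\<close> by the continuous deformation \<open>H\<close> with fixed end points.
  If the interval is unbounded, rectifiability can only refer to its bounded pieces.\<close>

definition deformed_contour ::
  "(complex \<Rightarrow> 'b::complex_hilbert_space \<Rightarrow> 'b) \<Rightarrow> complex set \<Rightarrow> ereal \<Rightarrow> ereal \<Rightarrow>
    (real \<Rightarrow> complex) \<Rightarrow> bool"
  where "deformed_contour K D \<alpha> \<beta> \<gamma> \<longleftrightarrow>
    inj_on \<gamma> (einterval \<alpha> \<beta>) \<and> \<gamma> ` einterval \<alpha> \<beta> \<subseteq> D \<and>
    (\<forall>r. rectifiable_on (einterval \<alpha> \<beta> \<inter> {-r..r}) \<gamma>) \<and>
    (\<exists>H. continuous_on ({0..1} \<times> einterval \<alpha> \<beta>) H \<and>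
         H ` ({0..1} \<times> einterval \<alpha> \<beta>) \<subseteq> D \<union> complex_of_real ` einterval \<alpha> \<beta> \<and>
         (\<forall>x\<in>einterval \<alpha> \<beta>. H (0, x) = complex_of_real x \<and> H (1, x) = \<gamma> x) \<and>
         fixes_end K H (lower_end \<alpha>) \<alpha> \<and> fixes_end K H (upper_end \<beta>) \<beta>)"


section \<open>Standing assumptions on the analytic continuation\<close>

text \<open>\<open>\<Delta>\<close> is the real interval, \<open>Dm\<close> the domain in the lower half-plane, \<open>cnj ` Dm\<close> the symmetric one.
  \<open>KB\<close> is the operator function \<open>K\<^sub>B\<close>, and \<open>K\<close> is its derivative on \<open>\<Delta>\<close>, together with its
  continuation to \<open>Dm\<close> and to \<open>cnj ` Dm\<close>; on the latter it is given by the symmetry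
  \<open>K(\<mu>)\<^sup>* = K(cnj \<mu>)\<close>, which makes it holomorphic there as well. Continuity on \<open>Dm \<union> \<Delta>\<close> links the values in \<open>Dm\<close> to those
  on \<open>\<Delta>\<close>.\<close>

definition continued_derivative ::
  "(real \<Rightarrow> 'b::complex_hilbert_space \<Rightarrow> 'b) \<Rightarrow> (complex \<Rightarrow> 'b \<Rightarrow> 'b) \<Rightarrow> real set \<Rightarrow>
    complex set \<Rightarrow> bool"
  where "continued_derivative KB K \<Delta> Dm \<longleftrightarrow>
    open Dm \<and> simply_connected Dm \<and> Dm \<subseteq> {z. Im z < 0} \<and> complex_of_real ` \<Delta> \<subseteq> frontier Dm \<and>
    (\<forall>t\<in>\<Delta>. has_op_derivative_real KB (K (complex_of_real t)) t) \<and>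
    (\<forall>z\<in>Dm. bounded_clinear (K z)) \<and> op_holomorphic_on K Dm \<and>
    op_continuous_on (Dm \<union> complex_of_real ` \<Delta>) K \<and>
    (\<forall>z\<in>Dm. K (cnj z) = cadjoint (K z))"

definition finite_end_bound ::
  "(complex \<Rightarrow> 'b::complex_hilbert_space \<Rightarrow> 'b) \<Rightarrow> complex set \<Rightarrow> ereal \<Rightarrow> bool"
  where "finite_end_bound K D e \<longleftrightarrow>
    (\<forall>m. e = ereal m \<longrightarrow> (\<exists>C>0. \<exists>g\<in>{-1<..0}. \<exists>r>0. \<forall>z\<in>D.
        dist z (complex_of_real m) < r \<longrightarrow> onorm (K z) \<le> C * dist z (complex_of_real m) powr g))"


section \<open>Riccati equation and block operator matrix\<close>

definition strong_riccati_solution ::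
  "'a::complex_hilbert_space set \<Rightarrow> ('a \<Rightarrow> 'a) \<Rightarrow> 'b::complex_hilbert_space set \<Rightarrow> ('b \<Rightarrow> 'b) \<Rightarrow>
    ('b \<Rightarrow> 'a) \<Rightarrow> ('a \<Rightarrow> 'b) \<Rightarrow> bool"
  where "strong_riccati_solution D0 A0 D1 A1 B Y \<longleftrightarrow>
    bounded_clinear Y \<and> Y ` D0 \<subseteq> D1 \<and>
    (\<forall>x\<in>D0. Y (A0 x) - A1 (Y x) + Y (B (Y x)) = - cadjoint B x)"

definition block_op ::
  "('a::complex_hilbert_space \<Rightarrow> 'a) \<Rightarrow> ('b::complex_hilbert_space \<Rightarrow> 'b) \<Rightarrow> ('b \<Rightarrow> 'a) \<Rightarrow>
    'a \<times> 'b \<Rightarrow> 'a \<times> 'b"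
  where "block_op A0 A1 B = (\<lambda>(x0, x1). (A0 x0 + B x1, - cadjoint B x0 + A1 x1))"

definition J_op :: "'a::complex_hilbert_space \<times> 'b::complex_hilbert_space \<Rightarrow> 'a \<times> 'b"
  where "J_op = (\<lambda>(x0, x1). (x0, - x1))"

definition graph0 :: "('a \<Rightarrow> 'b) \<Rightarrow> ('a \<times> 'b) set"
  where "graph0 Y = {(x0, Y x0) |x0. True}"

definition graph1 :: "('b \<Rightarrow> 'a) \<Rightarrow> ('a \<times> 'b) set"
  where "graph1 Y = {(Y x1, x1) |x1. True}"

definition invariant_subspace ::
  "'a::complex_hilbert_space set \<Rightarrow> ('a \<Rightarrow> 'a) \<Rightarrow> 'a set \<Rightarrow> bool"
  where "invariant_subspace D L S \<longleftrightarrow> csubspace S \<and> closed S \<and> (\<forall>x\<in>D \<inter> S. L x \<in> S)"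

end

theory Submission
  imports Defs "HOL-Probability.Probability" "HOL-Complex_Analysis.Complex_Analysis"
begin

text \<open>Put \<open>R(\<mu>) = (Z - \<mu>)\<^sup>-\<^sup>1\<close>. Since \<open>R(\<mu>) Z = 1 + \<mu> R(\<mu>)\<close> and \<open>\<integral> \<mu> E\<^sub>0(d\<mu>) = A\<^sub>0\<close>, the spectral integral
  \<open>Y = \<integral> E\<^sub>0(d\<mu>) B R(\<mu>)\<close> satisfies the Sylvester equation \<open>A\<^sub>0 Y - Y Z = - B\<close> (\<open>sylvester_equation\<close>).
  On the other hand \<open>B\<^sup>* E\<^sub>0(d\<mu>) B = K(\<mu>) d\<mu>\<close>, so \<open>B\<^sup>* Y = \<integral> K(\<mu>) R(\<mu>) d\<mu>\<close> along the interval
  (\<open>sylvester_density\<close>). The integrand is holomorphic in \<open>D\<^sup>l\<close>, because the spectrum of \<open>Z\<close> stays away from \<open>D\<^sup>l\<close>, and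
  moving the path of integration to the contour \<open>\<Gamma>\<^sup>l\<close> turns the integral into \<open>- X\<close>. Hence \<open>Z = A\<^sub>1 + X = A\<^sub>1 - B\<^sup>* Y\<close>, and the
  Sylvester equation becomes \<open>A\<^sub>0 Y - Y A\<^sub>1 + Y B\<^sup>* Y = - B\<close>. Its adjoint is the Riccati equation for \<open>Y\<^sup>*\<close>; the
  invariance of the two graphs is a restatement of these equations, and their \<open>J\<close>-orthogonality is the definition of the
  adjoint (\<open>riccati_from_sylvester\<close>).

  The spectral integral exists in the strong sense because \<open>B R(\<mu>)\<close> is continuously differentiable.
  Integration by parts gives its value on a compact interval. The errors that the cells of a division contribute are mutually
  orthogonal, so their squares add up (\<open>has_rs_spectral_integral\<close>). The decay of \<open>R\<close> bounds the integrals over all compact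
  intervals, and orthogonality of the increments turns boundedness into convergence
  (\<open>improper_spectral_integral_exists\<close>).

  The deformation of the path of integration needs care, because only \<open>\<Delta>\<^sub>0 \<subseteq> \<partial>D\<^sup>-\<close> is assumed about the way in which the domain meets
  the interval. A winding number argument shows that the existence of the deformation forces the domain to contain every
  bounded connected set that hangs below a point of the interval, avoids both curves and keeps away from the end points
  (\<open>connected_set_below_interval\<close>).
  Therefore \<open>D\<^sup>-\<close> contains half-discs centred at the points of the interval, and a primitive of the integrand on the simply connected domain
  extends continuously, with the right derivative, to the interval (\<open>strict_primitive_exists\<close>). Both integrals are then increments
  of one primitive, and only its variation between the two curves near each end point remains to be shown small. At a finite end
  point a circular arc joins the two curves inside the domain, and the growth condition with \<open>\<gamma> > -1\<close> suffices
  (\<open>finite_end_gap\<close>). At infinity the arcs traced by the deformation serve the same purpose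
  (\<open>infinite_end_gap\<close>). Results for the upper half-plane follow by reflection.\<close>

section \<open>Riemann-Stieltjes sums and end points\<close>

lemma tagged_division_cell:
  assumes p: "p tagged_division_of {a..b::real}" and sk: "(s, k) \<in> p"
  shows "a \<le> Inf k" "Inf k \<le> s" "s \<le> Sup k" "Sup k \<le> b" "k = {Inf k..Sup k}"
    "diameter k = Sup k - Inf k"
proof -
  obtain u v where k: "k = cbox u v" using tagged_division_ofD(4)[OF p sk] by blast
  have s: "s \<in> k" "k \<subseteq> {a..b}" using tagged_division_ofD(2,3)[OF p sk] by auto
  then have uv: "u \<le> s" "s \<le> v" using k by auto
  then have "Inf k = u" "Sup k = v" using k by auto
  then show "a \<le> Inf k" "Inf k \<le> s" "s \<le> Sup k" "Sup k \<le> b" "k = {Inf k..Sup k}"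
      "diameter k = Sup k - Inf k"
    using uv k s by auto
qed

lemma fine_tagged_division_exists:
  assumes "\<delta> > 0"
  shows "\<exists>p. p tagged_division_of {a..b::real} \<and> (\<forall>(s, k)\<in>p. diameter k < \<delta>)"
proof -
  have "gauge (\<lambda>s::real. ball s (\<delta>/3))" using assms by (simp add: gauge_def)
  then obtain p where p: "p tagged_division_of {a..b}" "(\<lambda>s. ball s (\<delta>/3)) fine p"
    using fine_division_exists_real by blast
  have "diameter k < \<delta>" if "(s, k) \<in> p" for s k
  proof -
    note c = tagged_division_cell[OF p(1) that]
    have "k \<subseteq> ball s (\<delta>/3)" using p(2) that by (auto simp: fine_def)
    moreover have "Inf k \<in> k" "Sup k \<in> k" using c by (metis atLeastAtMost_iff order_refl order_trans)+
    ultimately have "dist s (Inf k) < \<delta>/3" "dist s (Sup k) < \<delta>/3" by auto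
    then show ?thesis using c by (auto simp: dist_real_def)
  qed
  then show ?thesis using p(1) by blast
qed

lemma has_rs_integral_unique:
  assumes "has_rs_integral \<phi> I a b" "has_rs_integral \<phi> J a b"
  shows "I = J"
proof (rule ccontr)
  assume "I \<noteq> J"
  then have e: "norm (I - J) / 2 > 0" by simp
  obtain d1 where d1: "d1 > 0" "\<And>p. p tagged_division_of {a..b} \<and> (\<forall>(s, k)\<in>p. diameter k < d1) \<Longrightarrow>
      norm ((\<Sum>(s, k)\<in>p. \<phi> s (Inf k) (Sup k)) - I) < norm (I - J) / 2"
    using assms(1) e unfolding has_rs_integral_def by meson
  obtain d2 where d2: "d2 > 0" "\<And>p. p tagged_division_of {a..b} \<and> (\<forall>(s, k)\<in>p. diameter k < d2) \<Longrightarrow>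
      norm ((\<Sum>(s, k)\<in>p. \<phi> s (Inf k) (Sup k)) - J) < norm (I - J) / 2"
    using assms(2) e unfolding has_rs_integral_def by meson
  have "min d1 d2 > 0" using d1 d2 by simp
  then obtain p where p: "p tagged_division_of {a..b}" "\<forall>(s, k)\<in>p. diameter k < min d1 d2"
    using fine_tagged_division_exists by meson
  define S where "S = (\<Sum>(s, k)\<in>p. \<phi> s (Inf k) (Sup k))"
  have "norm (S - I) < norm (I - J) / 2" unfolding S_def by (rule d1(2)) (use p in auto)
  moreover have "norm (S - J) < norm (I - J) / 2" unfolding S_def by (rule d2(2)) (use p in auto)
  ultimately show False using norm_triangle_ineq4[of "S - J" "S - I"] by simp
qed

lemma has_rs_integral_linear:
  assumes h: "bounded_linear h" and I: "has_rs_integral \<phi> I a b"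
  shows "has_rs_integral (\<lambda>s u v. h (\<phi> s u v)) (h I) a b"
  unfolding has_rs_integral_def
proof (intro allI impI)
  interpret h: bounded_linear h by (rule h)
  fix e :: real assume e: "e > 0"
  obtain M where M: "M > 0" "\<And>x. norm (h x) \<le> norm x * M" using h.pos_bounded by blast
  have "e / M > 0" using e M by simp
  then obtain d where d: "d > 0" "\<And>p. p tagged_division_of {a..b} \<and> (\<forall>(s, k)\<in>p. diameter k < d) \<Longrightarrow>
      norm ((\<Sum>(s, k)\<in>p. \<phi> s (Inf k) (Sup k)) - I) < e / M"
    using I unfolding has_rs_integral_def by meson
  show "\<exists>\<delta>>0. \<forall>p. p tagged_division_of {a..b} \<and> (\<forall>(s, k)\<in>p. diameter k < \<delta>) \<longrightarrow>
      norm ((\<Sum>(s, k)\<in>p. h (\<phi> s (Inf k) (Sup k))) - h I) < e"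
  proof (intro exI conjI allI impI)
    fix p assume p: "p tagged_division_of {a..b} \<and> (\<forall>(s, k)\<in>p. diameter k < d)"
    have "(\<Sum>(s, k)\<in>p. h (\<phi> s (Inf k) (Sup k))) - h I = h ((\<Sum>(s, k)\<in>p. \<phi> s (Inf k) (Sup k)) - I)"
      by (simp add: h.diff h.sum case_prod_unfold)
    also have "norm \<dots> \<le> norm ((\<Sum>(s, k)\<in>p. \<phi> s (Inf k) (Sup k)) - I) * M" by (rule M)
    also have "\<dots> < e" using d(2)[OF p] M(1) by (simp add: pos_less_divide_eq)
    finally show "norm ((\<Sum>(s, k)\<in>p. h (\<phi> s (Inf k) (Sup k))) - h I) < e" .
  qed (rule d)
qed

lemma has_rs_integral_diff:
  assumes "has_rs_integral \<phi> I1 a b" "has_rs_integral \<psi> I2 a b"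
  shows "has_rs_integral (\<lambda>s u v. \<phi> s u v - \<psi> s u v) (I1 - I2) a b"
  unfolding has_rs_integral_def
proof (intro allI impI)
  fix e :: real assume "e > 0"
  then have e: "e / 2 > 0" by simp
  obtain d1 where d1: "d1 > 0" "\<And>p. p tagged_division_of {a..b} \<and> (\<forall>(s, k)\<in>p. diameter k < d1) \<Longrightarrow>
      norm ((\<Sum>(s, k)\<in>p. \<phi> s (Inf k) (Sup k)) - I1) < e / 2"
    using assms(1) e unfolding has_rs_integral_def by meson
  obtain d2 where d2: "d2 > 0" "\<And>p. p tagged_division_of {a..b} \<and> (\<forall>(s, k)\<in>p. diameter k < d2) \<Longrightarrow>
      norm ((\<Sum>(s, k)\<in>p. \<psi> s (Inf k) (Sup k)) - I2) < e / 2"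
    using assms(2) e unfolding has_rs_integral_def by meson
  show "\<exists>\<delta>>0. \<forall>p. p tagged_division_of {a..b} \<and> (\<forall>(s, k)\<in>p. diameter k < \<delta>) \<longrightarrow>
      norm ((\<Sum>(s, k)\<in>p. \<phi> s (Inf k) (Sup k) - \<psi> s (Inf k) (Sup k)) - (I1 - I2)) < e"
  proof (intro exI conjI allI impI)
    show "min d1 d2 > 0" using d1 d2 by simp
    fix p assume p: "p tagged_division_of {a..b} \<and> (\<forall>(s, k)\<in>p. diameter k < min d1 d2)"
    have 1: "norm ((\<Sum>(s, k)\<in>p. \<phi> s (Inf k) (Sup k)) - I1) < e / 2" by (rule d1(2)) (use p in auto)
    have 2: "norm ((\<Sum>(s, k)\<in>p. \<psi> s (Inf k) (Sup k)) - I2) < e / 2" by (rule d2(2)) (use p in auto)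
    have eq: "(\<Sum>(s, k)\<in>p. \<phi> s (Inf k) (Sup k) - \<psi> s (Inf k) (Sup k)) - (I1 - I2)
      = ((\<Sum>(s, k)\<in>p. \<phi> s (Inf k) (Sup k)) - I1) - ((\<Sum>(s, k)\<in>p. \<psi> s (Inf k) (Sup k)) - I2)"
      by (simp add: sum_subtractf case_prod_unfold)
    show "norm ((\<Sum>(s, k)\<in>p. \<phi> s (Inf k) (Sup k) - \<psi> s (Inf k) (Sup k)) - (I1 - I2)) < e"
      unfolding eq using 1 2 norm_triangle_ineq4 by (smt (verit) field_sum_of_halves)
  qed
qed

lemma has_rs_integral_cong:
  assumes "\<And>s u v. a \<le> u \<Longrightarrow> u \<le> s \<Longrightarrow> s \<le> v \<Longrightarrow> v \<le> b \<Longrightarrow> \<phi> s u v = \<psi> s u v"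
  shows "has_rs_integral \<phi> J a b \<longleftrightarrow> has_rs_integral \<psi> J a b"
proof -
  have eq: "(\<Sum>(s, k)\<in>p. \<phi> s (Inf k) (Sup k)) = (\<Sum>(s, k)\<in>p. \<psi> s (Inf k) (Sup k))"
    if "p tagged_division_of {a..b}" for p
    by (rule sum.cong[OF refl]) (use assms tagged_division_cell(1-4)[OF that] in auto)
  show ?thesis unfolding has_rs_integral_def
    by (intro all_cong1 imp_cong ex_cong1 conj_cong refl) (simp add: eq)
qed

text \<open>A sum over a fine division is compared with the telescoping sum of the increments of \<open>G\<close>, cell by cell.
  The weight \<open>m\<close> is the length of a cell or of the chord of a curve over it.\<close>

lemma has_rs_integral_increments:
  fixes G :: "real \<Rightarrow> 'v::real_normed_vector"
  assumes ab: "a \<le> b" and M: "M \<ge> 0"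
    and m: "\<And>p. p tagged_division_of {a..b} \<Longrightarrow> (\<Sum>(s, k)\<in>p. m (Inf k) (Sup k)) \<le> M"
    and \<phi>: "\<And>e. e > 0 \<Longrightarrow> \<exists>\<delta>>0. \<forall>s u v. a \<le> u \<and> u \<le> s \<and> s \<le> v \<and> v \<le> b \<and> v - u < \<delta> \<longrightarrow>
        norm (\<phi> s u v - (G v - G u)) \<le> e * m u v"
  shows "has_rs_integral \<phi> (G b - G a) a b"
  unfolding has_rs_integral_def
proof (intro allI impI)
  fix e :: real assume e: "e > 0"
  have e': "e / (M + 1) > 0" using e M by simp
  from \<phi>[OF this] obtain d where d: "d > 0" "\<And>s u v. a \<le> u \<and> u \<le> s \<and> s \<le> v \<and> v \<le> b \<and> v - u < d \<Longrightarrow>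
        norm (\<phi> s u v - (G v - G u)) \<le> e / (M + 1) * m u v" by blast
  show "\<exists>\<delta>>0. \<forall>p. p tagged_division_of {a..b} \<and> (\<forall>(s, k)\<in>p. diameter k < \<delta>) \<longrightarrow>
      norm ((\<Sum>(s, k)\<in>p. \<phi> s (Inf k) (Sup k)) - (G b - G a)) < e"
  proof (intro exI conjI allI impI)
    fix p assume p: "p tagged_division_of {a..b} \<and> (\<forall>(s, k)\<in>p. diameter k < d)"
    note c = tagged_division_cell[OF conjunct1[OF p]]
    have G: "G b - G a = (\<Sum>(s, k)\<in>p. G (Sup k) - G (Inf k))"
      by (rule additive_tagged_division_1[symmetric]) (use ab p in auto)
    have "norm ((\<Sum>(s, k)\<in>p. \<phi> s (Inf k) (Sup k)) - (G b - G a))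
      = norm (\<Sum>(s, k)\<in>p. \<phi> s (Inf k) (Sup k) - (G (Sup k) - G (Inf k)))"
      unfolding G by (simp add: sum_subtractf case_prod_unfold)
    also have "\<dots> \<le> (\<Sum>(s, k)\<in>p. e / (M + 1) * m (Inf k) (Sup k))"
    proof (rule sum_norm_le, clarify)
      fix s k assume "(s, k) \<in> p"
      then show "norm (\<phi> s (Inf k) (Sup k) - (G (Sup k) - G (Inf k))) \<le> e / (M + 1) * m (Inf k) (Sup k)"
        using c[of s k] p by (intro d(2)) fastforce
    qed
    also have "\<dots> = e / (M + 1) * (\<Sum>(s, k)\<in>p. m (Inf k) (Sup k))"
      by (simp add: sum_distrib_left case_prod_unfold)
    also have "\<dots> \<le> e / (M + 1) * M" using p e' by (intro mult_left_mono m) auto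
    also have "\<dots> < e" using e M by (simp add: field_simps)
    finally show "norm ((\<Sum>(s, k)\<in>p. \<phi> s (Inf k) (Sup k)) - (G b - G a)) < e" .
  qed (rule d)
qed

lemma eventually_lower_end:
  assumes "\<alpha> < \<beta>"
  shows "eventually P (lower_end \<alpha>) \<longleftrightarrow> (\<exists>c\<in>einterval \<alpha> \<beta>. \<forall>x\<in>einterval \<alpha> \<beta>. x < c \<longrightarrow> P x)"
proof -
  have "eventually P (lower_end \<alpha>) \<longleftrightarrow> (\<exists>b>\<alpha>. \<forall>y>\<alpha>. y < b \<longrightarrow> P (real_of_ereal y))"
    unfolding lower_end_def eventually_filtermap by (rule eventually_at_right[OF assms])
  also have "\<dots> \<longleftrightarrow> (\<exists>c\<in>einterval \<alpha> \<beta>. \<forall>x\<in>einterval \<alpha> \<beta>. x < c \<longrightarrow> P x)"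
  proof safe
    fix b assume b: "\<alpha> < b" "\<forall>y>\<alpha>. y < b \<longrightarrow> P (real_of_ereal y)"
    obtain c where c: "\<alpha> < ereal c" "ereal c < min b \<beta>" using ereal_dense2[of \<alpha> "min b \<beta>"] assms b by auto
    have "P x" if "x \<in> einterval \<alpha> \<beta>" "x < c" for x
    proof -
      have "\<alpha> < ereal x" "ereal x < b"
        using that c by (auto simp: einterval_def intro: less_trans[of "ereal x" "ereal c"])
      with b that show ?thesis by (metis real_of_ereal.simps(1) einterval_def mem_Collect_eq einterval_iff)
    qed
    then show "\<exists>c\<in>einterval \<alpha> \<beta>. \<forall>x\<in>einterval \<alpha> \<beta>. x < c \<longrightarrow> P x"
      using c by (intro bexI[of _ c]) (auto simp: einterval_def)
  next
    fix c assume c: "c \<in> einterval \<alpha> \<beta>" "\<forall>x\<in>einterval \<alpha> \<beta>. x < c \<longrightarrow> P x"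
    have "P (real_of_ereal y)" if y: "\<alpha> < y" "y < ereal c" for y
    proof -
      obtain x where "y = ereal x" using y by (cases y) auto
      moreover from this have "ereal x < \<beta>" using y c by (auto simp: einterval_def intro: less_trans[of _ "ereal c"])
      ultimately show ?thesis using y c by (simp add: einterval_def)
    qed
    then show "\<exists>b>\<alpha>. \<forall>y>\<alpha>. y < b \<longrightarrow> P (real_of_ereal y)"
      using c by (intro exI[of _ "ereal c"]) (auto simp: einterval_def)
  qed
  finally show ?thesis .
qed

lemma eventually_upper_end:
  assumes "\<alpha> < \<beta>"
  shows "eventually P (upper_end \<beta>) \<longleftrightarrow> (\<exists>c\<in>einterval \<alpha> \<beta>. \<forall>x\<in>einterval \<alpha> \<beta>. c < x \<longrightarrow> P x)"
proof -
  have "eventually P (upper_end \<beta>) \<longleftrightarrow> (\<exists>b<\<beta>. \<forall>y>b. y < \<beta> \<longrightarrow> P (real_of_ereal y))"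
    unfolding upper_end_def eventually_filtermap by (rule eventually_at_left[OF assms])
  also have "\<dots> \<longleftrightarrow> (\<exists>c\<in>einterval \<alpha> \<beta>. \<forall>x\<in>einterval \<alpha> \<beta>. c < x \<longrightarrow> P x)"
  proof safe
    fix b assume b: "b < \<beta>" "\<forall>y>b. y < \<beta> \<longrightarrow> P (real_of_ereal y)"
    obtain c where c: "max b \<alpha> < ereal c" "ereal c < \<beta>" using ereal_dense2[of "max b \<alpha>" \<beta>] assms b by auto
    have "P x" if "x \<in> einterval \<alpha> \<beta>" "c < x" for x
    proof -
      have "b < ereal x" "ereal x < \<beta>"
        using that c by (auto simp: einterval_def intro: less_trans[of _ "ereal c" "ereal x"])
      with b that show ?thesis by (metis real_of_ereal.simps(1) einterval_def mem_Collect_eq einterval_iff)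
    qed
    then show "\<exists>c\<in>einterval \<alpha> \<beta>. \<forall>x\<in>einterval \<alpha> \<beta>. c < x \<longrightarrow> P x"
      using c by (intro bexI[of _ c]) (auto simp: einterval_def)
  next
    fix c assume c: "c \<in> einterval \<alpha> \<beta>" "\<forall>x\<in>einterval \<alpha> \<beta>. c < x \<longrightarrow> P x"
    have "P (real_of_ereal y)" if y: "ereal c < y" "y < \<beta>" for y
    proof -
      obtain x where "y = ereal x" using y by (cases y) auto
      moreover from this have "\<alpha> < ereal x" using y c by (auto simp: einterval_def intro: less_trans[of _ "ereal c"])
      ultimately show ?thesis using y c by (simp add: einterval_def)
    qed
    then show "\<exists>b<\<beta>. \<forall>y>b. y < \<beta> \<longrightarrow> P (real_of_ereal y)"
      using c by (intro exI[of _ "ereal c"]) (auto simp: einterval_def)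
  qed
  finally show ?thesis .
qed

lemma einterval_extend_left: "\<alpha> < \<beta> \<Longrightarrow> c \<in> einterval \<alpha> \<beta> \<Longrightarrow> \<exists>x\<in>einterval \<alpha> \<beta>. x < c"
  using ereal_dense2[of \<alpha> "ereal c"] by (force simp: einterval_def intro: less_trans[of _ "ereal c"])

lemma einterval_extend_right: "\<alpha> < \<beta> \<Longrightarrow> c \<in> einterval \<alpha> \<beta> \<Longrightarrow> \<exists>x\<in>einterval \<alpha> \<beta>. c < x"
  using ereal_dense2[of "ereal c" \<beta>] unfolding einterval_def
  by simp (metis ereal_less(3) less_ereal.simps(1) less_trans)

lemma einterval_between: "a \<in> einterval \<alpha> \<beta> \<Longrightarrow> b \<in> einterval \<alpha> \<beta> \<Longrightarrow> {a..b} \<subseteq> einterval \<alpha> \<beta>"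
  unfolding einterval_def by (auto intro: less_le_trans[of \<alpha> "ereal a"] le_less_trans[of _ "ereal b"])

lemma einterval_convex: "x \<in> einterval \<alpha> \<beta> \<Longrightarrow> y \<in> einterval \<alpha> \<beta> \<Longrightarrow> x \<le> z \<Longrightarrow> z \<le> y \<Longrightarrow> z \<in> einterval \<alpha> \<beta>"
  using einterval_between by fastforce

lemma ends_not_bot:
  assumes "\<alpha> < \<beta>"
  shows "lower_end \<alpha> \<noteq> bot" "upper_end \<beta> \<noteq> bot"
proof -
  show "lower_end \<alpha> \<noteq> bot"
    unfolding trivial_limit_def eventually_lower_end[OF assms] using einterval_extend_left[OF assms] by blast
  show "upper_end \<beta> \<noteq> bot"
    unfolding trivial_limit_def eventually_upper_end[OF assms] using einterval_extend_right[OF assms] by blast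
qed

lemma eventually_ends:
  assumes "\<alpha> < \<beta>" "c \<in> einterval \<alpha> \<beta>"
  shows "\<forall>\<^sub>F x in lower_end \<alpha>. x \<in> einterval \<alpha> \<beta> \<and> x \<le> c"
    and "\<forall>\<^sub>F x in upper_end \<beta>. x \<in> einterval \<alpha> \<beta> \<and> c \<le> x"
  unfolding eventually_lower_end[OF assms(1)] eventually_upper_end[OF assms(1)]
  by (rule bexI[OF _ assms(2)], simp)+

lemma eventually_end_pairs:
  assumes "\<alpha> < \<beta>"
  shows "\<forall>\<^sub>F (a, b) in lower_end \<alpha> \<times>\<^sub>F upper_end \<beta>. a \<in> einterval \<alpha> \<beta> \<and> b \<in> einterval \<alpha> \<beta> \<and> a \<le> b"
proof -
  obtain c where c: "c \<in> einterval \<alpha> \<beta>"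
    using assms ereal_dense2 by (auto simp: einterval_def)
  show ?thesis unfolding eventually_prod_filter
    using eventually_ends[OF assms c] by (intro exI conjI) (assumption, assumption, auto)
qed

lemma has_improper_rs_integral_unique:
  assumes "\<alpha> < \<beta>" "has_improper_rs_integral \<phi> I \<alpha> \<beta>" "has_improper_rs_integral \<phi> J \<alpha> \<beta>"
  shows "I = J"
proof -
  obtain P Q where P: "\<forall>a\<in>einterval \<alpha> \<beta>. \<forall>b\<in>einterval \<alpha> \<beta>. a \<le> b \<longrightarrow> has_rs_integral \<phi> (P (a, b)) a b"
      "(P \<longlongrightarrow> I) (lower_end \<alpha> \<times>\<^sub>F upper_end \<beta>)"
    and Q: "\<forall>a\<in>einterval \<alpha> \<beta>. \<forall>b\<in>einterval \<alpha> \<beta>. a \<le> b \<longrightarrow> has_rs_integral \<phi> (Q (a, b)) a b"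
      "(Q \<longlongrightarrow> J) (lower_end \<alpha> \<times>\<^sub>F upper_end \<beta>)"
    using assms unfolding has_improper_rs_integral_def by blast
  have "\<forall>\<^sub>F ab in lower_end \<alpha> \<times>\<^sub>F upper_end \<beta>. P ab = Q ab"
    using eventually_end_pairs[OF assms(1)] by eventually_elim (use P(1) Q(1) has_rs_integral_unique in blast)
  then have "(Q \<longlongrightarrow> I) (lower_end \<alpha> \<times>\<^sub>F upper_end \<beta>)" using P(2) tendsto_cong by blast
  then show ?thesis
    using Q(2) tendsto_unique ends_not_bot[OF assms(1)] by (metis prod_filter_eq_bot)
qed

lemma has_improper_rs_integral_linear:
  assumes h: "bounded_linear h" and "has_improper_rs_integral \<phi> I \<alpha> \<beta>"
  shows "has_improper_rs_integral (\<lambda>s u v. h (\<phi> s u v)) (h I) \<alpha> \<beta>"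
proof -
  obtain P where P: "\<forall>a\<in>einterval \<alpha> \<beta>. \<forall>b\<in>einterval \<alpha> \<beta>. a \<le> b \<longrightarrow> has_rs_integral \<phi> (P (a, b)) a b"
      "(P \<longlongrightarrow> I) (lower_end \<alpha> \<times>\<^sub>F upper_end \<beta>)"
    using assms unfolding has_improper_rs_integral_def by blast
  show ?thesis unfolding has_improper_rs_integral_def
    by (rule exI[of _ "\<lambda>ab. h (P ab)"])
      (use P has_rs_integral_linear[OF h] bounded_linear.tendsto[OF h P(2)] in auto)
qed

section \<open>Primitives along curves\<close>

text \<open>Strict differentiability relative to \<open>S\<close>: both points of the difference quotient vary. Unlike a derivative within
  \<open>S\<close>, this passes from the interior of a half-disc to its diameter by taking limits, and it controls the increments of
  \<open>F\<close> along every rectifiable curve in \<open>S\<close>.\<close>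

definition strict_primitive_on :: "(complex \<Rightarrow> complex) \<Rightarrow> (complex \<Rightarrow> complex) \<Rightarrow> complex set \<Rightarrow> bool"
  where "strict_primitive_on F f S \<longleftrightarrow> (\<forall>z\<in>S. \<forall>e>0. \<exists>d>0. \<forall>u\<in>S \<inter> ball z d. \<forall>v\<in>S \<inter> ball z d.
    norm (f z * (v - u) - (F v - F u)) \<le> e * norm (v - u))"

text \<open>A Lebesgue number of the cover of \<open>{a..b}\<close> by the neighbourhoods on which strict differentiability gives the
  estimate serves as a uniform mesh size.\<close>

lemma strict_primitive_uniform_on_path:
  fixes p :: "real \<Rightarrow> complex"
  assumes F: "strict_primitive_on F f S" and f: "continuous_on S f"
    and p: "continuous_on {a..b} p" "p ` {a..b} \<subseteq> S" and e: "e > 0"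
  shows "\<exists>\<delta>>0. \<forall>s u v. a \<le> u \<and> u \<le> s \<and> s \<le> v \<and> v \<le> b \<and> v - u < \<delta> \<longrightarrow>
    norm (f (p s) * (p v - p u) - (F (p v) - F (p u))) \<le> e * norm (p v - p u)"
proof -
  have "\<exists>\<eta>>0. \<forall>s\<in>{a..b} \<inter> ball t \<eta>. \<forall>u\<in>{a..b} \<inter> ball t \<eta>. \<forall>v\<in>{a..b} \<inter> ball t \<eta>.
      norm (f (p s) * (p v - p u) - (F (p v) - F (p u))) \<le> e * norm (p v - p u)"
    if t: "t \<in> {a..b}" for t
  proof -
    have ptS: "p t \<in> S" using p t by auto
    have e2: "e / 2 > 0" using e by simp
    obtain d where d: "d > 0" "\<And>u v. u \<in> S \<inter> ball (p t) d \<Longrightarrow> v \<in> S \<inter> ball (p t) d \<Longrightarrow>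
        norm (f (p t) * (v - u) - (F v - F u)) \<le> e / 2 * norm (v - u)"
      using F ptS e2 unfolding strict_primitive_on_def by meson
    obtain d' where d': "d' > 0" "\<And>w. w \<in> S \<Longrightarrow> dist w (p t) < d' \<Longrightarrow> dist (f w) (f (p t)) < e / 2"
      using f ptS e2 unfolding continuous_on_iff by meson
    have "min d d' > 0" using d d' by simp
    then obtain \<eta> where \<eta>: "\<eta> > 0" "\<And>x. x \<in> {a..b} \<Longrightarrow> dist x t < \<eta> \<Longrightarrow> dist (p x) (p t) < min d d'"
      using p(1) t unfolding continuous_on_iff by meson
    show ?thesis
    proof (intro exI conjI ballI)
      fix s u v assume A: "s \<in> {a..b} \<inter> ball t \<eta>" "u \<in> {a..b} \<inter> ball t \<eta>" "v \<in> {a..b} \<inter> ball t \<eta>"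
      have P: "p x \<in> S" "dist (p x) (p t) < min d d'" if "x \<in> {a..b} \<inter> ball t \<eta>" for x
        using that \<eta>(2)[of x] p(2) by (auto simp: dist_commute)
      have 1: "norm (f (p t) * (p v - p u) - (F (p v) - F (p u))) \<le> e / 2 * norm (p v - p u)"
        using P[OF A(2)] P[OF A(3)] by (intro d(2)) (auto simp: dist_commute)
      have "norm (f (p s) - f (p t)) \<le> e / 2"
        using d'(2)[OF P(1)[OF A(1)]] P(2)[OF A(1)] by (simp add: dist_norm)
      then have 2: "norm ((f (p s) - f (p t)) * (p v - p u)) \<le> e / 2 * norm (p v - p u)"
        unfolding norm_mult by (intro mult_right_mono) auto
      have eq: "f (p s) * (p v - p u) - (F (p v) - F (p u))
          = (f (p s) - f (p t)) * (p v - p u) + (f (p t) * (p v - p u) - (F (p v) - F (p u)))"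
        by (simp add: algebra_simps)
      show "norm (f (p s) * (p v - p u) - (F (p v) - F (p u))) \<le> e * norm (p v - p u)"
        unfolding eq using norm_triangle_le[OF add_mono[OF 2 1]] by simp
    qed (rule \<eta>)
  qed
  then obtain \<eta> where \<eta>: "\<And>t. t \<in> {a..b} \<Longrightarrow> \<eta> t > 0"
    "\<And>t s u v. t \<in> {a..b} \<Longrightarrow> s \<in> {a..b} \<inter> ball t (\<eta> t) \<Longrightarrow> u \<in> {a..b} \<inter> ball t (\<eta> t) \<Longrightarrow>
      v \<in> {a..b} \<inter> ball t (\<eta> t) \<Longrightarrow>
      norm (f (p s) * (p v - p u) - (F (p v) - F (p u))) \<le> e * norm (p v - p u)"
    by metis
  have cov: "{a..b} \<subseteq> \<Union>((\<lambda>t. ball t (\<eta> t)) ` {a..b})" using \<eta>(1) by force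
  obtain \<delta> where \<delta>: "\<delta> > 0" "\<And>x. x \<in> {a..b} \<Longrightarrow> \<exists>G\<in>(\<lambda>t. ball t (\<eta> t)) ` {a..b}. ball x \<delta> \<subseteq> G"
    using Heine_Borel_lemma[OF compact_Icc cov] by blast
  show ?thesis
  proof (intro exI conjI allI impI)
    fix s u v assume A: "a \<le> u \<and> u \<le> s \<and> s \<le> v \<and> v \<le> b \<and> v - u < \<delta>"
    then obtain t where t: "t \<in> {a..b}" "ball u \<delta> \<subseteq> ball t (\<eta> t)" using \<delta>(2)[of u] by auto
    have "x \<in> ball t (\<eta> t)" if "u \<le> x" "x \<le> v" for x
      using t(2) A that by (force simp: dist_real_def)
    then show "norm (f (p s) * (p v - p u) - (F (p v) - F (p u))) \<le> e * norm (p v - p u)"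
      using A by (intro \<eta>(2)[OF t(1)]) auto
  qed (rule \<delta>)
qed

lemma rectifiable_on_tagged_division:
  assumes "rectifiable_on S \<gamma>" "{a..b} \<subseteq> S"
  shows "\<exists>M\<ge>0. \<forall>p. p tagged_division_of {a..b} \<longrightarrow> (\<Sum>(s, k)\<in>p. norm (\<gamma> (Sup k) - \<gamma> (Inf k))) \<le> M"
proof -
  obtain M where M: "\<And>p. p division_of {a..b} \<Longrightarrow> (\<Sum>k\<in>p. norm (\<gamma> (Sup k) - \<gamma> (Inf k))) \<le> M"
    using assms unfolding rectifiable_on_def by blast
  show ?thesis
  proof (intro exI[of _ "max M 0"] conjI allI impI)
    fix p assume p: "p tagged_division_of {a..b}"
    let ?d = "\<lambda>k. if k = {} then 0 else norm (\<gamma> (Sup k) - \<gamma> (Inf k))"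
    have "(\<Sum>(s, k)\<in>p. norm (\<gamma> (Sup k) - \<gamma> (Inf k))) = (\<Sum>(s, k)\<in>p. ?d k)"
      using tagged_division_ofD(2)[OF p] by (intro sum.cong) fastforce+
    also have "\<dots> = (\<Sum>k\<in>snd ` p. ?d k)"
      by (rule sum.over_tagged_division_lemma[OF p]) (auto simp: box_real cbox_interval)
    also have "\<dots> = (\<Sum>k\<in>snd ` p. norm (\<gamma> (Sup k) - \<gamma> (Inf k)))"
      using division_ofD(3)[OF division_of_tagged_division[OF p]] by (intro sum.cong) auto
    also have "\<dots> \<le> M" by (rule M[OF division_of_tagged_division[OF p]])
    finally show "(\<Sum>(s, k)\<in>p. norm (\<gamma> (Sup k) - \<gamma> (Inf k))) \<le> max M 0" by simp
  qed simp
qed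

lemma rs_integral_strict_primitive:
  assumes F: "strict_primitive_on F f S" and f: "continuous_on S f"
    and p: "continuous_on {a..b} p" "p ` {a..b} \<subseteq> S" and r: "rectifiable_on T p" "{a..b} \<subseteq> T" and ab: "a \<le> b"
  shows "has_rs_integral (\<lambda>s u v. f (p s) * (p v - p u)) (F (p b) - F (p a)) a b"
proof -
  obtain M where M: "M \<ge> 0" "\<And>q. q tagged_division_of {a..b} \<Longrightarrow> (\<Sum>(s, k)\<in>q. norm (p (Sup k) - p (Inf k))) \<le> M"
    using rectifiable_on_tagged_division[OF r] by blast
  show ?thesis
    by (rule has_rs_integral_increments[where G = "\<lambda>t. F (p t)" and m = "\<lambda>u v. norm (p v - p u)", OF ab M(1) M(2)])
      (assumption, rule strict_primitive_uniform_on_path[OF F f p])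
qed

text \<open>A division that is fine for both integrals compares their sums term by term.\<close>

lemma strict_primitive_increment_bound:
  assumes F: "strict_primitive_on F f S" and f: "continuous_on S f"
    and p: "continuous_on {a..b} p" "p ` {a..b} \<subseteq> S" and r: "rectifiable_on {a..b} p" and ab: "a \<le> b"
    and C: "C \<ge> 0" "\<And>t. t \<in> {a..b} \<Longrightarrow> norm (f (p t)) \<le> C * g (p t)"
    and v: "has_rs_integral (arc_length_form g p) v a b"
  shows "norm (F (p b) - F (p a)) \<le> C * v"
proof (rule field_le_epsilon)
  fix e :: real assume e: "e > 0"
  obtain d1 where d1: "d1 > 0" "\<And>q. q tagged_division_of {a..b} \<and> (\<forall>(s, k)\<in>q. diameter k < d1) \<Longrightarrow>
      norm ((\<Sum>(s, k)\<in>q. f (p s) * (p (Sup k) - p (Inf k))) - (F (p b) - F (p a))) < e / 2"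
    using rs_integral_strict_primitive[OF F f p r order_refl ab] e unfolding has_rs_integral_def by (meson half_gt_zero)
  have "e / (2 * (C + 1)) > 0" using e C by simp
  then obtain d2 where d2: "d2 > 0" "\<And>q. q tagged_division_of {a..b} \<and> (\<forall>(s, k)\<in>q. diameter k < d2) \<Longrightarrow>
      norm ((\<Sum>(s, k)\<in>q. arc_length_form g p s (Inf k) (Sup k)) - v) < e / (2 * (C + 1))"
    using v unfolding has_rs_integral_def by meson
  have "min d1 d2 > 0" using d1 d2 by simp
  then obtain q where q: "q tagged_division_of {a..b}" "\<forall>(s, k)\<in>q. diameter k < min d1 d2"
    using fine_tagged_division_exists by meson
  define S1 where "S1 = (\<Sum>(s, k)\<in>q. f (p s) * (p (Sup k) - p (Inf k)))"
  define S2 where "S2 = (\<Sum>(s, k)\<in>q. arc_length_form g p s (Inf k) (Sup k))"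
  have "norm (S1 - (F (p b) - F (p a))) < e / 2" unfolding S1_def by (rule d1(2)) (use q in auto)
  moreover have "norm (S2 - v) < e / (2 * (C + 1))" unfolding S2_def by (rule d2(2)) (use q in auto)
  moreover have "norm S1 \<le> C * S2"
    unfolding S1_def S2_def sum_distrib_left
  proof (rule sum_norm_le, clarify)
    fix s k assume "(s, k) \<in> q"
    then have "s \<in> {a..b}" using tagged_division_cell(1-4)[OF q(1)] by (meson atLeastAtMost_iff order_trans)
    then show "norm (f (p s) * (p (Sup k) - p (Inf k))) \<le> C * arc_length_form g p s (Inf k) (Sup k)"
      using C(2)[of s] by (simp add: norm_mult arc_length_form_def mult_right_mono mult.assoc[symmetric])
  qed
  moreover have "C * S2 \<le> C * v + e / 2"
  proof -
    have "C * S2 \<le> C * (v + e / (2 * (C + 1)))"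
      using calculation(2) C(1) by (intro mult_left_mono) auto
    also have "\<dots> \<le> C * v + e / 2"
    proof -
      have "C * (e / (2 * (C + 1))) \<le> e / 2" using C(1) e by (simp add: field_simps)
      then show ?thesis by (simp add: algebra_simps)
    qed
    finally show ?thesis .
  qed
  ultimately show "norm (F (p b) - F (p a)) \<le> C * v + e"
    using norm_triangle_ineq4[of S1 "S1 - (F (p b) - F (p a))"] by simp
qed

section \<open>The region swept by a deformation\<close>

text \<open>The difference of the winding numbers around two points symmetric about the axis is an integral of the Poisson
  kernel, which tends to the unit mass.\<close>

lemma winding_number_real_segment_jump:
  fixes a b t :: real
  assumes "a < t" "t < b"
  shows "((\<lambda>s. winding_number (linepath (of_real a) (of_real b)) (Complex t (- s))
    - winding_number (linepath (of_real a) (of_real b)) (Complex t s)) \<longlongrightarrow> -1) (at_right 0)"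
proof -
  let ?l = "linepath (complex_of_real a) (complex_of_real b)"
  have eq: "winding_number ?l (Complex t (- s)) - winding_number ?l (Complex t s)
      = of_real (- (arctan ((b - t) / s) - arctan ((a - t) / s)) / pi)" if s: "s > 0" for s
  proof -
    have nin: "Complex t r \<notin> path_image ?l" if "r \<noteq> 0" for r
      using that by (auto simp: path_image_linepath closed_segment_same_Im closed_segment_def complex_eq_iff)
    have "((\<lambda>w. 1 / (w - Complex t (-s)) - 1 / (w - Complex t s)) has_contour_integral
        (2 * pi * \<i> * winding_number ?l (Complex t (-s)) - 2 * pi * \<i> * winding_number ?l (Complex t s))) ?l"
      using nin s by (intro has_contour_integral_diff has_contour_integral_winding_number) auto
    then have I1: "((\<lambda>x. 1 / (complex_of_real x - Complex t (-s)) - 1 / (of_real x - Complex t s)) has_integral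
        (2 * pi * \<i> * winding_number ?l (Complex t (-s)) - 2 * pi * \<i> * winding_number ?l (Complex t s))) {a..b}"
      using assms by (subst (asm) has_contour_integral_linepath_Reals_iff) auto
    have k: "1 / (complex_of_real x - Complex t (-s)) - 1 / (of_real x - Complex t s)
        = (- 2 * \<i>) * of_real (s / ((x - t)\<^sup>2 + s\<^sup>2))" for x
    proof -
      have n: "complex_of_real x - Complex t (-s) \<noteq> 0" "complex_of_real x - Complex t s \<noteq> 0"
        using s by (auto simp: complex_eq_iff)
      have "(complex_of_real x - Complex t (-s)) * (of_real x - Complex t s) = of_real ((x - t)\<^sup>2 + s\<^sup>2)"
        by (simp add: complex_eq_iff power2_eq_square algebra_simps)
      moreover have "(of_real x - Complex t s) - (complex_of_real x - Complex t (-s)) = - 2 * \<i> * of_real s"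
        by (simp add: complex_eq_iff)
      ultimately show ?thesis using n by (simp add: diff_frac_eq)
    qed
    have "((\<lambda>x. arctan ((x - t) / s)) has_vector_derivative s / ((x - t)\<^sup>2 + s\<^sup>2)) (at x within {a..b})" for x
    proof -
      have "((\<lambda>x. arctan ((x - t) / s)) has_real_derivative s / ((x - t)\<^sup>2 + s\<^sup>2)) (at x within {a..b})"
        using s by (auto intro!: derivative_eq_intros simp: field_simps power2_eq_square add_nonneg_eq_0_iff)
      then show ?thesis by (simp add: has_real_derivative_iff_has_vector_derivative)
    qed
    then have "((\<lambda>x. s / ((x - t)\<^sup>2 + s\<^sup>2)) has_integral (arctan ((b - t) / s) - arctan ((a - t) / s))) {a..b}"
      using assms by (intro fundamental_theorem_of_calculus) auto
    then have "((\<lambda>x. (- 2 * \<i>) * of_real (s / ((x - t)\<^sup>2 + s\<^sup>2))) has_integral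
        (- 2 * \<i>) * of_real (arctan ((b - t) / s) - arctan ((a - t) / s))) {a..b}"
      by (intro has_integral_mult_right has_integral_of_real)
    then have "2 * pi * \<i> * winding_number ?l (Complex t (-s)) - 2 * pi * \<i> * winding_number ?l (Complex t s)
      = (- 2 * \<i>) * of_real (arctan ((b - t) / s) - arctan ((a - t) / s))"
      using I1 unfolding k by (rule has_integral_unique[rotated])
    then have "(2 * \<i>) * (of_real pi * (winding_number ?l (Complex t (-s)) - winding_number ?l (Complex t s)))
      = (2 * \<i>) * (- of_real (arctan ((b - t) / s) - arctan ((a - t) / s)))"
      by (simp add: algebra_simps)
    then have "of_real pi * (winding_number ?l (Complex t (-s)) - winding_number ?l (Complex t s))
      = - complex_of_real (arctan ((b - t) / s) - arctan ((a - t) / s))"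
      by (subst (asm) mult_cancel_left) auto
    then show ?thesis by (simp add: field_simps)
  qed
  have top: "filterlim (\<lambda>s::real. c / s) at_top (at_right 0)" if "c > 0" for c
    unfolding divide_inverse
    by (rule filterlim_tendsto_pos_mult_at_top[OF tendsto_const that filterlim_inverse_at_top_right])
  have 1: "filterlim (\<lambda>s. (b - t) / s) at_top (at_right 0)" using assms by (intro top) simp
  have "filterlim (\<lambda>s. - ((t - a) / s)) at_bot (at_right 0)"
    using assms top[of "t - a"] by (simp add: filterlim_uminus_at_top)
  moreover have "(\<lambda>s. - ((t - a) / s)) = (\<lambda>s. (a - t) / s)" by (simp add: minus_divide_left)
  ultimately have 2: "filterlim (\<lambda>s. (a - t) / s) at_bot (at_right 0)" by (rule subst[rotated])
  have "((\<lambda>s. - (arctan ((b - t) / s) - arctan ((a - t) / s)) / pi) \<longlongrightarrow> - (pi / 2 - (- (pi / 2))) / pi) (at_right 0)"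
    by (intro tendsto_intros filterlim_compose[OF tendsto_arctan_at_top 1] filterlim_compose[OF tendsto_arctan_at_bot 2]) auto
  then have "((\<lambda>s. complex_of_real (- (arctan ((b - t) / s) - arctan ((a - t) / s)) / pi)) \<longlongrightarrow> of_real (-1)) (at_right 0)"
    by (intro tendsto_of_real) simp
  then show ?thesis
    unfolding of_real_minus of_real_1
    by (rule Lim_transform_eventually)
      (use eq in \<open>auto simp: eventually_at_right_field intro!: exI[of _ 1]\<close>)
qed


text \<open>The topological content of a deformation of the interval into \<open>\<gamma>\<close>. That it keeps the end points
  fixed, be they finite or infinite, is expressed by the last two assumptions: the paths \<open>t \<mapsto> H (t, x)\<close> with \<open>x\<close> near an end point
  avoid a given bounded set whose closure misses that end point.\<close>

locale swept_region =
  fixes D :: "complex set" and \<alpha> \<beta> :: ereal and \<gamma> :: "real \<Rightarrow> complex" and H :: "real \<times> real \<Rightarrow> complex"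
  assumes ends_less: "\<alpha> < \<beta>" and open_D: "open D" and lower: "D \<subseteq> {z. Im z < 0}"
    and cont_H: "continuous_on ({0..1} \<times> einterval \<alpha> \<beta>) H"
    and range_H: "H ` ({0..1} \<times> einterval \<alpha> \<beta>) \<subseteq> D \<union> complex_of_real ` einterval \<alpha> \<beta>"
    and H_0: "\<And>x. x \<in> einterval \<alpha> \<beta> \<Longrightarrow> H (0, x) = complex_of_real x"
    and H_1: "\<And>x. x \<in> einterval \<alpha> \<beta> \<Longrightarrow> H (1, x) = \<gamma> x"
    and \<gamma>_in: "\<gamma> ` einterval \<alpha> \<beta> \<subseteq> D"
    and escape_lower: "\<And>C. bounded C \<Longrightarrow> (\<And>m. ereal m = \<alpha> \<Longrightarrow> complex_of_real m \<notin> closure C) \<Longrightarrow>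
      \<forall>\<^sub>F x in lower_end \<alpha>. \<forall>t\<in>{0..1}. H (t, x) \<notin> C"
    and escape_upper: "\<And>C. bounded C \<Longrightarrow> (\<And>m. ereal m = \<beta> \<Longrightarrow> complex_of_real m \<notin> closure C) \<Longrightarrow>
      \<forall>\<^sub>F x in upper_end \<beta>. \<forall>t\<in>{0..1}. H (t, x) \<notin> C"
begin

abbreviation "I \<equiv> einterval \<alpha> \<beta>"
abbreviation "S \<equiv> D \<union> complex_of_real ` einterval \<alpha> \<beta>"

lemma endpoint_notin: "ereal m \<in> {\<alpha>, \<beta>} \<Longrightarrow> m \<notin> I"
  by (auto simp: einterval_def)

lemma cont_\<gamma>: "continuous_on I \<gamma>"
proof -
  have "continuous_on I (\<lambda>x. H (1, x))"
    by (rule continuous_on_compose2[OF cont_H]) (auto intro!: continuous_intros)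
  then show ?thesis by (rule continuous_on_eq) (rule H_1)
qed

text \<open>The boundary of a large rectangle in the domain of \<open>H\<close> is mapped to a loop that is contractible in \<open>S\<close>, so it does not wind around the
  points outside \<open>S\<close>. It runs through \<open>t\<^sub>0\<close> along the real axis. Its winding number jumps by one there and vanishes
  above the axis, so it is nonzero just below, and on all of the connected set \<open>A\<close>, which the loop does not meet. Hence \<open>A\<close>
  contains no point outside \<open>S\<close>.\<close>

lemma connected_set_below_interval:
  assumes t0: "t0 \<in> I" and A: "connected A" "bounded A" "A \<inter> \<gamma> ` I = {}" "A \<inter> complex_of_real ` I = {}"
    and Aend: "\<And>m. ereal m \<in> {\<alpha>, \<beta>} \<Longrightarrow> complex_of_real m \<notin> closure A"
    and below: "\<forall>\<^sub>F s in at_right 0. Complex t0 (- s) \<in> A"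
  shows "A \<subseteq> D"
proof (rule ccontr)
  assume "\<not> A \<subseteq> D"
  then obtain w where w: "w \<in> A" "w \<notin> S" using A(4) by blast
  define C where "C = insert (complex_of_real t0) A"
  have C: "bounded C" "\<And>m. ereal m \<in> {\<alpha>, \<beta>} \<Longrightarrow> complex_of_real m \<notin> closure C"
    using A(2) Aend endpoint_notin t0 by (auto simp: C_def closure_insert)
  obtain a0 where a0: "a0 \<in> I" "\<And>x t. x \<in> I \<Longrightarrow> x < a0 \<Longrightarrow> t \<in> {0..1} \<Longrightarrow> H (t, x) \<notin> C"
    using escape_lower[OF C(1) C(2)] unfolding eventually_lower_end[OF ends_less] by auto
  obtain b0 where b0: "b0 \<in> I" "\<And>x t. x \<in> I \<Longrightarrow> b0 < x \<Longrightarrow> t \<in> {0..1} \<Longrightarrow> H (t, x) \<notin> C"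
    using escape_upper[OF C(1) C(2)] unfolding eventually_upper_end[OF ends_less] by auto
  have "min a0 t0 \<in> I" "max b0 t0 \<in> I" using a0 b0 t0 by (simp_all add: min_def max_def)
  then obtain a b where a: "a \<in> I" "a < min a0 t0" and b: "b \<in> I" "max b0 t0 < b"
    using einterval_extend_left[OF ends_less] einterval_extend_right[OF ends_less] by meson
  have ab: "a < t0" "t0 < b" using a b by auto
  have abI: "{a..b} \<subseteq> I" using a b by (intro einterval_between)
  \<comment> \<open>The rectangle is placed in the complex plane in order to use its boundary path. Its bottom edge \<open>l1\<close> is mapped
    identically to the real axis, and the image of the other edges \<open>q\<close> stays away from \<open>t0\<close>.\<close>
  define T where "T = (\<lambda>z. H (Im z, Re z))"
  let ?R = "cbox (Complex a 0) (Complex b 1)"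
  have inR: "z \<in> ?R \<longleftrightarrow> Re z \<in> {a..b} \<and> Im z \<in> {0..1}" for z by (auto simp: in_cbox_complex_iff)
  have T: "continuous_on ?R T" unfolding T_def
    by (rule continuous_on_compose2[OF cont_H]) (use inR abI in \<open>auto intro!: continuous_intros\<close>)
  have TS: "T ` ?R \<subseteq> S" using range_H inR abI unfolding T_def by fast
  define l1 where "l1 = linepath (complex_of_real a) (complex_of_real b)"
  define q where "q = linepath (Complex b 0) (Complex b 1) +++ linepath (Complex b 1) (Complex a 1) +++ linepath (Complex a 1) (Complex a 0)"
  have rect: "rectpath (Complex a 0) (Complex b 1) = l1 +++ q"
    by (simp add: rectpath_def Let_def l1_def q_def complex_of_real_def)
  have fin: "pathfinish l1 = pathstart q" "pathfinish q = pathstart l1" "path l1" "path q"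
    by (auto simp: l1_def q_def complex_of_real_def)
  have l1R: "path_image l1 \<subseteq> ?R" using ab
    by (auto simp: l1_def path_image_linepath closed_segment_same_Im closed_segment_eq_real_ivl inR complex_of_real_def)
  have qpts: "z \<in> path_image q \<Longrightarrow> (Re z = b \<and> Im z \<in> {0..1}) \<or> (Im z = 1 \<and> Re z \<in> {a..b}) \<or> (Re z = a \<and> Im z \<in> {0..1})" for z
    using ab by (auto simp: q_def path_image_join closed_segment_same_Im closed_segment_same_Re closed_segment_eq_real_ivl split: if_splits)
  have qR: "path_image q \<subseteq> ?R" using qpts inR ab by fastforce
  define g where "g = (T \<circ> l1) +++ (T \<circ> q)"
  have pTl1: "path (T \<circ> l1)" "path (T \<circ> q)"
    using T l1R qR fin by (auto intro!: path_continuous_image intro: continuous_on_subset)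
  have joint: "pathfinish (T \<circ> l1) = pathstart (T \<circ> q)" using fin by (simp add: pathfinish_compose pathstart_compose)
  have g: "path g" "pathfinish g = pathstart g" using pTl1 joint fin
    by (auto simp: g_def pathfinish_compose pathstart_compose)
  have g_eq: "g = T \<circ> (l1 +++ q)" by (simp add: g_def path_compose_join)
  have l1_img: "path_image l1 = complex_of_real ` {a..b}"
    using ab by (auto simp: l1_def path_image_linepath closed_segment_same_Im closed_segment_of_real closed_segment_eq_real_ivl)
  then have imT: "T ` path_image l1 = complex_of_real ` {a..b}"
    using abI H_0 by (force simp: T_def image_image)
  have img_q: "y \<in> D \<and> (\<exists>x\<in>I. y = \<gamma> x) \<or> y \<notin> C" if "y \<in> path_image (T \<circ> q)" for y
  proof -
    from that have "y \<in> T ` path_image q" unfolding path_image_compose .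
    then obtain z where z: "z \<in> path_image q" "y = T z" by (elim imageE)
    from z(2) have yz: "y = H (Im z, Re z)" unfolding T_def .
    from qpts[OF z(1)] show ?thesis
    proof (elim disjE conjE)
      assume "Re z = b" "Im z \<in> {0..1}"
      then show ?thesis using b0(2)[of b "Im z"] b yz by simp
    next
      assume "Re z = a" "Im z \<in> {0..1}"
      then show ?thesis using a0(2)[of a "Im z"] a yz by simp
    next
      assume *: "Im z = 1" "Re z \<in> {a..b}"
      then have "Re z \<in> I" using abI by blast
      then show ?thesis using * H_1 \<gamma>_in yz by auto
    qed
  qed
  have t0q: "complex_of_real t0 \<notin> path_image (T \<circ> q)"
    using img_q[of "complex_of_real t0"] lower by (auto simp: C_def)
  have Ag: "A \<inter> path_image g = {}"
  proof -
    have "A \<inter> path_image (T \<circ> q) = {}" using img_q A(3) by (auto simp: C_def)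
    moreover have "A \<inter> path_image (T \<circ> l1) = {}" using A(4) abI imT by (auto simp: path_image_compose)
    ultimately show ?thesis unfolding g_def path_image_join[OF joint] by blast
  qed
  have gT: "path_image g \<subseteq> T ` ?R"
    unfolding g_eq path_image_compose path_image_join[OF fin(1)] using l1R qR by blast
  have wn0: "winding_number g z = 0" if "z \<notin> S" for z
  proof -
    have "homotopic_loops ?R (l1 +++ q) (linepath (Complex a 0) (Complex a 0))"
    proof (rule homotopic_loops_linear)
      fix t :: real assume t: "t \<in> {0..1}"
      have "(l1 +++ q) t \<in> path_image (l1 +++ q)" using t by (simp add: path_image_def)
      then have "(l1 +++ q) t \<in> ?R" using l1R qR path_image_join[OF fin(1)] by blast
      moreover have "linepath (Complex a 0) (Complex a 0) t \<in> ?R"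
        using ab by (simp add: linepath_refl inR)
      ultimately show "closed_segment ((l1 +++ q) t) (linepath (Complex a 0) (Complex a 0) t) \<subseteq> ?R"
        by (intro closed_segment_subset convex_box)
    qed (use fin in simp_all)
    then have "homotopic_loops (- {z}) (T \<circ> (l1 +++ q)) (T \<circ> linepath (Complex a 0) (Complex a 0))"
      by (rule homotopic_loops_continuous_image[OF _ T]) (use TS that in auto)
    then have "winding_number g z = winding_number (T \<circ> linepath (Complex a 0) (Complex a 0)) z"
      unfolding g_eq by (rule winding_number_homotopic_loops)
    also have "T \<circ> linepath (Complex a 0) (Complex a 0) = (\<lambda>_. T (Complex a 0))"
      by (auto simp: linepath_def scaleR_left_distrib[symmetric])
    also have "winding_number \<dots> z = 0"
    proof (rule winding_number_constI)
      have "Complex a 0 \<in> ?R" using ab by (simp add: inR)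
      then show "T (Complex a 0) \<noteq> z" using TS that by blast
    qed simp
    finally show ?thesis .
  qed
  have split: "winding_number g z = winding_number l1 z + winding_number (T \<circ> q) z" if "z \<notin> path_image g" for z
  proof -
    have "winding_number g z = winding_number (T \<circ> l1) z + winding_number (T \<circ> q) z"
      unfolding g_def using that pTl1 joint by (intro winding_number_join) (auto simp: g_def path_image_join)
    also have "winding_number (T \<circ> l1) z = winding_number l1 z"
    proof (rule winding_number_cong)
      fix t :: real assume "0 \<le> t" "t \<le> 1"
      then have "l1 t \<in> complex_of_real ` {a..b}" unfolding l1_img[symmetric] by (simp add: path_image_def)
      then show "(T \<circ> l1) t = l1 t" using H_0 abI by (auto simp: T_def)
    qed
    finally show ?thesis .
  qed
  have "\<forall>\<^sub>F s in at_right 0. winding_number l1 (Complex t0 (- s)) - winding_number l1 (Complex t0 s)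
      = winding_number (T \<circ> q) (Complex t0 s) - winding_number (T \<circ> q) (Complex t0 (- s))"
    using below eventually_at_right_less[of 0]
  proof eventually_elim
    fix s :: real assume s: "Complex t0 (- s) \<in> A" "0 < s"
    have 1: "Complex t0 (- s) \<notin> path_image g" using s Ag by blast
    have "Complex t0 s \<notin> S" using s lower by (auto simp: complex_eq_iff)
    then have 2: "Complex t0 s \<notin> path_image g" "winding_number g (Complex t0 s) = 0" using gT TS wn0 by blast+
    have "winding_number g (Complex t0 (- s)) = winding_number g w"
      by (rule winding_number_eq[OF g s(1) w(1) A(1) Ag])
    then have "winding_number g (Complex t0 (- s)) = 0" using wn0 w by simp
    with 2 split[OF 1] split[OF 2(1)] show "winding_number l1 (Complex t0 (- s)) - winding_number l1 (Complex t0 s)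
      = winding_number (T \<circ> q) (Complex t0 s) - winding_number (T \<circ> q) (Complex t0 (- s))"
      by (simp add: add_eq_0_iff)
  qed
  then have "((\<lambda>s. winding_number (T \<circ> q) (Complex t0 s) - winding_number (T \<circ> q) (Complex t0 (- s))) \<longlongrightarrow> -1) (at_right 0)"
    using winding_number_real_segment_jump[OF ab] unfolding l1_def[symmetric] by (rule Lim_transform_eventually[rotated])
  moreover have "((\<lambda>s. winding_number (T \<circ> q) (Complex t0 s) - winding_number (T \<circ> q) (Complex t0 (- s))) \<longlongrightarrow> 
      winding_number (T \<circ> q) (of_real t0) - winding_number (T \<circ> q) (of_real t0)) (at_right 0)"
  proof (intro tendsto_diff)
    have c: "isCont (winding_number (T \<circ> q)) (complex_of_real t0)"
      by (rule continuous_at_winding_number[OF pTl1(2) t0q])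
    have "((\<lambda>s. Complex t0 s) \<longlongrightarrow> Complex t0 0) (at_right 0)" "((\<lambda>s. Complex t0 (-s)) \<longlongrightarrow> Complex t0 (- 0)) (at_right 0)"
      by (intro tendsto_intros)+
    then show "((\<lambda>s. winding_number (T \<circ> q) (Complex t0 s)) \<longlongrightarrow> winding_number (T \<circ> q) (of_real t0)) (at_right 0)"
      "((\<lambda>s. winding_number (T \<circ> q) (Complex t0 (-s))) \<longlongrightarrow> winding_number (T \<circ> q) (of_real t0)) (at_right 0)"
      unfolding complex_of_real_def minus_zero
      by - (rule isCont_tendsto_compose[OF c[unfolded complex_of_real_def]], assumption)+
  qed
  ultimately show False using tendsto_unique trivial_limit_at_right_real by fastforce
qed


text \<open>The two end points are treated at once: \<open>\<sigma> = 1\<close> stands for the lower end and \<open>\<sigma> = -1\<close> for the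
  upper one, so that \<open>\<sigma> * x < \<sigma> * c\<close> says that \<open>x\<close> is closer to the end than \<open>c\<close>.\<close>

definition endpoint :: "real \<Rightarrow> ereal"
  where "endpoint \<sigma> = (if \<sigma> = 1 then \<alpha> else \<beta>)"

definition end_filter :: "real \<Rightarrow> real filter"
  where "end_filter \<sigma> = (if \<sigma> = 1 then lower_end \<alpha> else upper_end \<beta>)"

lemma eventually_end_filter:
  assumes "\<sigma> \<in> {1, -1}"
  shows "eventually P (end_filter \<sigma>) \<longleftrightarrow> (\<exists>c\<in>I. \<forall>x\<in>I. \<sigma> * x < \<sigma> * c \<longrightarrow> P x)"
proof (cases "\<sigma> = 1")
  case True
  then show ?thesis by (simp add: end_filter_def eventually_lower_end[OF ends_less])
next
  case False
  then show ?thesis using assms by (simp add: end_filter_def eventually_upper_end[OF ends_less])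
qed

lemma escape_end:
  assumes "\<sigma> \<in> {1, -1}" "bounded C" "\<And>m. ereal m = endpoint \<sigma> \<Longrightarrow> complex_of_real m \<notin> closure C"
  shows "\<exists>c\<in>I. \<forall>x\<in>I. \<sigma> * x < \<sigma> * c \<longrightarrow> (\<forall>t\<in>{0..1}. H (t, x) \<notin> C)"
proof -
  have "\<forall>\<^sub>F x in end_filter \<sigma>. \<forall>t\<in>{0..1}. H (t, x) \<notin> C"
    using assms escape_lower[of C] escape_upper[of C] by (auto simp: end_filter_def endpoint_def)
  then show ?thesis unfolding eventually_end_filter[OF assms(1)] .
qed

lemma closed_segment_in_I: "a \<in> I \<Longrightarrow> b \<in> I \<Longrightarrow> closed_segment a b \<subseteq> I"
  using einterval_between[of a \<alpha> \<beta> b] einterval_between[of b \<alpha> \<beta> a] by (simp add: closed_segment_eq_real_ivl)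

text \<open>Close to the end belonging to \<open>\<sigma>\<close> the curve avoids a neighbourhood of \<open>t\<close>, and what remains of the part up to \<open>c\<close> is a
  compact subset of \<open>D\<close>.\<close>

lemma \<gamma>_away_from_point:
  assumes t: "complex_of_real t \<notin> D" and \<sigma>: "\<sigma> \<in> {1, -1}" and c: "c \<in> I" and te: "ereal t \<noteq> endpoint \<sigma>"
  shows "\<exists>\<rho>>0. \<forall>y\<in>I. \<sigma> * y \<le> \<sigma> * c \<longrightarrow> \<rho> \<le> dist (\<gamma> y) (of_real t)"
proof -
  obtain \<rho>1 where \<rho>1: "\<rho>1 > 0" "\<And>m. ereal m = endpoint \<sigma> \<Longrightarrow> complex_of_real m \<notin> cball (of_real t) \<rho>1"
  proof (cases "\<exists>m. ereal m = endpoint \<sigma>")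
    case True
    then obtain m where m: "ereal m = endpoint \<sigma>" by blast
    then have pos: "\<bar>m - t\<bar> > 0" using te by auto
    have "complex_of_real m' \<notin> cball (of_real t) (\<bar>m - t\<bar> / 2)" if "ereal m' = endpoint \<sigma>" for m'
    proof -
      have "ereal m' = ereal m" by (rule trans[OF that m[symmetric]])
      then have "m' = m" by simp
      moreover have "dist (complex_of_real t) (of_real m) = \<bar>m - t\<bar>" by (simp add: dist_of_real dist_real_def abs_minus_commute)
      ultimately show ?thesis using pos by simp
    qed
    then show thesis by (rule that[OF half_gt_zero[OF pos]])
  qed (use that[of 1] in auto)
  obtain c1 where c1: "c1 \<in> I" "\<forall>x\<in>I. \<sigma> * x < \<sigma> * c1 \<longrightarrow> (\<forall>t'\<in>{0..1}. H (t', x) \<notin> cball (of_real t) \<rho>1)"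
    using escape_end[OF \<sigma> bounded_cball, of "of_real t" \<rho>1] \<rho>1(2) unfolding closure_closed[OF closed_cball] by blast
  define K where "K = closed_segment c1 c"
  have K: "K \<subseteq> I" unfolding K_def by (rule closed_segment_in_I[OF c1(1) c])
  have cK: "compact (\<gamma> ` K)"
    by (rule compact_continuous_image[OF continuous_on_subset[OF cont_\<gamma> K]]) (simp add: K_def)
  have "\<gamma> ` K \<subseteq> D" by (rule subset_trans[OF image_mono[OF K] \<gamma>_in])
  then have "complex_of_real t \<notin> \<gamma> ` K" using t by (rule contra_subsetD)
  from separate_point_closed[OF compact_imp_closed[OF cK] this]
  obtain \<rho>2 where \<rho>2: "\<rho>2 > 0" "\<forall>w\<in>\<gamma> ` K. \<rho>2 \<le> dist (of_real t) w" by auto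
  have "min \<rho>1 \<rho>2 \<le> dist (\<gamma> y) (of_real t)" if y: "y \<in> I" "\<sigma> * y \<le> \<sigma> * c" for y
  proof (cases "\<sigma> * y < \<sigma> * c1")
    case True
    have "(1::real) \<in> {0..1}" by simp
    with c1(2) True y(1) have "H (1, y) \<notin> cball (of_real t) \<rho>1" by blast
    then have "\<rho>1 \<le> dist (\<gamma> y) (of_real t)" unfolding H_1[OF y(1)] by (simp add: dist_commute)
    then show ?thesis by linarith
  next
    case False
    from \<sigma> consider "\<sigma> = 1" | "\<sigma> = -1" by blast
    then have "y \<in> K" using False y(2) by cases (simp_all add: K_def closed_segment_eq_real_ivl)
    then have "\<rho>2 \<le> dist (of_real t) (\<gamma> y)" using \<rho>2(2) by (rule bspec[rotated, OF imageI])
    then show ?thesis by (simp add: dist_commute)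
  qed
  moreover have "min \<rho>1 \<rho>2 > 0" using \<rho>1(1) \<rho>2(1) by simp
  ultimately show ?thesis by blast
qed

lemma ends_differ: "\<sigma> \<in> {1, -1} \<Longrightarrow> endpoint \<sigma> \<noteq> endpoint (- \<sigma>)"
  using ends_less by (auto simp: endpoint_def)

lemma real_notin_D: "complex_of_real t \<notin> D"
  using lower by auto

text \<open>A small half-disc below a point of the interval meets neither curve, so the preceding topological argument applies to it.\<close>

lemma half_disc_in_D:
  assumes t0: "t0 \<in> I"
  obtains r where "r > 0" "{z. dist z (of_real t0) < r \<and> Im z < 0} \<subseteq> D"
    "{z. dist z (of_real t0) < r} \<inter> \<gamma> ` I = {}" "\<And>x. \<bar>x - t0\<bar> < r \<Longrightarrow> x \<in> I"
proof -
  have te: "ereal t0 \<noteq> endpoint \<sigma>" for \<sigma> using t0 by (auto simp: endpoint_def einterval_def)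
  obtain r1 where r1: "r1 > 0" "\<And>y. y \<in> I \<Longrightarrow> 1 * y \<le> 1 * t0 \<Longrightarrow> r1 \<le> dist (\<gamma> y) (of_real t0)"
    using \<gamma>_away_from_point[OF real_notin_D _ t0 te, of 1] by auto
  obtain r2 where r2: "r2 > 0" "\<And>y. y \<in> I \<Longrightarrow> -1 * y \<le> -1 * t0 \<Longrightarrow> r2 \<le> dist (\<gamma> y) (of_real t0)"
    using \<gamma>_away_from_point[OF real_notin_D _ t0 te, of "-1"] by auto
  obtain r3 where r3: "r3 > 0" "ball t0 r3 \<subseteq> I"
    using openE[OF open_einterval t0] by blast
  define r where "r = min r1 (min r2 (r3 / 2))"
  have r: "r > 0" "r \<le> r1" "r \<le> r2" "2 * r \<le> r3" using r1 r2 r3 by (auto simp: r_def)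
  have rI: "x \<in> I" if "\<bar>x - t0\<bar> < 2 * r" for x using that r3 r by (auto simp: dist_real_def subset_iff)
  have r\<gamma>: "{z. dist z (of_real t0) < r} \<inter> \<gamma> ` I = {}"
  proof -
    have "r \<le> dist (\<gamma> y) (of_real t0)" if "y \<in> I" for y
      using r1(2)[OF that] r2(2)[OF that] r by (cases "y \<le> t0") auto
    then show ?thesis by fastforce
  qed
  define A where "A = ball (complex_of_real t0) r \<inter> {z. Im z < 0}"
  have "A \<subseteq> D"
  proof (rule connected_set_below_interval[OF t0])
    show "connected A" unfolding A_def by (intro convex_connected convex_Int convex_ball convex_halfspace_Im_lt)
    show "bounded A" unfolding A_def by auto
    show "A \<inter> \<gamma> ` I = {}" using r\<gamma> by (auto simp: A_def dist_commute)
    show "A \<inter> complex_of_real ` I = {}" by (auto simp: A_def)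
    show "complex_of_real m \<notin> closure A" if "ereal m \<in> {\<alpha>, \<beta>}" for m
    proof
      assume m: "complex_of_real m \<in> closure A"
      have "closure A \<subseteq> cball (of_real t0) r"
        unfolding A_def by (intro closure_minimal) (auto simp: dist_commute)
      then have "\<bar>m - t0\<bar> \<le> r" using m by (force simp: dist_of_real dist_real_def abs_minus_commute)
      then show False using rI[of m] r(1) endpoint_notin that by auto
    qed
    show "\<forall>\<^sub>F s in at_right 0. Complex t0 (- s) \<in> A"
      unfolding eventually_at_right_field
      by (rule exI[of _ r]) (use r in \<open>auto simp: A_def dist_norm complex_of_real_def cmod_def\<close>)
  qed
  then have "{z. dist z (of_real t0) < r \<and> Im z < 0} \<subseteq> D" by (auto simp: A_def dist_commute)
  with r(1) r\<gamma> rI show thesis by (intro that[of r]) auto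
qed

text \<open>A holomorphic primitive on \<open>D\<close> is Lipschitz on the half-discs below the points of the interval. Its limits from below extend it to
  the interval, and the mean value estimates on the half-discs persist in the limit.\<close>

lemma strict_primitive_exists:
  assumes sc: "simply_connected D" and f: "f holomorphic_on D" "continuous_on S f"
  obtains F where "strict_primitive_on F f S" "\<And>z. z \<in> D \<Longrightarrow> (F has_field_derivative f z) (at z)"
proof -
  have "\<forall>g. g holomorphic_on D \<longrightarrow> (\<exists>h. \<forall>z. z \<in> D \<longrightarrow> (h has_field_derivative g z) (at z))"
    by (rule conjunct2[OF iffD1[OF simply_connected_eq_global_primitive[OF open_D] sc]])
  from this[THEN spec, of f] f(1) have "\<exists>h. \<forall>z. z \<in> D \<longrightarrow> (h has_field_derivative f z) (at z)"
    by (rule mp)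
  then obtain F0 where F0: "\<And>z. z \<in> D \<Longrightarrow> (F0 has_field_derivative f z) (at z)" by blast
  define sh where "sh = (\<lambda>z n. z - \<i> * of_real (1 / real (Suc n)))"
  define F where "F = (\<lambda>z. lim (\<lambda>n. F0 (sh z n)))"
  have sh: "sh z \<longlonglongrightarrow> z" for z
  proof -
    have "sh z \<longlonglongrightarrow> z - \<i> * of_real 0" unfolding sh_def
      by (intro tendsto_diff tendsto_const tendsto_mult tendsto_of_real LIMSEQ_Suc[OF lim_1_over_n])
    then show ?thesis by simp
  qed
  have FD: "F z = F0 z" if "z \<in> D" for z
  proof -
    have "isCont F0 z" by (rule DERIV_isCont[OF F0[OF that]])
    then have "(\<lambda>n. F0 (sh z n)) \<longlonglongrightarrow> F0 z" by (rule isCont_tendsto_compose) (rule sh)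
    then show ?thesis unfolding F_def by (rule limI)
  qed
  have mv: "norm (c * (v - u) - (F0 v - F0 u)) \<le> e * norm (v - u)"
    if "convex U" "U \<subseteq> D" "\<And>w. w \<in> U \<Longrightarrow> norm (f w - c) \<le> e" "u \<in> U" "v \<in> U" for U c e u v
  proof -
    have "norm ((\<lambda>w. c * w - F0 w) v - (\<lambda>w. c * w - F0 w) u) \<le> e * norm (v - u)"
    proof (rule field_differentiable_bound[OF that(1)])
      show "((\<lambda>w. c * w - F0 w) has_field_derivative c - f z) (at z within U)" if "z \<in> U" for z
        by (rule DERIV_diff[OF DERIV_cmult_Id has_field_derivative_at_within[OF F0]]) (use that \<open>U \<subseteq> D\<close> in blast)
      show "norm (c - f z) \<le> e" if "z \<in> U" for z
        using \<open>\<And>w. w \<in> U \<Longrightarrow> norm (f w - c) \<le> e\<close>[OF that] by (simp add: norm_minus_commute)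
    qed (use that in auto)
    then show ?thesis by (simp add: algebra_simps)
  qed
  have "strict_primitive_on F f S"
    unfolding strict_primitive_on_def
  proof (intro ballI allI impI)
    fix z e assume z: "z \<in> S" and e: "(e::real) > 0"
    have "\<exists>d>0. \<forall>w\<in>S. dist w z < d \<longrightarrow> dist (f w) (f z) < e"
      by (rule f(2)[unfolded continuous_on_iff, rule_format, OF z e])
    then obtain d0 where d0: "d0 > 0" "\<And>w. w \<in> S \<Longrightarrow> dist w z < d0 \<Longrightarrow> dist (f w) (f z) < e"
      by blast
    show "\<exists>d>0. \<forall>u\<in>S \<inter> ball z d. \<forall>v\<in>S \<inter> ball z d. norm (f z * (v - u) - (F v - F u)) \<le> e * norm (v - u)"
    proof (cases "z \<in> D")
      case True
      obtain r where r: "r > 0" "ball z r \<subseteq> D" using openE[OF open_D True] .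
      have "norm (f z * (v - u) - (F v - F u)) \<le> e * norm (v - u)"
        if "u \<in> ball z (min r d0)" "v \<in> ball z (min r d0)" for u v
      proof -
        have sub: "ball z (min r d0) \<subseteq> D" using r(2) by auto
        then have uv: "u \<in> D" "v \<in> D" using that by blast+
        show ?thesis unfolding FD[OF uv(1)] FD[OF uv(2)]
        proof (rule mv[OF convex_ball])
          fix w assume w: "w \<in> ball z (min r d0)"
          then have "w \<in> S" using sub by blast
          moreover have "dist w z < d0" using w by (simp add: dist_commute)
          ultimately show "norm (f w - f z) \<le> e" using d0(2)[of w] by (simp add: dist_norm)
        qed (rule sub that)+
      qed
      then show ?thesis using r(1) d0(1) by (intro exI[of _ "min r d0"] conjI ballI) (simp, blast)
    next
      case False
      then obtain t0 where t0: "t0 \<in> I" "z = of_real t0" using z by auto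
      obtain r where r: "r > 0" "{z. dist z (of_real t0) < r \<and> Im z < 0} \<subseteq> D"
        by (rule half_disc_in_D[OF t0(1)])
      define d where "d = min r d0"
      define U where "U = ball z d \<inter> {z. Im z < 0}"
      have dpos: "d > 0" using r d0 by (simp add: d_def)
      have U: "convex U" "U \<subseteq> D"
        using r(2) t0(2) by (auto simp: U_def d_def convex_Int convex_halfspace_Im_lt dist_commute)
      have fU: "norm (f w - f z) \<le> e" if "w \<in> U" for w
      proof -
        have "w \<in> S" "dist w z < d0" using that U(2) by (auto simp: U_def d_def dist_commute)
        from d0(2)[OF this] show ?thesis by (simp add: dist_norm)
      qed
      have mvU: "norm (f z * (v - u) - (F0 v - F0 u)) \<le> e * norm (v - u)" if "u \<in> U" "v \<in> U" for u v
        by (rule mv[OF U _ that]) (rule fU)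
      have evU: "\<forall>\<^sub>F n in sequentially. sh u n \<in> U" if u: "u \<in> S \<inter> ball z d" for u
      proof -
        have "\<forall>\<^sub>F n in sequentially. sh u n \<in> ball z d"
          using topological_tendstoD[OF sh open_ball] u by blast
        moreover have "Im (sh u n) < 0" for n
        proof -
          have "Im (sh u n) = Im u - 1 / real (Suc n)" by (simp add: sh_def del: of_nat_Suc)
          moreover have "Im u \<le> 0" using u lower by force
          moreover have "1 / real (Suc n) > 0" by simp
          ultimately show ?thesis by linarith
        qed
        ultimately show ?thesis by (simp add: U_def)
      qed
      have limF: "(\<lambda>n. F0 (sh u n)) \<longlonglongrightarrow> F u" if u: "u \<in> S \<inter> ball z d" for u
      proof -
        obtain N where N: "\<And>n. n \<ge> N \<Longrightarrow> sh u n \<in> U" using evU[OF u] unfolding eventually_sequentially by blast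
        have lip: "norm (F0 y - F0 x) \<le> (norm (f z) + e) * norm (y - x)" if "x \<in> U" "y \<in> U" for x y
        proof -
          have "norm (F0 y - F0 x) = norm (f z * (y - x) - (f z * (y - x) - (F0 y - F0 x)))" by simp
          also have "\<dots> \<le> norm (f z * (y - x)) + norm (f z * (y - x) - (F0 y - F0 x))" by (rule norm_triangle_ineq4)
          also have "\<dots> \<le> norm (f z) * norm (y - x) + e * norm (y - x)"
            using mvU[OF that] by (simp add: norm_mult)
          finally show ?thesis by (simp add: algebra_simps)
        qed
        have "lipschitz_on (norm (f z) + e) U F0"
          by (rule lipschitz_onI) (use lip e in \<open>auto simp: dist_norm\<close>)
        then have "uniformly_continuous_on U F0" by (rule lipschitz_on_uniformly_continuous)
        moreover have "Cauchy (\<lambda>n. sh u (n + N))"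
          by (rule LIMSEQ_imp_Cauchy[OF LIMSEQ_ignore_initial_segment[OF sh]])
        ultimately have "Cauchy (\<lambda>n. F0 (sh u (n + N)))"
          by (rule uniformly_continuous_on_Cauchy) (simp add: N)
        then have "convergent (\<lambda>n. F0 (sh u (n + N)))" by (rule Cauchy_convergent)
        then have "convergent (\<lambda>n. F0 (sh u n))" by (rule convergent_ignore_initial_segment[THEN iffD1])
        then show ?thesis unfolding F_def by (simp add: convergent_LIMSEQ_iff)
      qed
      have "norm (f z * (v - u) - (F v - F u)) \<le> e * norm (v - u)"
        if u: "u \<in> S \<inter> ball z d" and v: "v \<in> S \<inter> ball z d" for u v
      proof (rule tendsto_le[OF trivial_limit_sequentially])
        show "(\<lambda>n. e * norm (sh v n - sh u n)) \<longlonglongrightarrow> e * norm (v - u)" by (intro tendsto_intros sh)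
        show "(\<lambda>n. norm (f z * (sh v n - sh u n) - (F0 (sh v n) - F0 (sh u n)))) \<longlonglongrightarrow> norm (f z * (v - u) - (F v - F u))"
          by (intro tendsto_intros sh limF u v)
        show "\<forall>\<^sub>F n in sequentially. norm (f z * (sh v n - sh u n) - (F0 (sh v n) - F0 (sh u n))) \<le> e * norm (sh v n - sh u n)"
          using evU[OF u] evU[OF v] by eventually_elim (rule mvU)
      qed
      then show ?thesis using dpos by blast
    qed
  qed
  moreover have "(F has_field_derivative f z) (at z)" if "z \<in> D" for z
    by (rule has_field_derivative_transform_within_open[OF F0[OF that] open_D that]) (simp add: FD)
  ultimately show thesis by (rule that)
qed

lemma strict_primitive_continuous:
  assumes F: "strict_primitive_on F f T"
  shows "continuous_on T F"
  unfolding continuous_on_iff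
proof (intro ballI allI impI)
  fix z e assume z: "z \<in> T" and e: "(e::real) > 0"
  obtain d where d: "d > 0" "\<And>u v. u \<in> T \<inter> ball z d \<Longrightarrow> v \<in> T \<inter> ball z d \<Longrightarrow>
      norm (f z * (v - u) - (F v - F u)) \<le> 1 * norm (v - u)"
    using F z unfolding strict_primitive_on_def by (meson zero_less_one)
  define c where "c = norm (f z) + 1"
  have c: "c > 0" by (simp add: c_def add_nonneg_pos)
  have "dist (F w) (F z) < e" if w: "w \<in> T" "dist w z < min d (e / c)" for w
  proof -
    have "norm (F w - F z) = norm (f z * (w - z) - (f z * (w - z) - (F w - F z)))" by simp
    also have "\<dots> \<le> norm (f z * (w - z)) + norm (f z * (w - z) - (F w - F z))" by (rule norm_triangle_ineq4)
    also have "\<dots> \<le> norm (f z) * norm (w - z) + 1 * norm (w - z)"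
      using d(2)[of z w] w z d(1) by (intro add_mono) (auto simp: norm_mult dist_commute)
    also have "\<dots> = c * dist w z" by (simp add: c_def algebra_simps dist_norm)
    also have "\<dots> < e" using w c by (simp add: pos_less_divide_eq mult.commute)
    finally show ?thesis by (simp add: dist_norm)
  qed
  then show "\<exists>d>0. \<forall>w\<in>T. dist w z < d \<longrightarrow> dist (F w) (F z) < e"
    using d(1) e c by (intro exI[of _ "min d (e / c)"]) auto
qed


text \<open>A circular arc around the end point \<open>m\<close> leads from the interval to its first meeting with \<open>\<gamma>\<close>. Up to there it is a connected set below the
  interval that avoids both curves, so it lies in \<open>D\<close>, where \<open>f\<close> is bounded by \<open>C \<rho> powr g\<close>; the length of the arc
  is at most \<open>\<pi> \<rho>\<close>, and \<open>g > -1\<close>.\<close>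

lemma finite_end_gap:
  assumes F: "\<And>z. z \<in> D \<Longrightarrow> (F has_field_derivative f z) (at z)" "continuous_on S F"
    and \<sigma>: "\<sigma> \<in> {1, -1}" and m: "ereal m = endpoint \<sigma>"
    and C: "C > 0" "g > -1" "r > 0"
      "\<And>z. z \<in> D \<Longrightarrow> dist z (of_real m) < r \<Longrightarrow> norm (f z) \<le> C * dist z (of_real m) powr g"
    and near: "\<And>\<rho>. \<rho> > 0 \<Longrightarrow> \<exists>c\<in>I. \<forall>y\<in>I. \<sigma> * y < \<sigma> * c \<longrightarrow> dist (\<gamma> y) (of_real m) < \<rho>"
    and \<epsilon>: "\<epsilon> > 0" and c: "c \<in> I"
  shows "\<exists>x\<in>I. \<exists>y\<in>I. \<sigma> * x < \<sigma> * c \<and> \<sigma> * y < \<sigma> * c \<and> norm (F (\<gamma> y) - F (of_real x)) < \<epsilon>"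
proof -
  have \<sigma>2: "\<sigma> * \<sigma> = 1" "- \<sigma> \<in> {1, -1}" "\<bar>\<sigma>\<bar> = 1" using \<sigma> by auto
  have m_other: "ereal m \<noteq> endpoint (- \<sigma>)" using ends_differ[OF \<sigma>] m by simp
  obtain \<rho>0 where \<rho>0: "\<rho>0 > 0" "\<And>y. y \<in> I \<Longrightarrow> \<sigma> * c \<le> \<sigma> * y \<Longrightarrow> \<rho>0 \<le> dist (\<gamma> y) (of_real m)"
    using \<gamma>_away_from_point[OF real_notin_D \<sigma>2(2) c m_other] by auto
  obtain \<rho>1 where \<rho>1: "\<rho>1 > 0" "\<And>m'. ereal m' = endpoint (- \<sigma>) \<Longrightarrow> \<rho>1 \<le> \<bar>m' - m\<bar>"
  proof (cases "\<exists>m'. ereal m' = endpoint (- \<sigma>)")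
    case True
    then obtain m' where m': "ereal m' = endpoint (- \<sigma>)" by blast
    then have "m' \<noteq> m" using m_other by auto
    then have "\<bar>m' - m\<bar> > 0" by simp
    moreover have "\<bar>m' - m\<bar> \<le> \<bar>m'' - m\<bar>" if "ereal m'' = endpoint (- \<sigma>)" for m''
      using trans[OF that m'[symmetric]] by simp
    ultimately show thesis by (rule that)
  qed (use that[of 1] in auto)
  have cm: "\<sigma> * (c - m) > 0"
    using \<sigma> m c by (auto simp: endpoint_def einterval_def split: if_splits)
  have small_in: "m + \<sigma> * \<rho> \<in> I \<and> \<sigma> * (m + \<sigma> * \<rho>) < \<sigma> * c" if \<rho>: "0 < \<rho>" "\<rho> < \<sigma> * (c - m)" for \<rho>
  proof -
    have eq: "\<sigma> * (m + \<sigma> * \<rho>) = \<sigma> * m + \<rho>" using \<sigma>2(1) by (simp add: distrib_left mult.assoc[symmetric])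
    have 1: "\<sigma> * (m + \<sigma> * \<rho>) < \<sigma> * c" unfolding eq using \<rho>(2) by (simp add: algebra_simps)
    from \<sigma> consider "\<sigma> = 1" | "\<sigma> = -1" by blast
    then have "m + \<sigma> * \<rho> \<in> I"
    proof cases
      case 1
      with m have a: "\<alpha> = ereal m" by (simp add: endpoint_def)
      have "ereal (m + \<rho>) < ereal c" using 1 \<rho> by simp
      also have "ereal c < \<beta>" using c by (simp add: einterval_def)
      finally show ?thesis using 1 \<rho> a by (simp add: einterval_def)
    next
      case 2
      with m have b: "\<beta> = ereal m" by (simp add: endpoint_def)
      have "\<alpha> < ereal c" using c by (simp add: einterval_def)
      also have "ereal c < ereal (m - \<rho>)" using 2 \<rho> by simp
      finally show ?thesis using 2 \<rho> b by (simp add: einterval_def)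
    qed
    with 1 show ?thesis by simp
  qed
  obtain \<rho> where \<rho>: "0 < \<rho>" "\<rho> < \<rho>0" "\<rho> < r" "2 * \<rho> < \<rho>1" "\<rho> < \<sigma> * (c - m)" "C * \<rho> powr g * \<rho> * pi < \<epsilon>"
  proof -
    have "((\<lambda>\<rho>::real. \<rho> powr (g + 1)) \<longlongrightarrow> 0) (at_right 0)"
    proof (rule tendsto_zero_powrI[OF tendsto_ident_at tendsto_const])
      show "\<forall>\<^sub>F \<rho>::real in at_right 0. 0 \<le> \<rho>"
        using eventually_at_right_less[of "0::real"] by eventually_elim simp
    qed (use C in simp)
    then have "((\<lambda>\<rho>. C * pi * \<rho> powr (g + 1)) \<longlongrightarrow> C * pi * 0) (at_right 0)"
      by (intro tendsto_mult tendsto_const)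
    then have "\<forall>\<^sub>F \<rho> in at_right 0. C * pi * \<rho> powr (g + 1) < \<epsilon>" using \<epsilon> by (intro order_tendstoD(2)) auto
    moreover have "\<forall>\<^sub>F \<rho> in at_right 0. \<rho> < min (min \<rho>0 r) (min (\<rho>1 / 2) (\<sigma> * (c - m)))"
      using \<rho>0(1) \<rho>1(1) C(3) cm by (intro eventually_at_rightI[of 0 "min (min \<rho>0 r) (min (\<rho>1 / 2) (\<sigma> * (c - m)))"]) auto
    ultimately have "\<forall>\<^sub>F \<rho> in at_right 0. 0 < \<rho> \<and> \<rho> < min (min \<rho>0 r) (min (\<rho>1 / 2) (\<sigma> * (c - m))) \<and> C * pi * \<rho> powr (g + 1) < \<epsilon>"
      using eventually_at_right_less[of "0::real"] by eventually_elim auto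
    then obtain \<rho> where *: "0 < \<rho>" "\<rho> < min (min \<rho>0 r) (min (\<rho>1 / 2) (\<sigma> * (c - m)))" "C * pi * \<rho> powr (g + 1) < \<epsilon>"
      using eventually_happens'[OF trivial_limit_at_right_real] by blast
    have "C * \<rho> powr g * \<rho> * pi = C * pi * \<rho> powr (g + 1)" using *(1) by (simp add: powr_add)
    then have "C * \<rho> powr g * \<rho> * pi < \<epsilon>" using *(3) by (rule ord_eq_less_trans)
    moreover have "\<rho> < \<rho>0" "\<rho> < r" "2 * \<rho> < \<rho>1" "\<rho> < \<sigma> * (c - m)" using *(2) by auto
    ultimately show thesis by (intro that[OF *(1)])
  qed
  define t0 where "t0 = m + \<sigma> * \<rho>"
  have t0: "t0 \<in> I" "\<sigma> * t0 < \<sigma> * c" using small_in[OF \<rho>(1,5)] by (auto simp: t0_def)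
  \<comment> \<open>The arc starts at \<open>t0\<close> and runs through the lower half-plane: clockwise around a lower end point, where
    \<open>\<sigma> = 1\<close>, and counterclockwise around an upper one.\<close>
  define P where "P = (\<lambda>\<zeta>. complex_of_real m + of_real (\<sigma> * \<rho>) * exp (- (\<i> * of_real \<sigma> * \<zeta>)))"
  define p where "p = (\<lambda>\<theta>::real. P (of_real \<theta>))"
  have p_alt: "p \<theta> = Complex (m + \<sigma> * \<rho> * cos \<theta>) (- \<rho> * sin \<theta>)" for \<theta>
    using \<sigma> by (auto simp: p_def P_def complex_eq_iff Re_exp Im_exp)
  have dist_p: "dist (p \<theta>) (of_real m) = \<rho>" for \<theta>
  proof -
    have "\<sigma>\<^sup>2 = 1" using \<sigma>2(1) by (simp add: power2_eq_square)
    then have "(\<sigma> * \<rho> * cos \<theta>)\<^sup>2 + (\<rho> * sin \<theta>)\<^sup>2 = \<rho>\<^sup>2 * (cos \<theta>)\<^sup>2 + \<rho>\<^sup>2 * (sin \<theta>)\<^sup>2"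
      by (simp add: power_mult_distrib)
    also have "\<dots> = \<rho>\<^sup>2" by (simp flip: distrib_left)
    finally show ?thesis using \<rho>(1) by (simp add: dist_norm p_alt cmod_def)
  qed
  have p0: "p 0 = of_real t0" by (simp add: p_alt t0_def complex_of_real_def)
  have cont_p: "continuous_on A p" for A unfolding p_def P_def by (intro continuous_intros)
  obtain c' where c': "c' \<in> I" "\<And>y. y \<in> I \<Longrightarrow> \<sigma> * y < \<sigma> * c' \<Longrightarrow> dist (\<gamma> y) (of_real m) < \<rho>"
    using near[OF \<rho>(1)] by blast
  define K where "K = closed_segment c' c"
  have K: "K \<subseteq> I" unfolding K_def by (rule closed_segment_in_I[OF c'(1) c])
  have in_K: "y \<in> K" if "y \<in> I" "dist (\<gamma> y) (of_real m) = \<rho>" for y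
  proof -
    have b: "\<not> \<sigma> * y < \<sigma> * c'" "\<not> \<sigma> * c \<le> \<sigma> * y" using c'(2)[OF that(1)] \<rho>0(2)[OF that(1)] that(2) \<rho>(2) by linarith+
    from \<sigma> consider "\<sigma> = 1" | "\<sigma> = -1" by blast
    then show ?thesis using b by cases (simp_all add: K_def closed_segment_eq_real_ivl)
  qed
  have cK: "closed (\<gamma> ` K)"
    by (rule compact_imp_closed, rule compact_continuous_image[OF continuous_on_subset[OF cont_\<gamma> K]]) (simp add: K_def)
  define T where "T = {0..pi} \<inter> p -` (\<gamma> ` K)"
  have cT: "closed T" unfolding T_def by (rule continuous_closed_preimage[OF cont_p closed_atLeastAtMost cK])
  have "T \<noteq> {}"
  proof -
    have "\<exists>y\<in>I. \<sigma> * y < \<sigma> * c'"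
    proof (cases "\<sigma> = 1")
      case True
      then show ?thesis using einterval_extend_left[OF ends_less c'(1)] by simp
    next
      case False
      then have "\<sigma> = -1" using \<sigma> by simp
      then show ?thesis using einterval_extend_right[OF ends_less c'(1)] by simp
    qed
    then obtain y1 where y1: "y1 \<in> I" "\<sigma> * y1 < \<sigma> * c'" by blast
    define h where "h = (\<lambda>y. dist (\<gamma> y) (complex_of_real m))"
    have seg: "closed_segment y1 c \<subseteq> I" by (rule closed_segment_in_I[OF y1(1) c])
    have "connected (h ` closed_segment y1 c)"
      unfolding h_def by (intro connected_continuous_image continuous_intros continuous_on_subset[OF cont_\<gamma> seg] connected_segment)
    then have "{h y1..h c} \<subseteq> h ` closed_segment y1 c"
      by (rule connected_contains_Icc) auto
    moreover have "h y1 < \<rho>" "\<rho> \<le> h c" using c'(2)[OF y1] \<rho>0(2)[OF c order_refl] \<rho>(2) by (simp_all add: h_def)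
    ultimately have "\<rho> \<in> h ` closed_segment y1 c" by fastforce
    then obtain y where y: "y \<in> I" "dist (\<gamma> y) (of_real m) = \<rho>" using seg unfolding h_def by blast
    define w where "w = \<gamma> y - of_real m"
    have w: "cmod w = \<rho>" using y by (simp add: w_def dist_norm)
    have Imw: "Im w < 0" using \<gamma>_in lower y(1) by (auto simp: w_def)
    define x where "x = \<sigma> * Re w / \<rho>"
    have x2: "1 - x\<^sup>2 = (Im w / \<rho>)\<^sup>2"
    proof -
      have "\<sigma>\<^sup>2 = 1" using \<sigma>2(1) by (simp add: power2_eq_square)
      then have "x\<^sup>2 = (Re w)\<^sup>2 / \<rho>\<^sup>2" by (simp add: x_def power_divide power_mult_distrib)
      also have "(Re w)\<^sup>2 = \<rho>\<^sup>2 - (Im w)\<^sup>2" using cmod_power2[of w] unfolding w by simp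
      finally show ?thesis using \<rho>(1) by (simp add: power_divide diff_divide_distrib)
    qed
    have "x\<^sup>2 \<le> 1" using x2 zero_le_power2[of "Im w / \<rho>"] by linarith
    then have "\<bar>x\<bar> \<le> 1" by (simp add: abs_square_le_1)
    then have x: "-1 \<le> x" "x \<le> 1" by linarith+
    define \<theta> where "\<theta> = arccos x"
    have "sin \<theta> = sqrt ((Im w / \<rho>)\<^sup>2)" unfolding \<theta>_def using x x2 by (simp add: sin_arccos)
    also have "\<dots> = - Im w / \<rho>" using Imw \<rho>(1) by (simp add: real_sqrt_abs)
    finally have s: "\<rho> * sin \<theta> = - Im w" using \<rho>(1) by simp
    have "cos \<theta> = x" unfolding \<theta>_def using x by simp
    then have "\<sigma> * \<rho> * cos \<theta> = (\<sigma> * \<sigma>) * Re w" using \<rho>(1) by (simp add: x_def)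
    then have "p \<theta> = \<gamma> y" using s \<sigma>2(1) by (simp add: p_alt complex_eq_iff w_def)
    moreover have "\<theta> \<in> {0..pi}" unfolding \<theta>_def using x by (simp add: arccos_lbound arccos_ubound)
    ultimately show ?thesis using in_K[OF y] unfolding T_def by blast
  qed
  define \<theta>1 where "\<theta>1 = Inf T"
  have bT: "bdd_below T" unfolding T_def by (rule bdd_below_Int1) simp
  have "\<theta>1 \<in> T" unfolding \<theta>1_def by (rule closed_contains_Inf[OF \<open>T \<noteq> {}\<close> bT cT])
  then obtain y where y: "y \<in> K" "p \<theta>1 = \<gamma> y" and \<theta>1: "0 \<le> \<theta>1" "\<theta>1 \<le> pi" by (auto simp: T_def)
  have yI: "y \<in> I" using y K by blast
  then have pD: "p \<theta>1 \<in> D" using \<gamma>_in y by auto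
  then have "Im (p \<theta>1) < 0" using lower by blast
  then have "sin \<theta>1 > 0" using \<rho>(1) by (simp add: p_alt zero_less_mult_iff)
  then have \<theta>1': "0 < \<theta>1" "\<theta>1 < pi" using \<theta>1 by (cases "\<theta>1 = 0"; cases "\<theta>1 = pi"; simp)+
  have first: "p \<theta> \<notin> \<gamma> ` I" if "\<theta> \<in> {0<..<\<theta>1}" for \<theta>
  proof
    assume "p \<theta> \<in> \<gamma> ` I"
    then obtain y' where y': "y' \<in> I" "p \<theta> = \<gamma> y'" by blast
    then have "y' \<in> K" using dist_p[of \<theta>] by (intro in_K) simp_all
    then have "\<theta> \<in> T" using that \<theta>1 y' by (auto simp: T_def)
    then have "\<theta>1 \<le> \<theta>" unfolding \<theta>1_def by (rule cInf_lower[OF _ bT])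
    then show False using that by simp
  qed
  obtain r' where r': "r' > 0" "{z. dist z (of_real t0) < r' \<and> Im z < 0} \<subseteq> D"
    "{z. dist z (of_real t0) < r'} \<inter> \<gamma> ` I = {}" "\<And>x. \<bar>x - t0\<bar> < r' \<Longrightarrow> x \<in> I"
    by (rule half_disc_in_D[OF t0(1)], rule that)
  define \<delta> where "\<delta> = min r' (\<rho> / 2)"
  have \<delta>: "\<delta> > 0" "\<delta> \<le> r'" "\<delta> \<le> \<rho> / 2" using r' \<rho> by (auto simp: \<delta>_def)
  define U where "U = ball (complex_of_real t0) \<delta> \<inter> {z. Im z < 0}"
  \<comment> \<open>The half-disc is added because the arc need not contain the points straight below \<open>t0\<close>.\<close>
  define A where "A = p ` {0<..<\<theta>1} \<union> U"
  have Imp: "Im (p \<theta>) < 0" if "\<theta> \<in> {0<..<\<theta>1}" for \<theta>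
    using that \<theta>1' \<rho>(1) sin_gt_zero[of \<theta>] by (simp add: p_alt)
  have dist_t0: "dist (complex_of_real t0) (of_real m) = \<rho>" using dist_p[of 0] p0 by simp
  have "A \<subseteq> D"
  proof (rule connected_set_below_interval[OF t0(1)])
    have "connected (p ` {0<..<\<theta>1})" by (intro connected_continuous_image cont_p connected_Ioo)
    moreover have "connected U" unfolding U_def by (intro convex_connected convex_Int convex_ball convex_halfspace_Im_lt)
    moreover have "p ` {0<..<\<theta>1} \<inter> U \<noteq> {}"
    proof -
      have "isCont p 0" using cont_p[of UNIV] by (simp add: continuous_on_eq_continuous_at)
      then obtain \<eta> where \<eta>: "\<eta> > 0" "\<And>\<theta>. dist \<theta> 0 < \<eta> \<Longrightarrow> dist (p \<theta>) (p 0) < \<delta>"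
        using \<delta>(1) unfolding continuous_at_eps_delta by (metis dist_norm)
      define \<theta> where "\<theta> = min \<eta> \<theta>1 / 2"
      have "\<theta> \<in> {0<..<\<theta>1}" "dist \<theta> 0 < \<eta>" using \<eta>(1) \<theta>1' by (auto simp: \<theta>_def)
      moreover from this have "p \<theta> \<in> U" using \<eta>(2)[of \<theta>] Imp[of \<theta>] by (simp add: U_def p0 dist_commute)
      ultimately show ?thesis by blast
    qed
    ultimately show "connected A" unfolding A_def by (rule connected_Un)
    have bnd: "A \<subseteq> cball (of_real m) (3 * \<rho> / 2) \<inter> - ball (of_real m) (\<rho> / 2)"
    proof
      fix z assume "z \<in> A"
      then consider "dist z (of_real m) = \<rho>" | "dist (of_real t0) z < \<delta>" unfolding A_def U_def using dist_p by auto
      then show "z \<in> cball (of_real m) (3 * \<rho> / 2) \<inter> - ball (of_real m) (\<rho> / 2)"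
      proof cases
        case 1
        then show ?thesis using \<rho>(1) by (simp add: dist_commute)
      next
        case 2
        then show ?thesis
          using dist_t0 \<delta>(3) dist_triangle[of "complex_of_real m" z "of_real t0"] dist_triangle[of "of_real t0" "complex_of_real m" z]
          by (simp add: dist_commute)
      qed
    qed
    show "bounded A" by (rule bounded_subset[OF bounded_cball]) (use bnd in blast)
    have clA: "closure A \<subseteq> cball (of_real m) (3 * \<rho> / 2) \<inter> - ball (of_real m) (\<rho> / 2)"
      by (rule closure_minimal[OF bnd]) (intro closed_Int closed_cball closed_Compl open_ball)
    have "U \<subseteq> {z. dist z (of_real t0) < r'}" using \<delta>(2) by (auto simp: U_def dist_commute)
    then show "A \<inter> \<gamma> ` I = {}" using first r'(3) unfolding A_def by blast
    have "Im z < 0" if "z \<in> A" for z using that Imp unfolding A_def U_def by blast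
    then show "A \<inter> complex_of_real ` I = {}" by fastforce
    show "complex_of_real m' \<notin> closure A" if "ereal m' \<in> {\<alpha>, \<beta>}" for m'
    proof
      assume "complex_of_real m' \<in> closure A"
      then have "dist (complex_of_real m) (of_real m') \<le> 3 * \<rho> / 2" "\<not> dist (complex_of_real m) (of_real m') < \<rho> / 2"
        using clA by auto
      then have b: "\<bar>m' - m\<bar> \<le> 3 * \<rho> / 2" "m' \<noteq> m" using \<rho>(1) unfolding dist_of_real dist_real_def by linarith+
      have "ereal m' \<noteq> endpoint \<sigma>" using b(2) m by (metis ereal.inject)
      then have "ereal m' = endpoint (- \<sigma>)" using \<open>ereal m' \<in> {\<alpha>, \<beta>}\<close> \<sigma> unfolding endpoint_def by auto
      then show False using \<rho>1(2) b(1) \<rho>(1,4) by fastforce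
    qed
    show "\<forall>\<^sub>F s in at_right 0. Complex t0 (- s) \<in> A"
      unfolding eventually_at_right_field
      by (rule exI[of _ \<delta>]) (use \<delta> in \<open>auto simp: A_def U_def dist_norm complex_of_real_def cmod_def\<close>)
  qed
  then have arcD: "p \<theta> \<in> D" if "0 < \<theta>" "\<theta> \<le> \<theta>1" for \<theta>
    using that pD unfolding A_def by (cases "\<theta> = \<theta>1") auto
  define M where "M = C * \<rho> powr g * \<rho>"
  have step: "norm (F (p \<theta>1) - F (p \<theta>)) \<le> M * pi" if \<theta>: "0 < \<theta>" "\<theta> < \<theta>1" for \<theta>
  proof -
    let ?L = "closed_segment (complex_of_real \<theta>) (of_real \<theta>1)"
    have L: "\<exists>x. \<zeta> = of_real x \<and> 0 < x \<and> x \<le> \<theta>1" if "\<zeta> \<in> ?L" for \<zeta>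
      using that \<theta> by (auto simp: closed_segment_of_real closed_segment_eq_real_ivl)
    have "norm ((\<lambda>\<zeta>. F (P \<zeta>)) (of_real \<theta>1) - (\<lambda>\<zeta>. F (P \<zeta>)) (of_real \<theta>)) \<le> M * norm (complex_of_real \<theta>1 - of_real \<theta>)"
    proof (rule field_differentiable_bound[OF convex_closed_segment])
      fix \<zeta> assume "\<zeta> \<in> ?L"
      then obtain x where x: "\<zeta> = of_real x" "0 < x" "x \<le> \<theta>1" using L by blast
      have PD: "P \<zeta> \<in> D" "dist (P \<zeta>) (of_real m) = \<rho>" using arcD[OF x(2,3)] dist_p[of x] by (simp_all add: p_def x(1))
      have "(P has_field_derivative of_real (\<sigma> * \<rho>) * (exp (- (\<i> * of_real \<sigma> * \<zeta>)) * (- (\<i> * of_real \<sigma>)))) (at \<zeta> within ?L)"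
        unfolding P_def by (auto intro!: derivative_eq_intros)
      then show "((\<lambda>\<zeta>. F (P \<zeta>)) has_field_derivative
          f (P \<zeta>) * (of_real (\<sigma> * \<rho>) * (exp (- (\<i> * of_real \<sigma> * \<zeta>)) * (- (\<i> * of_real \<sigma>))))) (at \<zeta> within ?L)"
        by (rule DERIV_chain2[where f = F and g = P, OF F(1)[OF PD(1)]])
      have "norm (of_real (\<sigma> * \<rho>) * (exp (- (\<i> * of_real \<sigma> * \<zeta>)) * (- (\<i> * of_real \<sigma>)))) = \<rho>"
        using \<sigma>2(3) \<rho>(1) x(1) by (simp add: norm_mult abs_mult)
      moreover have "norm (f (P \<zeta>)) \<le> C * \<rho> powr g" using C(4)[OF PD(1)] PD(2) \<rho>(3) by simp
      ultimately show "norm (f (P \<zeta>) * (of_real (\<sigma> * \<rho>) * (exp (- (\<i> * of_real \<sigma> * \<zeta>)) * (- (\<i> * of_real \<sigma>))))) \<le> M"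
        unfolding norm_mult[of "f (P \<zeta>)"] M_def using \<rho>(1) by (simp add: mult_right_mono)
    qed auto
    also have "norm (complex_of_real \<theta>1 - of_real \<theta>) = \<theta>1 - \<theta>" using \<theta> by (simp flip: of_real_diff)
    also have "M * (\<theta>1 - \<theta>) \<le> M * pi" unfolding M_def using \<theta> \<theta>1' C(1) \<rho>(1) by (intro mult_left_mono) auto
    finally show ?thesis by (simp add: p_def)
  qed
  have "((\<lambda>\<theta>. norm (F (p \<theta>1) - F (p \<theta>))) \<longlongrightarrow> norm (F (p \<theta>1) - F (p 0))) (at_right 0)"
  proof (rule continuous_on_Icc_at_rightD[OF _ \<theta>1'(1)])
    have "p ` {0..\<theta>1} \<subseteq> S"
    proof
      fix z assume "z \<in> p ` {0..\<theta>1}"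
      then obtain \<theta> where "z = p \<theta>" "0 \<le> \<theta>" "\<theta> \<le> \<theta>1" by auto
      then show "z \<in> S" using arcD[of \<theta>] p0 t0(1) by (cases "\<theta> = 0") auto
    qed
    then show "continuous_on {0..\<theta>1} (\<lambda>\<theta>. norm (F (p \<theta>1) - F (p \<theta>)))"
      by (intro continuous_intros continuous_on_compose2[OF F(2) cont_p])
  qed
  then have "norm (F (p \<theta>1) - F (p 0)) \<le> M * pi"
  proof (rule tendsto_upperbound)
    show "\<forall>\<^sub>F \<theta> in at_right 0. norm (F (p \<theta>1) - F (p \<theta>)) \<le> M * pi"
      unfolding eventually_at_right_field using step \<theta>1'(1) by blast
  qed simp
  then have "norm (F (\<gamma> y) - F (of_real t0)) < \<epsilon>" using \<rho>(6) y p0 by (simp add: M_def)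
  moreover have "\<sigma> * y < \<sigma> * c"
    using \<rho>0(2)[OF yI] dist_p[of \<theta>1] y(2) \<rho>(2) by fastforce
  ultimately show ?thesis using t0 yI by blast
qed

text \<open>At infinity the path \<open>t \<mapsto> H (t, x)\<close> itself joins the two curves inside \<open>S\<close>, and for suitable \<open>x\<close> the
  integral of \<open>\<kappa>\<close> along it is small. The path may run along the real axis, where the extended primitive is as good as inside.\<close>

lemma infinite_end_gap:
  assumes F: "strict_primitive_on F f S" and f: "continuous_on S f" and C: "C \<ge> 0"
    and bound: "\<And>z. z \<in> S \<Longrightarrow> r0 \<le> norm z \<Longrightarrow> norm (f z) \<le> C * \<kappa> z"
    and far: "\<forall>\<^sub>F x in Fl. x \<in> I \<and> (\<forall>t\<in>{0..1}. r0 \<le> norm (H (t, x)))"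
    and arcs: "\<And>\<epsilon>. \<epsilon> > 0 \<Longrightarrow> \<exists>\<^sub>F x in Fl. rectifiable_on {0..1} (\<lambda>t. H (t, x)) \<and>
      (\<exists>v<\<epsilon>. has_rs_integral (arc_length_form \<kappa> (\<lambda>t. H (t, x))) v 0 1)"
    and P: "eventually P Fl" and \<epsilon>: "\<epsilon> > 0"
  shows "\<exists>x\<in>I. P x \<and> norm (F (\<gamma> x) - F (of_real x)) < \<epsilon>"
proof -
  have "\<epsilon> / (C + 1) > 0" using \<epsilon> C by simp
  from frequently_eventually_conj[OF arcs[OF this] eventually_conj[OF far P]]
  obtain x v where x: "x \<in> I" "\<forall>t\<in>{0..1}. r0 \<le> norm (H (t, x))" "P x" "rectifiable_on {0..1} (\<lambda>t. H (t, x))"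
    and v: "v < \<epsilon> / (C + 1)" "has_rs_integral (arc_length_form \<kappa> (\<lambda>t. H (t, x))) v 0 1"
    by (blast dest: frequently_ex)
  have HS: "(\<lambda>t. H (t, x)) ` {0..1} \<subseteq> S" using range_H x(1) by blast
  have "norm (F (H (1, x)) - F (H (0, x))) \<le> C * v"
  proof (rule strict_primitive_increment_bound[OF F f _ HS x(4) _ C _ v(2)])
    show "continuous_on {0..1} (\<lambda>t. H (t, x))"
      by (rule continuous_on_compose2[OF cont_H]) (use x(1) in \<open>auto intro!: continuous_intros\<close>)
    show "norm (f (H (t, x))) \<le> C * \<kappa> (H (t, x))" if "t \<in> {0..1}" for t
      using bound[of "H (t, x)"] HS x(2) that by blast
  qed simp
  also have "\<dots> \<le> C * (\<epsilon> / (C + 1))" using v(1) C by (intro mult_left_mono) auto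
  also have "\<dots> < \<epsilon>" using C \<epsilon> by (simp add: field_simps)
  finally show ?thesis using x H_0 H_1 by auto
qed

text \<open>Both integrals are differences of the values of one primitive at pairs of points near the ends.\<close>

lemma integrals_agree:
  assumes F: "strict_primitive_on F f S" and f: "continuous_on S f"
    and r: "\<And>r. rectifiable_on (I \<inter> {-r..r}) \<gamma>"
    and gap_lower: "\<And>P \<epsilon>. eventually P (lower_end \<alpha>) \<Longrightarrow> \<epsilon> > 0 \<Longrightarrow>
      \<exists>x\<in>I. \<exists>y\<in>I. P x \<and> P y \<and> norm (F (\<gamma> y) - F (of_real x)) < \<epsilon>"
    and gap_upper: "\<And>P \<epsilon>. eventually P (upper_end \<beta>) \<Longrightarrow> \<epsilon> > 0 \<Longrightarrow>
      \<exists>x\<in>I. \<exists>y\<in>I. P x \<and> P y \<and> norm (F (\<gamma> y) - F (of_real x)) < \<epsilon>"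
    and I1: "has_improper_rs_integral (\<lambda>s u v. f (of_real s) * of_real (v - u)) J1 \<alpha> \<beta>"
    and I2: "has_improper_rs_integral (\<lambda>s u v. f (\<gamma> s) * (\<gamma> v - \<gamma> u)) J2 \<alpha> \<beta>"
  shows "J1 = J2"
proof (rule ccontr)
  assume "J1 \<noteq> J2"
  define e where "e = norm (J1 - J2) / 4"
  have e: "e > 0" using \<open>J1 \<noteq> J2\<close> by (simp add: e_def)
  have rs1: "has_rs_integral (\<lambda>s u v. f (of_real s) * of_real (v - u)) (F (of_real b) - F (of_real a)) a b"
    if "a \<in> I" "b \<in> I" "a \<le> b" for a b
  proof -
    have rect: "rectifiable_on {a..b} complex_of_real"
      unfolding rectifiable_on_def
    proof (intro exI allI impI, elim conjE)
      fix a' b' p assume ab': "{a'..b'} \<subseteq> {a..b}" and p: "p division_of {a'..b'}"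
      have "(\<Sum>k\<in>p. norm (complex_of_real (Sup k) - of_real (Inf k))) = (\<Sum>k\<in>p. measure lborel k)"
      proof (rule sum.cong[OF refl])
        fix k assume "k \<in> p"
        then obtain u v where "k = cbox u v" "k \<noteq> {}" using division_ofD(3,4)[OF p] by blast
        then show "norm (complex_of_real (Sup k) - of_real (Inf k)) = measure lborel k"
          by (auto simp flip: of_real_diff)
      qed
      also have "\<dots> = measure lborel (cbox a' b')" by (rule additive_content_division) (use p in simp)
      also have "\<dots> \<le> measure lborel (cbox a b)" by (rule content_subset) (use ab' in simp)
      finally show "(\<Sum>k\<in>p. norm (complex_of_real (Sup k) - of_real (Inf k))) \<le> measure lborel (cbox a b)" .
    qed
    have "complex_of_real ` {a..b} \<subseteq> S" using einterval_between[OF that(1,2)] by blast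
    from rs_integral_strict_primitive[OF F f _ this rect order_refl that(3)]
    show ?thesis by (simp add: continuous_on_of_real_id)
  qed
  have rs2: "has_rs_integral (\<lambda>s u v. f (\<gamma> s) * (\<gamma> v - \<gamma> u)) (F (\<gamma> b) - F (\<gamma> a)) a b"
    if "a \<in> I" "b \<in> I" "a \<le> b" for a b
  proof (rule rs_integral_strict_primitive[OF F f _ _ r[of "max \<bar>a\<bar> \<bar>b\<bar>"] _ that(3)])
    have ab: "{a..b} \<subseteq> I" by (rule einterval_between[OF that(1,2)])
    show "continuous_on {a..b} \<gamma>" by (rule continuous_on_subset[OF cont_\<gamma> ab])
    show "\<gamma> ` {a..b} \<subseteq> S" using \<gamma>_in ab by blast
    show "{a..b} \<subseteq> I \<inter> {- max \<bar>a\<bar> \<bar>b\<bar>..max \<bar>a\<bar> \<bar>b\<bar>}" using ab by auto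
  qed
  obtain P1 where P1: "\<forall>a\<in>I. \<forall>b\<in>I. a \<le> b \<longrightarrow> has_rs_integral (\<lambda>s u v. f (of_real s) * of_real (v - u)) (P1 (a, b)) a b"
      "(P1 \<longlongrightarrow> J1) (lower_end \<alpha> \<times>\<^sub>F upper_end \<beta>)"
    using I1 unfolding has_improper_rs_integral_def by blast
  obtain P2 where P2: "\<forall>a\<in>I. \<forall>b\<in>I. a \<le> b \<longrightarrow> has_rs_integral (\<lambda>s u v. f (\<gamma> s) * (\<gamma> v - \<gamma> u)) (P2 (a, b)) a b"
      "(P2 \<longlongrightarrow> J2) (lower_end \<alpha> \<times>\<^sub>F upper_end \<beta>)"
    using I2 unfolding has_improper_rs_integral_def by blast
  have "\<forall>\<^sub>F ab in lower_end \<alpha> \<times>\<^sub>F upper_end \<beta>. dist (P1 ab) J1 < e \<and> dist (P2 ab) J2 < e \<and>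
      fst ab \<in> I \<and> snd ab \<in> I \<and> fst ab \<le> snd ab"
    using tendstoD[OF P1(2) e] tendstoD[OF P2(2) e] eventually_end_pairs[OF ends_less]
    by eventually_elim auto
  then obtain Pl Pu where ev: "eventually Pl (lower_end \<alpha>)" "eventually Pu (upper_end \<beta>)"
    and PP: "\<And>a b. Pl a \<Longrightarrow> Pu b \<Longrightarrow> dist (P1 (a, b)) J1 < e \<and> dist (P2 (a, b)) J2 < e \<and> a \<in> I \<and> b \<in> I \<and> a \<le> b"
    unfolding eventually_prod_filter by auto
  obtain x y where xy: "Pl x" "Pl y" "norm (F (\<gamma> y) - F (of_real x)) < e" using gap_lower[OF ev(1) e] by blast
  obtain x' y' where xy': "Pu x'" "Pu y'" "norm (F (\<gamma> y') - F (of_real x')) < e" using gap_upper[OF ev(2) e] by blast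
  have e1: "P1 (x, x') = F (of_real x') - F (of_real x)"
    using PP[OF xy(1) xy'(1)] P1(1) rs1 has_rs_integral_unique by blast
  have e2: "P2 (y, y') = F (\<gamma> y') - F (\<gamma> y)"
    using PP[OF xy(2) xy'(2)] P2(1) rs2 has_rs_integral_unique by blast
  have "J1 - J2 = (J1 - P1 (x, x')) + (P2 (y, y') - J2) + (F (\<gamma> y) - F (of_real x)) - (F (\<gamma> y') - F (of_real x'))"
    unfolding e1 e2 by simp
  also have "norm \<dots> \<le> norm (J1 - P1 (x, x')) + norm (P2 (y, y') - J2) + norm (F (\<gamma> y) - F (of_real x)) + norm (F (\<gamma> y') - F (of_real x'))"
    by (intro norm_triangle_le norm_triangle_le_diff add_mono order_refl)
  also have "\<dots> < 4 * e"
    using PP[OF xy(1) xy'(1)] PP[OF xy(2) xy'(2)] xy(3) xy'(3) by (simp add: dist_norm norm_minus_commute)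
  finally show False by (simp add: e_def)
qed

end

section \<open>Complex Hilbert spaces and adjoints\<close>

lemma cinner_add_right:
  fixes x :: "'a::complex_hilbert_space"
  shows "cinner x (y + z) = cinner x y + cinner x z"
  by (metis cinner_add_left cinner_commute complex_cnj_add)

lemma cinner_scaleC_right:
  fixes x :: "'a::complex_hilbert_space"
  shows "cinner x (c *\<^sub>C y) = cnj c * cinner x y"
  by (metis cinner_commute cinner_scaleC_left complex_cnj_mult)

lemma cinner_scaleR_left: "cinner (r *\<^sub>R x) y = r *\<^sub>R cinner (x::'a::complex_hilbert_space) y"
  by (simp add: scaleR_scaleC cinner_scaleC_left scaleR_conv_of_real)

lemma cinner_scaleR_right: "cinner x (r *\<^sub>R y) = r *\<^sub>R cinner (x::'a::complex_hilbert_space) y"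
  by (simp add: scaleR_scaleC cinner_scaleC_right scaleR_conv_of_real)

lemma scaleC_one: "1 *\<^sub>C x = (x::'a::complex_hilbert_space)"
  using scaleR_scaleC[of 1 x] by simp

lemma scaleC_minus_one: "(-1) *\<^sub>C x = - (x::'a::complex_hilbert_space)"
  using scaleR_scaleC[of "-1" x] by simp

lemma scaleC_minus_right: "c *\<^sub>C (- x) = - (c *\<^sub>C (x::'a::complex_hilbert_space))"
  by (metis mult.commute scaleC_minus_one scaleC_scaleC)

lemma scaleC_minus_left: "(- c) *\<^sub>C x = - (c *\<^sub>C (x::'a::complex_hilbert_space))"
  by (metis mult_minus1 scaleC_minus_one scaleC_scaleC)

lemma scaleC_diff_right: "c *\<^sub>C (x - y) = c *\<^sub>C x - c *\<^sub>C (y::'a::complex_hilbert_space)"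
  by (metis diff_conv_add_uminus scaleC_add_right scaleC_minus_right)

lemma scaleC_diff_left: "(c - d) *\<^sub>C x = c *\<^sub>C x - d *\<^sub>C (x::'a::complex_hilbert_space)"
  by (metis diff_conv_add_uminus scaleC_add_left scaleC_minus_left)

lemma cinner_minus_left: "cinner (- x) y = - cinner (x::'a::complex_hilbert_space) y"
  by (metis cinner_scaleC_left mult_minus1 scaleC_minus_one)

lemma cinner_minus_right: "cinner x (- y) = - cinner (x::'a::complex_hilbert_space) y"
  by (metis cinner_commute cinner_minus_left complex_cnj_minus)

lemma cinner_diff_left: "cinner (x - y) z = cinner x z - cinner (y::'a::complex_hilbert_space) z"
  by (metis cinner_add_left cinner_minus_left diff_conv_add_uminus)

lemma cinner_diff_right: "cinner z (x - y) = cinner z x - cinner (z::'a::complex_hilbert_space) y"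
  by (metis cinner_add_right cinner_minus_right diff_conv_add_uminus)

lemma cinner_zero_left [simp]: "cinner 0 (x::'a::complex_hilbert_space) = 0"
  using cinner_diff_left[of 0 0 x] by simp

lemma cinner_zero_right [simp]: "cinner (x::'a::complex_hilbert_space) 0 = 0"
  using cinner_diff_right[of x 0 0] by simp

lemma cinner_eq_zero_iff [simp]: "cinner x x = 0 \<longleftrightarrow> (x::'a::complex_hilbert_space) = 0"
  by (simp add: cinner_norm)

lemma Re_cinner_self: "Re (cinner x x) = (norm (x::'a::complex_hilbert_space))\<^sup>2"
  by (simp add: cinner_norm)

lemma norm_add_square:
  "(norm (x + y))\<^sup>2 = (norm x)\<^sup>2 + 2 * Re (cinner x y) + (norm (y::'a::complex_hilbert_space))\<^sup>2"
proof -
  have "Re (cinner y x) = Re (cinner x y)" by (metis cinner_commute complex_cnj(1) complex.collapse complex.sel(1))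
  then show ?thesis
    unfolding Re_cinner_self[symmetric] by (simp add: cinner_add_left cinner_add_right)
qed

lemma norm_scaleC: "norm (c *\<^sub>C (x::'a::complex_hilbert_space)) = cmod c * norm x"
proof -
  have "complex_of_real ((norm (c *\<^sub>C x))\<^sup>2) = c * cnj c * complex_of_real ((norm x)\<^sup>2)"
    unfolding cinner_norm[symmetric] by (simp add: cinner_scaleC_left cinner_scaleC_right)
  also have "\<dots> = complex_of_real ((cmod c * norm x)\<^sup>2)"
    by (simp add: complex_norm_square power_mult_distrib del: of_real_power)
  finally have "(norm (c *\<^sub>C x))\<^sup>2 = (cmod c * norm x)\<^sup>2"
    using of_real_eq_iff by blast
  then show ?thesis by simp
qed

lemma cauchy_schwarz_cinner: "cmod (cinner x y) \<le> norm x * norm (y::'a::complex_hilbert_space)"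
proof (cases "y = 0")
  case False
  define c where "c = cinner x y / complex_of_real ((norm y)\<^sup>2)"
  have ny: "norm y > 0" using False by simp
  have "0 \<le> (norm (x + (- c) *\<^sub>C y))\<^sup>2" by simp
  also have "\<dots> = (norm x)\<^sup>2 - 2 * Re (cnj c * cinner x y) + (cmod c)\<^sup>2 * (norm y)\<^sup>2"
    by (subst norm_add_square)
      (simp add: cinner_scaleC_right norm_scaleC power_mult_distrib scaleC_minus_left cinner_minus_right)
  also have "Re (cnj c * cinner x y) = (cmod (cinner x y))\<^sup>2 / (norm y)\<^sup>2"
  proof -
    have "cnj c * cinner x y = complex_of_real ((cmod (cinner x y))\<^sup>2 / (norm y)\<^sup>2)"
      by (simp add: c_def complex_norm_square mult.commute del: of_real_power)
    then show ?thesis by (metis Re_complex_of_real)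
  qed
  also have "(cmod c)\<^sup>2 * (norm y)\<^sup>2 = (cmod (cinner x y))\<^sup>2 / (norm y)\<^sup>2"
    using ny by (simp add: c_def norm_divide power_divide power2_eq_square norm_mult field_simps)
  finally have "(cmod (cinner x y))\<^sup>2 \<le> (norm x * norm y)\<^sup>2"
    using ny by (simp add: field_simps power_mult_distrib)
  then show ?thesis by (rule power2_le_imp_le) simp
qed simp

lemma bounded_bilinear_cinner:
  "bounded_bilinear (cinner :: 'a::complex_hilbert_space \<Rightarrow> 'a \<Rightarrow> complex)"
proof
  show "\<exists>K. \<forall>a b. norm (cinner (a::'a) b) \<le> norm a * norm b * K"
    by (rule exI[of _ 1]) (simp add: cauchy_schwarz_cinner)
qed (auto simp: cinner_add_left cinner_add_right cinner_scaleR_left cinner_scaleR_right)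

lemmas tendsto_cinner = bounded_bilinear.tendsto[OF bounded_bilinear_cinner]
lemmas bounded_linear_cinner_left = bounded_bilinear.bounded_linear_left[OF bounded_bilinear_cinner]
lemmas bounded_linear_cinner_right = bounded_bilinear.bounded_linear_right[OF bounded_bilinear_cinner]

lemma cinner_sum_right: "cinner y (sum f A) = (\<Sum>i\<in>A. cinner (y::'a::complex_hilbert_space) (f i))"
  by (rule linear_sum) (rule bounded_linear.linear[OF bounded_linear_cinner_right])

lemma cinner_extensional: "(\<And>z. cinner x z = cinner y z) \<Longrightarrow> x = (y::'a::complex_hilbert_space)"
  by (metis cinner_diff_left cinner_eq_zero_iff eq_iff_diff_eq_0)

lemma cinner_extensional_right: "(\<And>z. cinner z x = cinner z y) \<Longrightarrow> x = (y::'a::complex_hilbert_space)"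
  by (metis cinner_diff_right cinner_eq_zero_iff eq_iff_diff_eq_0)

lemma bounded_linear_scaleC: "bounded_linear (\<lambda>x::'a::complex_hilbert_space. c *\<^sub>C x)"
  by (rule bounded_linear_intro[of _ "cmod c"])
    (auto simp: scaleC_add_right norm_scaleC scaleR_scaleC scaleC_scaleC mult.commute)

lemma bounded_clinear_bounded_linear: "bounded_clinear f \<Longrightarrow> bounded_linear f"
  and bounded_clinear_scaleC: "bounded_clinear f \<Longrightarrow> f (c *\<^sub>C x) = c *\<^sub>C f x"
  by (auto simp: bounded_clinear_def)

lemma bounded_clinear_compose:
  "bounded_clinear f \<Longrightarrow> bounded_clinear g \<Longrightarrow> bounded_clinear (\<lambda>x. f (g x))"
  by (auto simp: bounded_clinear_def bounded_linear_compose)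

lemma bounded_clinear_add:
  "bounded_clinear f \<Longrightarrow> bounded_clinear g \<Longrightarrow> bounded_clinear (\<lambda>x. f x + g x)"
  by (auto simp: bounded_clinear_def bounded_linear_add scaleC_add_right)

lemma bounded_clinear_diff:
  "bounded_clinear f \<Longrightarrow> bounded_clinear g \<Longrightarrow> bounded_clinear (\<lambda>x. f x - g x)"
  by (auto simp: bounded_clinear_def bounded_linear_sub scaleC_diff_right)

lemma bounded_clinear_scaleC_left:
  "bounded_clinear f \<Longrightarrow> bounded_clinear (\<lambda>x. c *\<^sub>C f x)"
  by (auto simp: bounded_clinear_def bounded_linear_scaleC bounded_linear_compose[OF bounded_linear_scaleC]
      scaleC_scaleC mult.commute)

lemma bounded_clinear_intro:
  assumes "\<And>x y. f (x + y) = f x + f y" "\<And>c x. f (c *\<^sub>C x) = c *\<^sub>C f x"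
    and "\<And>x. norm (f x) \<le> M * norm x"
  shows "bounded_clinear f"
  unfolding bounded_clinear_def using assms
  by (auto intro!: bounded_linear_intro[of f M] simp: scaleR_scaleC mult.commute)

text \<open>The vector representing a nonzero functional \<open>f\<close> is a multiple of the point of the closed affine
  hyperplane \<open>f = 1\<close> that is nearest to the origin. By the parallelogram law a minimizing sequence is a Cauchy
  sequence.\<close>

lemma riesz_representation:
  fixes f :: "'a::complex_hilbert_space \<Rightarrow> complex"
  assumes f: "bounded_linear f" and fc: "\<And>c x. f (c *\<^sub>C x) = c * f x"
  shows "\<exists>y. \<forall>x. f x = cinner x y"
proof (cases "\<forall>x. f x = 0")
  case True
  then show ?thesis by (intro exI[of _ 0]) simp
next
  case False
  interpret f: bounded_linear f by (rule f)
  from False obtain x0 where x0: "f x0 \<noteq> 0" by blast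
  define C where "C = {x. f x = 1}"
  define N where "N = (\<lambda>x::'a. (norm x)\<^sup>2)"
  define d where "d = Inf (N ` C)"
  have C0: "(1 / f x0) *\<^sub>C x0 \<in> C" using x0 by (simp add: C_def fc)
  have bdd: "bdd_below (N ` C)" by (rule bdd_belowI[of _ 0]) (auto simp: N_def)
  have dle: "d \<le> N x" if "x \<in> C" for x unfolding d_def using that bdd by (simp add: cInf_lower)
  have "\<exists>x\<in>C. N x < d + 1 / real (Suc n)" for n
  proof -
    have "Inf (N ` C) < d + 1 / real (Suc n)" by (simp add: d_def)
    then show ?thesis using cInf_less_iff[OF _ bdd] C0 by auto
  qed
  then obtain u where u: "\<And>n. u n \<in> C" "\<And>n. N (u n) < d + 1 / real (Suc n)" by metis
  have par: "N (x - y) \<le> 2 * N x + 2 * N y - 4 * d" if "x \<in> C" "y \<in> C" for x y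
  proof -
    have "(1/2) *\<^sub>R (x + y) \<in> C" using that by (simp add: C_def f.scaleR f.add scaleR_conv_of_real)
    then have "d \<le> N ((1/2) *\<^sub>R (x + y))" by (rule dle)
    then have "4 * d \<le> N (x + y)" by (simp add: N_def power_mult_distrib power2_eq_square)
    moreover have "N (x + y) + N (x - y) = 2 * N x + 2 * N y"
      using norm_add_square[of x y] norm_add_square[of x "- y"] by (simp add: N_def cinner_minus_right)
    ultimately show ?thesis by linarith
  qed
  have "Cauchy u"
  proof (rule metric_CauchyI)
    fix e :: real assume e: "e > 0"
    obtain M :: nat where M: "4 / e\<^sup>2 < real M" using reals_Archimedean2 by blast
    have M0: "M > 0" using M e by (metis divide_pos_pos gr0I less_asym of_nat_0 zero_less_numeral zero_less_power)
    show "\<exists>M. \<forall>m\<ge>M. \<forall>n\<ge>M. dist (u m) (u n) < e"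
    proof (intro exI allI impI)
      fix m n assume mn: "M \<le> m" "M \<le> n"
      have le: "1 / real (Suc k) \<le> 1 / real M" if "M \<le> k" for k
        using that M0 by (intro divide_left_mono) auto
      have "N (u m - u n) \<le> 2 * N (u m) + 2 * N (u n) - 4 * d" using par u by blast
      also have "\<dots> < 2 / real (Suc m) + 2 / real (Suc n)" using u(2)[of m] u(2)[of n] by simp
      also have "\<dots> \<le> 4 / real M" using le[OF mn(1)] le[OF mn(2)] by simp
      also have "\<dots> < e\<^sup>2" using M M0 e by (simp add: field_simps)
      finally show "dist (u m) (u n) < e"
        using e by (simp add: N_def dist_norm power2_less_imp_less)
    qed
  qed
  then obtain w where w: "u \<longlonglongrightarrow> w" using Cauchy_convergent convergent_def by blast
  have fw: "f w = 1"
  proof -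
    have "(\<lambda>n. f (u n)) \<longlonglongrightarrow> f w" by (rule f.tendsto[OF w])
    then show ?thesis using u(1) by (simp add: C_def LIMSEQ_const_iff)
  qed
  have Nw: "N w \<le> d"
  proof -
    have "(\<lambda>n. N (u n)) \<longlonglongrightarrow> N w" unfolding N_def by (intro tendsto_intros w)
    moreover have "(\<lambda>n. d + 1 / real (Suc n)) \<longlonglongrightarrow> d + 0"
      by (intro tendsto_intros LIMSEQ_Suc lim_1_over_n)
    ultimately show ?thesis using u(2) less_imp_le by (metis (no_types, lifting) LIMSEQ_le add.right_neutral)
  qed
  have orth: "cinner w v = 0" if v: "f v = 0" for v
  proof -
    define c where "c = cinner w v"
    define s where "s = 1 / ((norm v)\<^sup>2 + 1)"
    have s: "s > 0" "s * (norm v)\<^sup>2 < 1" by (auto simp: s_def add_nonneg_pos)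
    have "w + (- (s * c)) *\<^sub>C v \<in> C" using fw v by (simp add: C_def f.add fc)
    then have "N w \<le> N (w + (- (s * c)) *\<^sub>C v)" using dle Nw by fastforce
    also have "\<dots> = N w - 2 * (s * (cmod c)\<^sup>2) + (s * cmod c)\<^sup>2 * N v"
    proof -
      have "Re (cinner w ((- (s * c)) *\<^sub>C v)) = - (s * (cmod c)\<^sup>2)"
      proof -
        have "cinner w ((- (s * c)) *\<^sub>C v) = - complex_of_real (s * (cmod c)\<^sup>2)"
          by (simp add: cinner_scaleC_right c_def[symmetric] complex_norm_square mult.commute del: of_real_power)
        then show ?thesis by simp
      qed
      then show ?thesis unfolding N_def norm_add_square
        by (simp add: norm_scaleC norm_mult power_mult_distrib)
    qed
    finally have "s * (cmod c)\<^sup>2 * 2 \<le> s * (cmod c)\<^sup>2 * (s * N v)"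
      by (simp add: power2_eq_square algebra_simps)
    moreover have "s * (cmod c)\<^sup>2 * (s * N v) \<le> s * (cmod c)\<^sup>2 * 1"
      using s by (intro mult_left_mono) (auto simp: N_def)
    ultimately have "s * (cmod c)\<^sup>2 \<le> 0" by linarith
    then show ?thesis using s by (simp add: c_def mult_le_0_iff)
  qed
  have w0: "w \<noteq> 0" using fw f.zero by auto
  show ?thesis
  proof (intro exI allI)
    fix x
    have "f (x - f x *\<^sub>C w) = 0" using fw by (simp add: f.diff fc)
    then have "cinner (x - f x *\<^sub>C w) w = 0" using orth cinner_commute by (metis complex_cnj_zero)
    then have "cinner x w = f x * complex_of_real ((norm w)\<^sup>2)"
      by (simp add: cinner_diff_left cinner_scaleC_left cinner_norm)
    then show "f x = cinner x (complex_of_real (1 / (norm w)\<^sup>2) *\<^sub>C w)"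
      using w0 by (simp add: cinner_scaleC_right)
  qed
qed

lemma cadjoint_unique:
  assumes "\<And>x y. cinner (f x) y = cinner x (g y)"
  shows "cadjoint f = g"
  unfolding cadjoint_def
proof (rule the_equality)
  fix h assume h: "\<forall>x y. cinner (f x) y = cinner x (h y)"
  have "h y = g y" for y by (rule cinner_extensional_right) (metis assms h)
  then show "h = g" by blast
qed (use assms in blast)

lemma bounded_clinear_norm_le: "bounded_clinear f \<Longrightarrow> norm (f x) \<le> onorm f * norm x"
  by (simp add: bounded_clinear_def onorm)

lemma
  assumes f: "bounded_clinear (f :: 'a::complex_hilbert_space \<Rightarrow> 'b::complex_hilbert_space)"
  shows cinner_cadjoint: "cinner (f x) y = cinner x (cadjoint f y)"
    and bounded_clinear_cadjoint: "bounded_clinear (cadjoint f)"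
    and onorm_cadjoint_le: "onorm (cadjoint f) \<le> onorm f"
proof -
  have bl: "bounded_linear f" using f by (rule bounded_clinear_bounded_linear)
  have "\<exists>z. \<forall>x. cinner (f x) y = cinner x z" for y
  proof (rule riesz_representation)
    show "bounded_linear (\<lambda>x. cinner (f x) y)"
      by (rule bounded_linear_compose[OF bounded_linear_cinner_left bl])
  qed (simp add: bounded_clinear_scaleC[OF f] cinner_scaleC_left)
  then obtain g where g: "\<And>x y. cinner (f x) y = cinner x (g y)" by metis
  have adj: "cadjoint f = g" by (rule cadjoint_unique) (rule g)
  show "cinner (f x) y = cinner x (cadjoint f y)" using g adj by simp
  have le: "norm (g y) \<le> onorm f * norm y" for y
  proof (cases "g y = 0")
    case False
    have "(norm (g y))\<^sup>2 = Re (cinner (f (g y)) y)" by (simp add: g Re_cinner_self)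
    also have "\<dots> \<le> norm (f (g y)) * norm y"
      using cauchy_schwarz_cinner complex_Re_le_cmod order_trans by blast
    also have "\<dots> \<le> onorm f * norm (g y) * norm y"
      by (intro mult_right_mono onorm bl) simp
    finally show ?thesis using False by (simp add: power2_eq_square mult.commute mult.left_commute)
  qed (simp add: onorm_pos_le[OF bl])
  show bc: "bounded_clinear (cadjoint f)"
    unfolding adj
  proof (rule bounded_clinear_intro)
    show "g (x + y) = g x + g y" for x y
      by (rule cinner_extensional_right) (metis cinner_add_right g)
    show "g (c *\<^sub>C x) = c *\<^sub>C g x" for c x
      by (rule cinner_extensional_right) (metis cinner_scaleC_right g)
  qed (rule le)
  show "onorm (cadjoint f) \<le> onorm f" unfolding adj
    by (rule onorm_bound) (use le onorm_pos_le[OF bl] in auto)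
qed

lemma cinner_cadjoint_left:
  "bounded_clinear f \<Longrightarrow> cinner (cadjoint f x) y = cinner x (f y)"
  by (metis cinner_cadjoint cinner_commute)

lemma cadjoint_cadjoint: "bounded_clinear f \<Longrightarrow> cadjoint (cadjoint f) = f"
  by (rule cadjoint_unique) (rule cinner_cadjoint_left)

lemma onorm_cadjoint: "bounded_clinear f \<Longrightarrow> onorm (cadjoint f) = onorm f"
  by (metis antisym bounded_clinear_cadjoint cadjoint_cadjoint onorm_cadjoint_le)

section \<open>Projection-valued measures without atoms\<close>

locale continuous_pvm =
  fixes E :: "real set \<Rightarrow> 'a::complex_hilbert_space \<Rightarrow> 'a"
  assumes pvm: "projection_valued_measure E"
    and ac: "\<And>x. absolutely_continuous lborel (scalar_spectral_measure E x)"
begin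

lemma E_clinear: "T \<in> sets borel \<Longrightarrow> bounded_clinear (E T)"
  and E_idem: "T \<in> sets borel \<Longrightarrow> E T (E T x) = E T x"
  and E_sym: "T \<in> sets borel \<Longrightarrow> cinner (E T x) y = cinner x (E T y)"
  and E_UNIV: "E UNIV x = x"
  and E_sums: "range F \<subseteq> sets borel \<Longrightarrow> disjoint_family F \<Longrightarrow> (\<lambda>n. E (F n) x) sums E (\<Union>n. F n) x"
  using pvm unfolding projection_valued_measure_def by blast+

lemma E_linear: "T \<in> sets borel \<Longrightarrow> bounded_linear (E T)"
  by (rule bounded_clinear_bounded_linear[OF E_clinear])

lemma E_add: "T \<in> sets borel \<Longrightarrow> E T (x + y) = E T x + E T y"
  by (rule linear_add[OF bounded_linear.linear[OF E_linear]])

lemma E_diff: "T \<in> sets borel \<Longrightarrow> E T (x - y) = E T x - E T y"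
  by (rule linear_diff[OF bounded_linear.linear[OF E_linear]])

lemma E_zero: "T \<in> sets borel \<Longrightarrow> E T 0 = 0"
  by (rule linear_0[OF bounded_linear.linear[OF E_linear]])

lemma E_scaleC: "T \<in> sets borel \<Longrightarrow> E T (c *\<^sub>C x) = c *\<^sub>C E T x"
  by (rule bounded_clinear_scaleC[OF E_clinear])

lemma norm_E_square: "T \<in> sets borel \<Longrightarrow> (norm (E T x))\<^sup>2 = Re (cinner (E T x) x)"
  unfolding Re_cinner_self[symmetric] by (simp add: E_sym E_idem)

lemma norm_E_le: 
  assumes "T \<in> sets borel"
  shows "norm (E T x) \<le> norm x"
proof (cases "E T x = 0")
  case False
  have "(norm (E T x))\<^sup>2 \<le> cmod (cinner (E T x) x)"
    unfolding norm_E_square[OF assms] by (rule complex_Re_le_cmod)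
  also have "\<dots> \<le> norm (E T x) * norm x" by (rule cauchy_schwarz_cinner)
  finally show ?thesis using False by (simp add: power2_eq_square)
qed simp

lemma E_empty: "E {} x = 0"
proof -
  have "(\<lambda>n::nat. E {} x) sums E (\<Union>n::nat. {}) x" by (rule E_sums) (auto simp: disjoint_family_on_def)
  then have "summable (\<lambda>n::nat. E {} x)" by (rule sums_summable)
  then have "(\<lambda>n::nat. E {} x) \<longlonglongrightarrow> 0" by (rule summable_LIMSEQ_zero)
  then show ?thesis by (simp add: LIMSEQ_const_iff)
qed

lemma E_disjoint_union:
  assumes "T \<in> sets borel" "U \<in> sets borel" "T \<inter> U = {}"
  shows "E (T \<union> U) x = E T x + E U x"
proof -
  have "(\<lambda>n. E (binaryset T U n) x) sums E (\<Union>n. binaryset T U n) x"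
    using assms by (intro E_sums) (auto simp: range_binaryset_eq disjoint_family_on_def binaryset_def)
  moreover have "(\<lambda>n. E (binaryset T U n) x) sums (E T x + E U x)"
    by (rule binaryset_sums[where f = "\<lambda>T. E T x"]) (rule E_empty)
  ultimately show ?thesis unfolding UN_binaryset_eq by (rule sums_unique2)
qed

text \<open>On the range of \<open>E U\<close> the projection \<open>E (T \<union> U)\<close> would otherwise increase the norm.\<close>

lemma E_disjoint:
  assumes "T \<in> sets borel" "U \<in> sets borel" "T \<inter> U = {}"
  shows "E T (E U x) = 0"
proof -
  have TU: "T \<union> U \<in> sets borel" using assms by simp
  have "(norm (E (T \<union> U) (E U x)))\<^sup>2 = Re (cinner (E T (E U x) + E U (E U x)) (E U x))"
    unfolding norm_E_square[OF TU] by (rule arg_cong[OF E_disjoint_union[OF assms]])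
  also have "\<dots> = (norm (E T (E U x)))\<^sup>2 + (norm (E U (E U x)))\<^sup>2"
    by (simp only: norm_E_square[OF assms(1), of "E U x"] norm_E_square[OF assms(2), of "E U x"]
      cinner_add_left plus_complex.sel)
  finally have "(norm (E (T \<union> U) (E U x)))\<^sup>2 = (norm (E T (E U x)))\<^sup>2 + (norm (E U (E U x)))\<^sup>2" .
  moreover have "(norm (E (T \<union> U) (E U x)))\<^sup>2 \<le> (norm (E U x))\<^sup>2"
    by (intro power_mono norm_E_le TU) simp
  ultimately have "(norm (E T (E U x)))\<^sup>2 \<le> 0" by (simp add: E_idem assms)
  then show ?thesis by simp
qed

lemma E_Int:
  assumes "T \<in> sets borel" "U \<in> sets borel"
  shows "E T (E U x) = E (T \<inter> U) x"
proof -
  have s: "T \<inter> U \<in> sets borel" "U - T \<in> sets borel" "T - U \<in> sets borel" using assms by auto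
  have eq: "(T \<inter> U) \<union> (U - T) = U" "(T \<inter> U) \<union> (T - U) = T" by blast+
  have "E U x = E (T \<inter> U) x + E (U - T) x"
    using E_disjoint_union[OF s(1,2), of x] unfolding eq by blast
  then have "E T (E U x) = E T (E (T \<inter> U) x) + E T (E (U - T) x)" by (simp add: E_add assms)
  also have "E T (E (U - T) x) = 0" using assms s by (intro E_disjoint) auto
  also have "E T (E (T \<inter> U) x) = E (T \<inter> U) (E (T \<inter> U) x) + E (T - U) (E (T \<inter> U) x)"
    using E_disjoint_union[OF s(1,3), of "E (T \<inter> U) x"] unfolding eq by blast
  also have "E (T - U) (E (T \<inter> U) x) = 0" using s by (intro E_disjoint) auto
  finally show ?thesis by (simp add: E_idem s)
qed

lemma E_subset: "T \<in> sets borel \<Longrightarrow> U \<in> sets borel \<Longrightarrow> T \<subseteq> U \<Longrightarrow> E T (E U x) = E T x"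
  and E_superset: "T \<in> sets borel \<Longrightarrow> U \<in> sets borel \<Longrightarrow> T \<subseteq> U \<Longrightarrow> E U (E T x) = E T x"
  by (simp_all add: E_Int inf.absorb1 inf.absorb2)

lemma E_orthogonal:
  assumes "T \<in> sets borel" "U \<in> sets borel" "T \<inter> U = {}"
  shows "cinner (E T x) (E U y) = 0"
  using E_disjoint[OF assms] by (simp add: E_sym assms)

lemma norm_E_mono:
  assumes "T \<in> sets borel" "U \<in> sets borel" "T \<subseteq> U"
  shows "norm (x - E U x) \<le> norm (x - E T x)"
proof -
  have "x - E U x = (x - E T x) - E U (x - E T x)"
    using E_superset[OF assms] by (simp add: E_diff assms)
  also have "\<dots> = E (- U) (x - E T x)"
  proof -
    have "E (U \<union> - U) (x - E T x) = E U (x - E T x) + E (- U) (x - E T x)"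
      by (rule E_disjoint_union) (use assms in auto)
    then show ?thesis unfolding Compl_partition E_UNIV by (metis add_diff_cancel_left')
  qed
  also have "norm \<dots> \<le> norm (x - E T x)" using assms by (intro norm_E_le) auto
  finally show ?thesis .
qed

abbreviation "M x \<equiv> scalar_spectral_measure E x"

lemma sets_M [measurable_cong, simp]: "sets (M x) = sets borel" and space_M [simp]: "space (M x) = UNIV"
proof -
  have b: "sets (borel::real measure) \<subseteq> Pow UNIV" by simp
  show "sets (M x) = sets borel"
    unfolding scalar_spectral_measure_def sets_measure_of[OF b]
    using sets.sigma_sets_eq[of "borel :: real measure"] by simp
  show "space (M x) = UNIV" unfolding scalar_spectral_measure_def space_measure_of[OF b] ..
qed

lemma emeasure_M:
  assumes T: "T \<in> sets borel"
  shows "emeasure (M x) T = ennreal ((norm (E T x))\<^sup>2)"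
proof -
  let ?\<mu> = "\<lambda>S. ennreal (Re (cinner (E S x) x))"
  have "emeasure (M x) T = ?\<mu> T"
    unfolding scalar_spectral_measure_def
  proof (rule emeasure_measure_of_sigma[OF _ _ _ T])
    show "sigma_algebra UNIV (sets (borel::real measure))"
      using sets.sigma_algebra_axioms[of "borel::real measure"] by simp
    show "positive (sets borel) ?\<mu>" by (simp add: positive_def E_empty)
    show "countably_additive (sets borel) ?\<mu>"
      unfolding countably_additive_def
    proof (intro allI impI)
      fix F :: "nat \<Rightarrow> real set"
      assume F: "range F \<subseteq> sets borel" "disjoint_family F"
      have "(\<lambda>n. Re (cinner (E (F n) x) x)) sums Re (cinner (E (\<Union>n. F n) x) x)"
        by (intro bounded_linear.sums[OF bounded_linear_Re] bounded_linear.sums[OF bounded_linear_cinner_left] E_sums F)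
      moreover have "0 \<le> Re (cinner (E (F n) x) x)" for n
        using norm_E_square[of "F n" x] F by (metis range_subsetD zero_le_power2)
      ultimately show "(\<Sum>n. ?\<mu> (F n)) = ?\<mu> (\<Union>n. F n)" by (intro suminf_ennreal_eq)
    qed
  qed
  then show ?thesis by (simp add: norm_E_square T)
qed

lemma measure_M: "T \<in> sets borel \<Longrightarrow> measure (M x) T = (norm (E T x))\<^sup>2"
  by (simp add: measure_def emeasure_M)

lemma finite_measure_M: "finite_measure (M x)"
  by (rule finite_measureI) (simp add: emeasure_M)

lemma E_null: "T \<in> null_sets lborel \<Longrightarrow> E T x = 0"
proof -
  assume T: "T \<in> null_sets lborel"
  then have "T \<in> null_sets (M x)" using ac[of x] by (auto simp: absolutely_continuous_def)
  moreover have "T \<in> sets borel" using T by (auto simp: null_sets_def)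
  ultimately show ?thesis by (auto simp: null_sets_def emeasure_M ennreal_eq_0_iff)
qed

lemma E_lessThan_diff: "u \<le> v \<Longrightarrow> E {..<v} x - E {..<u} x = E {u..<v} x"
  using E_disjoint_union[of "{..<u}" "{u..<v}" x] by (simp add: ivl_disj_un ivl_disj_int)

text \<open>The square of the norm of an increment of the spectral family is an increment of a distribution function, which is
  continuous in the absence of atoms.\<close>

lemma continuous_E: "continuous_on UNIV (\<lambda>t. E {..<t} x)"
proof -
  interpret finite_borel_measure "M x"
    by (intro finite_borel_measure.intro finite_measure_M finite_borel_measure_axioms.intro) simp_all
  have cd: "measure (M x) {u..<v} = cdf (M x) v - cdf (M x) u" if "u \<le> v" for u v
  proof -
    have eq: "cdf (M x) t = measure (M x) {..<t}" for t
    proof -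
      have "E {..t} x = E {..<t} x + E {t} x"
        using E_disjoint_union[of "{..<t}" "{t}" x] unfolding ivl_disj_un(2) by simp
      moreover have "E {t} x = 0" by (rule E_null) (simp add: null_sets_def)
      ultimately show ?thesis by (simp add: cdf_def measure_M)
    qed
    have "measure (M x) ({..<u} \<union> {u..<v}) = measure (M x) {..<u} + measure (M x) {u..<v}"
      by (rule finite_measure_Union) (auto simp: sets_M)
    then show ?thesis using that by (simp add: eq ivl_disj_un)
  qed
  have nr: "(norm (E {..<v} x - E {..<u} x))\<^sup>2 = \<bar>cdf (M x) v - cdf (M x) u\<bar>" for u v
  proof (cases "u \<le> v")
    case True
    then show ?thesis using cd[OF True] cdf_nondecreasing[OF True] by (simp add: E_lessThan_diff measure_M)
  next
    case False
    then have "v \<le> u" by simp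
    then show ?thesis using cd[of v u] cdf_nondecreasing[of v u] 
      by (subst norm_minus_commute) (simp add: E_lessThan_diff measure_M)
  qed
  have "isCont (\<lambda>t. E {..<t} x) s" for s
  proof -
    have "E {s} x = 0" by (rule E_null) (simp add: null_sets_def)
    then have "measure (M x) {s} = 0" by (simp add: measure_M)
    then have "isCont (cdf (M x)) s" by (simp add: isCont_cdf)
    then have "((\<lambda>t. \<bar>cdf (M x) t - cdf (M x) s\<bar>) \<longlongrightarrow> \<bar>cdf (M x) s - cdf (M x) s\<bar>) (at s)"
      unfolding isCont_def by (intro tendsto_intros)
    then have "((\<lambda>t. sqrt ((norm (E {..<t} x - E {..<s} x))\<^sup>2)) \<longlongrightarrow> sqrt 0) (at s)"
      unfolding nr by (intro tendsto_real_sqrt) simp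
    then have "((\<lambda>t. E {..<t} x - E {..<s} x) \<longlongrightarrow> 0) (at s)" by (simp add: tendsto_norm_zero_iff)
    then show ?thesis unfolding isCont_def by (simp add: LIM_zero_iff)
  qed
  then show ?thesis by (simp add: continuous_at_imp_continuous_on)
qed

lemma continuous_on_E_compose:
  assumes \<Phi>: "continuous_on A \<Phi>"
  shows "continuous_on A (\<lambda>t. E {..<t} (\<Phi> t))"
  unfolding continuous_on_def
proof
  fix s assume s: "s \<in> A"
  have b: "norm (E {..<t} (\<Phi> t - \<Phi> s)) \<le> norm (\<Phi> t - \<Phi> s)" for t by (rule norm_E_le) simp
  have "((\<lambda>t. norm (\<Phi> t - \<Phi> s)) \<longlongrightarrow> 0) (at s within A)"
    using \<Phi> s by (simp add: continuous_on_def tendsto_norm_zero_iff LIM_zero_iff)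
  then have "((\<lambda>t. E {..<t} (\<Phi> t - \<Phi> s)) \<longlongrightarrow> 0) (at s within A)"
    by (rule Lim_null_comparison[rotated]) (simp add: b)
  moreover have "((\<lambda>t. E {..<t} (\<Phi> s)) \<longlongrightarrow> E {..<s} (\<Phi> s)) (at s within A)"
    using continuous_on_subset[OF continuous_E subset_UNIV[of A]] s by (simp add: continuous_on_def)
  ultimately have "((\<lambda>t. E {..<t} (\<Phi> t - \<Phi> s) + E {..<t} (\<Phi> s)) \<longlongrightarrow> 0 + E {..<s} (\<Phi> s)) (at s within A)"
    by (rule tendsto_add)
  then show "((\<lambda>t. E {..<t} (\<Phi> t)) \<longlongrightarrow> E {..<s} (\<Phi> s)) (at s within A)"
    by (simp add: E_diff)
qed

lemma norm_square_orthogonal_sum: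
  fixes f :: "'i \<Rightarrow> 'a"
  assumes "finite A" "\<And>i j. i \<in> A \<Longrightarrow> j \<in> A \<Longrightarrow> i \<noteq> j \<Longrightarrow> cinner (f i) (f j) = 0"
  shows "(norm (sum f A))\<^sup>2 = (\<Sum>i\<in>A. (norm (f i))\<^sup>2)"
  using assms
proof (induction A rule: finite_induct)
  case (insert i A)
  have "cinner (f i) (sum f A) = 0" unfolding cinner_sum_right using insert by (intro sum.neutral) auto
  then show ?case using insert by (simp add: norm_add_square)
qed simp

lemma tagged_division_cells_disjoint:
  assumes p: "p tagged_division_of {a..b::real}" and "(s, k) \<in> p" "(s', k') \<in> p" "(s, k) \<noteq> (s', k')"
  shows "{Inf k..<Sup k} \<inter> {Inf k'..<Sup k'} = {}"
proof (rule ccontr)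
  assume "{Inf k..<Sup k} \<inter> {Inf k'..<Sup k'} \<noteq> {}"
  then have lt: "max (Inf k) (Inf k') < min (Sup k) (Sup k')" by auto
  then obtain t where t: "max (Inf k) (Inf k') < t" "t < min (Sup k) (Sup k')" using dense by blast
  have "interior k \<inter> interior k' = {}" by (rule tagged_division_ofD(5)[OF p assms(2-4)])
  moreover have "interior k = {Inf k<..<Sup k}" "interior k' = {Inf k'<..<Sup k'}"
    using tagged_division_cell(5)[OF p assms(2)] tagged_division_cell(5)[OF p assms(3)] by (metis interior_atLeastAtMost_real)+
  ultimately show False using t by auto
qed

lemma norm_square_tagged_sum:
  assumes p: "p tagged_division_of {a..b::real}"
  shows "(norm (\<Sum>(s, k)\<in>p. E {Inf k..<Sup k} (g s k)))\<^sup>2 = (\<Sum>(s, k)\<in>p. (norm (E {Inf k..<Sup k} (g s k)))\<^sup>2)"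
proof -
  have "(norm (sum (\<lambda>(s, k). E {Inf k..<Sup k} (g s k)) p))\<^sup>2 = (\<Sum>i\<in>p. (norm ((\<lambda>(s, k). E {Inf k..<Sup k} (g s k)) i))\<^sup>2)"
  proof (rule norm_square_orthogonal_sum[OF tagged_division_of_finite[OF p]])
    fix i j assume ij: "i \<in> p" "j \<in> p" "i \<noteq> j"
    obtain s k s' k' where [simp]: "i = (s, k)" "j = (s', k')" by (cases i, cases j)
    have "{Inf k..<Sup k} \<inter> {Inf k'..<Sup k'} = {}"
      by (rule tagged_division_cells_disjoint[OF p, of s k s' k']) (use ij in simp_all)
    then show "cinner ((\<lambda>(s, k). E {Inf k..<Sup k} (g s k)) i) ((\<lambda>(s, k). E {Inf k..<Sup k} (g s k)) j) = 0"
      by (simp add: E_orthogonal)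
  qed
  then show ?thesis by (simp add: case_prod_unfold)
qed

end

section \<open>Strong Stieltjes integrals of differentiable functions\<close>

context continuous_pvm begin

text \<open>Integration by parts gives the integral of \<open>\<Phi>\<close> against \<open>E\<close> a meaning as an ordinary integral.\<close>

definition parts_integral :: "(real \<Rightarrow> 'a) \<Rightarrow> (real \<Rightarrow> 'a) \<Rightarrow> real \<Rightarrow> real \<Rightarrow> 'a"
  where "parts_integral \<Phi> \<Phi>' u v =
    E {..<v} (\<Phi> v) - E {..<u} (\<Phi> u) - integral {u..v} (\<lambda>\<tau>. E {..<\<tau>} (\<Phi>' \<tau>))"

context
  fixes a b :: real and \<Phi> \<Phi>' :: "real \<Rightarrow> 'a"
  assumes ab: "a \<le> b"
    and deriv: "\<And>t. t \<in> {a..b} \<Longrightarrow> (\<Phi> has_vector_derivative \<Phi>' t) (at t within {a..b})"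
    and cont': "continuous_on {a..b} \<Phi>'"
begin

lemma parts_integrable: "a \<le> u \<Longrightarrow> v \<le> b \<Longrightarrow> (\<lambda>\<tau>. E {..<\<tau>} (\<Phi>' \<tau>)) integrable_on {u..v}"
  by (rule integrable_continuous_real, rule continuous_on_E_compose, rule continuous_on_subset[OF cont']) auto

lemma parts_integral_increment:
  assumes "a \<le> u" "u \<le> v" "v \<le> b"
  shows "parts_integral \<Phi> \<Phi>' u v = parts_integral \<Phi> \<Phi>' a v - parts_integral \<Phi> \<Phi>' a u"
proof -
  have "integral {a..u} (\<lambda>\<tau>. E {..<\<tau>} (\<Phi>' \<tau>)) + integral {u..v} (\<lambda>\<tau>. E {..<\<tau>} (\<Phi>' \<tau>))
      = integral {a..v} (\<lambda>\<tau>. E {..<\<tau>} (\<Phi>' \<tau>))"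
    by (rule Henstock_Kurzweil_Integration.integral_combine[OF assms(1,2) parts_integrable]) (use assms in auto)
  then show ?thesis unfolding parts_integral_def by (simp add: algebra_simps)
qed

text \<open>The part of the integral with \<open>E {..<u}\<close> can be evaluated by the fundamental theorem of calculus and cancels the
  boundary terms, so only the range of \<open>E {u..<v}\<close> remains.\<close>

lemma parts_integral_cell:
  assumes uv: "a \<le> u" "u \<le> v" "v \<le> b"
  shows "parts_integral \<Phi> \<Phi>' u v = E {u..<v} (\<Phi> v - integral {u..v} (\<lambda>\<tau>. E {..<\<tau>} (\<Phi>' \<tau>)))"
proof -
  let ?f = "\<lambda>\<tau>. E {..<\<tau>} (\<Phi>' \<tau>)"
  have sub: "{u..v} \<subseteq> {a..b}" using uv by auto
  have int': "\<Phi>' integrable_on {u..v}"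
    by (rule integrable_continuous_real[OF continuous_on_subset[OF cont' sub]])
  have ftc: "integral {u..v} \<Phi>' = \<Phi> v - \<Phi> u"
    by (rule integral_unique, rule fundamental_theorem_of_calculus[OF uv(2)])
      (use sub in \<open>auto intro!: has_vector_derivative_within_subset[OF deriv]\<close>)
  have intf: "?f integrable_on {u..v}" using uv by (intro parts_integrable)
  have split: "?f \<tau> = E {..<u} (\<Phi>' \<tau>) + E {u..<v} (?f \<tau>)" if "\<tau> \<in> {u..v}" for \<tau>
  proof -
    have "{u..<v} \<inter> {..<\<tau>} = {u..<\<tau>}" using that by auto
    then have "E {u..<v} (?f \<tau>) = E {u..<\<tau>} (\<Phi>' \<tau>)" by (simp add: E_Int)
    then show ?thesis using E_lessThan_diff[of u \<tau> "\<Phi>' \<tau>"] that by (simp add: algebra_simps)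
  qed
  have "integral {u..v} ?f = integral {u..v} (\<lambda>\<tau>. E {..<u} (\<Phi>' \<tau>) + E {u..<v} (?f \<tau>))"
    by (rule integral_cong) (rule split)
  also have "\<dots> = integral {u..v} (\<lambda>\<tau>. E {..<u} (\<Phi>' \<tau>)) + integral {u..v} (\<lambda>\<tau>. E {u..<v} (?f \<tau>))"
    using integrable_linear[OF int' E_linear[of "{..<u}"]] integrable_linear[OF intf E_linear[of "{u..<v}"]]
    by (intro Henstock_Kurzweil_Integration.integral_add) (simp_all add: o_def)
  also have "integral {u..v} (\<lambda>\<tau>. E {..<u} (\<Phi>' \<tau>)) = E {..<u} (\<Phi> v - \<Phi> u)"
    using integral_linear[OF int' E_linear[of "{..<u}"]] by (simp add: o_def ftc)
  also have "integral {u..v} (\<lambda>\<tau>. E {u..<v} (?f \<tau>)) = E {u..<v} (integral {u..v} ?f)"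
    using integral_linear[OF intf E_linear[of "{u..<v}"]] by (simp add: o_def)
  finally show ?thesis
    unfolding parts_integral_def using E_lessThan_diff[OF uv(2), of "\<Phi> v"] by (simp add: E_diff algebra_simps)
qed

text \<open>The errors of the cells of a division are mutually orthogonal and of the order of the length of the cells, so their sum is of the order of the square root of
  the mesh.\<close>

lemma has_rs_spectral_integral:
  "has_rs_integral (\<lambda>s u v. E {u..<v} (\<Phi> s)) (parts_integral \<Phi> \<Phi>' a b) a b"
  unfolding has_rs_integral_def
proof (intro allI impI)
  fix e :: real assume e: "e > 0"
  have "bounded (\<Phi>' ` {a..b})" by (intro compact_imp_bounded compact_continuous_image cont') simp
  then obtain L where L: "L > 0" "\<And>t. t \<in> {a..b} \<Longrightarrow> norm (\<Phi>' t) \<le> L" unfolding bounded_pos by auto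
  define d where "d = e\<^sup>2 / (4 * L\<^sup>2 * (b - a) + 1)"
  have den: "4 * L\<^sup>2 * (b - a) + 1 > 0" using ab by (simp add: add_nonneg_pos)
  have d: "d > 0" using e den by (simp add: d_def)
  define r where "r = (\<lambda>s u v. \<Phi> s - \<Phi> v + integral {u..v} (\<lambda>\<tau>. E {..<\<tau>} (\<Phi>' \<tau>)))"
  have r: "norm (r s u v) \<le> 2 * L * (v - u)" if "a \<le> u" "u \<le> s" "s \<le> v" "v \<le> b" for s u v
  proof -
    have "norm (\<Phi> s - \<Phi> v) \<le> L * norm (s - v)"
    proof (rule differentiable_bound[where S = "{a..b}" and f' = "\<lambda>t h. h *\<^sub>R \<Phi>' t"])
      show "(\<Phi> has_derivative (\<lambda>h. h *\<^sub>R \<Phi>' t)) (at t within {a..b})" if "t \<in> {a..b}" for t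
        using deriv[OF that] by (simp add: has_vector_derivative_def)
      show "onorm (\<lambda>h. h *\<^sub>R \<Phi>' t) \<le> L" if "t \<in> {a..b}" for t
      proof (rule onorm_bound)
        show "norm (h *\<^sub>R \<Phi>' t) \<le> L * norm h" for h
          using mult_left_mono[OF L(2)[OF that], of "\<bar>h\<bar>"] by (simp add: mult.commute)
      qed (use L(1) in simp)
    qed (use that in auto)
    also have "\<dots> \<le> L * (v - u)" using that L(1) by (intro mult_left_mono) auto
    finally have 1: "norm (\<Phi> s - \<Phi> v) \<le> L * (v - u)" .
    have "norm (integral {u..v} (\<lambda>\<tau>. E {..<\<tau>} (\<Phi>' \<tau>))) \<le> integral {u..v} (\<lambda>_. L)"
    proof (rule integral_norm_bound_integral)
      show "norm (E {..<\<tau>} (\<Phi>' \<tau>)) \<le> L" if "\<tau> \<in> {u..v}" for \<tau>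
      proof -
        have "\<tau> \<in> {a..b}" using that \<open>a \<le> u\<close> \<open>v \<le> b\<close> by auto
        then show ?thesis using norm_E_le[of "{..<\<tau>}" "\<Phi>' \<tau>"] L(2)[of \<tau>] by simp
      qed
    qed (use that in \<open>auto intro: parts_integrable\<close>)
    also have "\<dots> = L * (v - u)" using that by simp
    finally have 2: "norm (integral {u..v} (\<lambda>\<tau>. E {..<\<tau>} (\<Phi>' \<tau>))) \<le> L * (v - u)" .
    have "norm (r s u v) \<le> L * (v - u) + L * (v - u)"
      unfolding r_def by (rule norm_triangle_le[OF add_mono[OF 1 2]])
    then show ?thesis by simp
  qed
  show "\<exists>\<delta>>0. \<forall>p. p tagged_division_of {a..b} \<and> (\<forall>(s, k)\<in>p. diameter k < \<delta>) \<longrightarrow>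
    norm ((\<Sum>(s, k)\<in>p. E {Inf k..<Sup k} (\<Phi> s)) - parts_integral \<Phi> \<Phi>' a b) < e"
  proof (intro exI conjI allI impI)
    fix p assume p: "p tagged_division_of {a..b} \<and> (\<forall>(s, k)\<in>p. diameter k < d)"
    note pt = conjunct1[OF p]
    note c = tagged_division_cell[OF pt]
    let ?G = "parts_integral \<Phi> \<Phi>' a"
    have G0: "?G a = 0" by (simp add: parts_integral_def)
    have sumG: "(\<Sum>(s, k)\<in>p. ?G (Sup k) - ?G (Inf k)) = ?G b"
      using additive_tagged_division_1[OF ab pt, of ?G] G0 by simp
    have cell: "E {Inf k..<Sup k} (\<Phi> s) - (?G (Sup k) - ?G (Inf k)) = E {Inf k..<Sup k} (r s (Inf k) (Sup k))"
      if "(s, k) \<in> p" for s k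
    proof -
      have o: "a \<le> Inf k" "Inf k \<le> Sup k" "Sup k \<le> b" using c[OF that] by auto
      show ?thesis
        unfolding parts_integral_increment[OF o, symmetric] parts_integral_cell[OF o] r_def
        by (simp add: E_diff E_add)
    qed
    have "(\<Sum>(s, k)\<in>p. E {Inf k..<Sup k} (\<Phi> s)) - ?G b
        = (\<Sum>(s, k)\<in>p. E {Inf k..<Sup k} (\<Phi> s) - (?G (Sup k) - ?G (Inf k)))"
      unfolding sumG[symmetric] by (simp add: sum_subtractf case_prod_unfold)
    also have "\<dots> = (\<Sum>(s, k)\<in>p. E {Inf k..<Sup k} (r s (Inf k) (Sup k)))"
      by (rule sum.cong[OF refl]) (use cell in auto)
    finally have "(norm ((\<Sum>(s, k)\<in>p. E {Inf k..<Sup k} (\<Phi> s)) - ?G b))\<^sup>2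
        = (\<Sum>(s, k)\<in>p. (norm (E {Inf k..<Sup k} (r s (Inf k) (Sup k))))\<^sup>2)"
      using norm_square_tagged_sum[OF pt, of "\<lambda>s k. r s (Inf k) (Sup k)"] by simp
    also have "\<dots> \<le> (\<Sum>(s, k)\<in>p. 4 * L\<^sup>2 * d * (Sup k - Inf k))"
    proof (rule sum_mono, clarify)
      fix s k assume sk: "(s, k) \<in> p"
      note ck = c[OF sk]
      have "norm (E {Inf k..<Sup k} (r s (Inf k) (Sup k))) \<le> norm (r s (Inf k) (Sup k))" by (rule norm_E_le) simp
      also have "\<dots> \<le> 2 * L * (Sup k - Inf k)" by (rule r[OF ck(1-4)])
      finally have "(norm (E {Inf k..<Sup k} (r s (Inf k) (Sup k))))\<^sup>2 \<le> (2 * L * (Sup k - Inf k))\<^sup>2"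
        by (intro power_mono) auto
      also have "\<dots> = 4 * L\<^sup>2 * (Sup k - Inf k) * (Sup k - Inf k)" by (simp add: power2_eq_square)
      also have "\<dots> \<le> 4 * L\<^sup>2 * d * (Sup k - Inf k)"
      proof (intro mult_right_mono mult_left_mono)
        show "Sup k - Inf k \<le> d" using p sk ck(6) by fastforce
      qed (use ck in auto)
      finally show "(norm (E {Inf k..<Sup k} (r s (Inf k) (Sup k))))\<^sup>2 \<le> 4 * L\<^sup>2 * d * (Sup k - Inf k)" .
    qed
    also have "\<dots> = 4 * L\<^sup>2 * d * (\<Sum>(s, k)\<in>p. Sup k - Inf k)" by (simp add: sum_distrib_left case_prod_unfold)
    also have "(\<Sum>(s, k)\<in>p. Sup k - Inf k) = b - a" by (rule additive_tagged_division_1[OF ab pt])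
    also have "4 * L\<^sup>2 * d * (b - a) < e\<^sup>2"
    proof -
      have "d * (4 * L\<^sup>2 * (b - a)) < d * (4 * L\<^sup>2 * (b - a) + 1)" using d by (intro mult_strict_left_mono) auto
      also have "\<dots> = e\<^sup>2" using den by (simp add: d_def)
      finally show ?thesis by (simp add: mult_ac)
    qed
    finally show "norm ((\<Sum>(s, k)\<in>p. E {Inf k..<Sup k} (\<Phi> s)) - ?G b) < e"
      by (rule power2_less_imp_less) (use e in simp)
  qed (rule d)
qed

text \<open>A bound on \<open>\<Phi>'\<close> that is integrable over the whole line makes the estimate independent of the interval.\<close>

lemma norm_parts_integral_le:
  assumes C: "norm (\<Phi> b) \<le> C1" "\<And>t. t \<in> {a..b} \<Longrightarrow> norm (\<Phi>' t) \<le> C2 / (1 + t\<^sup>2)" "C2 \<ge> 0"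
  shows "norm (parts_integral \<Phi> \<Phi>' a b) \<le> C1 + C2 * pi"
proof -
  have hi: "((\<lambda>t. C2 / (1 + t\<^sup>2)) has_integral (C2 * arctan b - C2 * arctan a)) {a..b}"
  proof (rule fundamental_theorem_of_calculus[OF ab])
    fix t
    have "((\<lambda>t. C2 * arctan t) has_real_derivative C2 * inverse (1 + t\<^sup>2)) (at t within {a..b})"
      by (intro DERIV_cmult has_field_derivative_at_within[OF DERIV_arctan])
    then show "((\<lambda>t. C2 * arctan t) has_vector_derivative C2 / (1 + t\<^sup>2)) (at t within {a..b})"
      by (simp add: has_real_derivative_iff_has_vector_derivative divide_inverse)
  qed
  have "norm (integral {a..b} (\<lambda>\<tau>. E {..<\<tau>} (\<Phi>' \<tau>))) \<le> integral {a..b} (\<lambda>t. C2 / (1 + t\<^sup>2))"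
  proof (rule integral_norm_bound_integral)
    show "(\<lambda>t. C2 / (1 + t\<^sup>2)) integrable_on {a..b}" using hi by (rule has_integral_integrable)
    show "norm (E {..<\<tau>} (\<Phi>' \<tau>)) \<le> C2 / (1 + \<tau>\<^sup>2)" if "\<tau> \<in> {a..b}" for \<tau>
      using norm_E_le[of "{..<\<tau>}" "\<Phi>' \<tau>"] C(2)[OF that] by simp
  qed (rule parts_integrable, simp_all)
  also have "\<dots> = C2 * (arctan b - arctan a)" using hi by (simp add: integral_unique right_diff_distrib)
  also have "\<dots> \<le> C2 * pi"
    using arctan_bounded[of a] arctan_bounded[of b] C(3) by (intro mult_left_mono) auto
  finally have W: "norm (integral {a..b} (\<lambda>\<tau>. E {..<\<tau>} (\<Phi>' \<tau>))) \<le> C2 * pi" .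
  have "norm (parts_integral \<Phi> \<Phi>' a b) \<le> norm (\<Phi> b - integral {a..b} (\<lambda>\<tau>. E {..<\<tau>} (\<Phi>' \<tau>)))"
    unfolding parts_integral_cell[OF order_refl ab order_refl] by (rule norm_E_le) simp
  also have "\<dots> \<le> norm (\<Phi> b) + norm (integral {a..b} (\<lambda>\<tau>. E {..<\<tau>} (\<Phi>' \<tau>)))" by (rule norm_triangle_ineq4)
  finally show ?thesis using W C(1) by linarith
qed

end

text \<open>Continuity from below of the spectral measure of \<open>y\<close> gives convergence along a sequence of intervals; between its members the
  error decreases monotonically.\<close>

lemma E_exhaust_interval:
  assumes "\<alpha> < \<beta>" and y: "E (einterval \<alpha> \<beta>) y = y"
  shows "((\<lambda>(a, b). E {a..<b} y) \<longlongrightarrow> y) (lower_end \<alpha> \<times>\<^sub>F upper_end \<beta>)"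
proof (rule tendstoI)
  fix e :: real assume e: "e > 0"
  obtain u l :: "nat \<Rightarrow> real" where ul: "einterval \<alpha> \<beta> = (\<Union>i. {l i .. u i})" "incseq u" "decseq l"
    "\<And>i. l i < u i" "\<And>i. \<alpha> < l i" "\<And>i. u i < \<beta>"
    by (rule einterval_Icc_approximation[OF assms(1)], rule that)
  interpret finite_measure "M y" by (rule finite_measure_M)
  have "(\<lambda>i. measure (M y) {l i..u i}) \<longlonglongrightarrow> measure (M y) (\<Union>i. {l i..u i})"
  proof (rule finite_Lim_measure_incseq)
    show "incseq (\<lambda>i. {l i..u i})"
      using ul(2,3) by (intro monoI) (force simp: incseq_def decseq_def)
  qed auto
  then have "(\<lambda>i. (norm (E {l i..u i} y))\<^sup>2) \<longlonglongrightarrow> (norm y)\<^sup>2"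
    unfolding ul(1)[symmetric] by (simp add: measure_M y)
  then have "\<forall>\<^sub>F i in sequentially. (norm y)\<^sup>2 - e\<^sup>2 < (norm (E {l i..u i} y))\<^sup>2"
    using e by (intro order_tendstoD(1)) auto
  then obtain i where i: "(norm y)\<^sup>2 - e\<^sup>2 < (norm (E {l i..u i} y))\<^sup>2"
    using eventually_happens'[OF sequentially_bot] by blast
  have "cinner (E {l i..u i} y) y = cinner (E {l i..u i} y) (E {l i..u i} y)"
    by (simp add: E_sym E_idem)
  then have "(norm (y - E {l i..u i} y))\<^sup>2 = (norm y)\<^sup>2 - (norm (E {l i..u i} y))\<^sup>2"
  proof -
    have "(norm (E {l i..u i} y + (y - E {l i..u i} y)))\<^sup>2
      = (norm (E {l i..u i} y))\<^sup>2 + (norm (y - E {l i..u i} y))\<^sup>2"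
      unfolding norm_add_square cinner_diff_right using \<open>cinner (E {l i..u i} y) y = _\<close> by simp
    then show ?thesis by simp
  qed
  then have "(norm (y - E {l i..u i} y))\<^sup>2 < e\<^sup>2" using i by linarith
  then have lt: "norm (y - E {l i..u i} y) < e" by (rule power2_less_imp_less) (use e in simp)
  have li: "l i \<in> einterval \<alpha> \<beta>" "u i \<in> einterval \<alpha> \<beta>"
    using ul(4-6)[of i] by (auto simp: einterval_def intro: less_trans[of \<alpha> "ereal (l i)"] less_trans[of _ "ereal (u i)"])
  obtain u' where u': "u' \<in> einterval \<alpha> \<beta>" "u i < u'" using einterval_extend_right[OF assms(1) li(2)] by blast
  show "\<forall>\<^sub>F x in lower_end \<alpha> \<times>\<^sub>F upper_end \<beta>. dist (case x of (a, b) \<Rightarrow> E {a..<b} y) y < e"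
    unfolding eventually_prod_filter
  proof (intro exI conjI allI impI)
    show "\<forall>\<^sub>F a in lower_end \<alpha>. a \<le> l i" using eventually_ends(1)[OF assms(1) li(1)] by eventually_elim simp
    show "\<forall>\<^sub>F b in upper_end \<beta>. u' \<le> b" using eventually_ends(2)[OF assms(1) u'(1)] by eventually_elim simp
    fix a b assume "a \<le> l i" "u' \<le> b"
    then have "norm (y - E {a..<b} y) \<le> norm (y - E {l i..u i} y)"
      using u'(2) by (intro norm_E_mono) auto
    then show "dist (case (a, b) of (a, b) \<Rightarrow> E {a..<b} y) y < e" using lt by (simp add: dist_norm norm_minus_commute)
  qed
qed

text \<open>The integrals over compact intervals are pieces \<open>E {a..<b} y\<close> of one vector \<open>y\<close>. It is obtained as a limit along increasing intervals,
  which exists because the increments are orthogonal and the partial sums bounded.\<close>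

lemma improper_spectral_integral_exists:
  assumes \<alpha>\<beta>: "\<alpha> < \<beta>"
    and deriv: "\<And>t. t \<in> einterval \<alpha> \<beta> \<Longrightarrow> (\<Phi> has_vector_derivative \<Phi>' t) (at t)"
    and cont': "continuous_on (einterval \<alpha> \<beta>) \<Phi>'"
    and C: "\<And>t. t \<in> einterval \<alpha> \<beta> \<Longrightarrow> norm (\<Phi> t) \<le> C1"
      "\<And>t. t \<in> einterval \<alpha> \<beta> \<Longrightarrow> norm (\<Phi>' t) \<le> C2 / (1 + t\<^sup>2)" "C2 \<ge> 0"
  obtains y where "E (einterval \<alpha> \<beta>) y = y" "norm y \<le> C1 + C2 * pi"
    "\<And>a b. a \<in> einterval \<alpha> \<beta> \<Longrightarrow> b \<in> einterval \<alpha> \<beta> \<Longrightarrow> a \<le> b \<Longrightarrow>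
      has_rs_integral (\<lambda>s u v. E {u..<v} (\<Phi> s)) (E {a..<b} y) a b"
    "has_improper_rs_integral (\<lambda>s u v. E {u..<v} (\<Phi> s)) y \<alpha> \<beta>"
proof -
  let ?I = "einterval \<alpha> \<beta>"
  have dv: "(\<Phi> has_vector_derivative \<Phi>' t) (at t within {a..b})" if "a \<in> ?I" "b \<in> ?I" "t \<in> {a..b}" for a b t
    using deriv einterval_between[OF that(1,2)] that(3) by (blast intro: has_vector_derivative_at_within)
  have ct: "continuous_on {a..b} \<Phi>'" if "a \<in> ?I" "b \<in> ?I" for a b
    by (rule continuous_on_subset[OF cont' einterval_between[OF that]])
  define Q where "Q = parts_integral \<Phi> \<Phi>'"
  have rs: "has_rs_integral (\<lambda>s u v. E {u..<v} (\<Phi> s)) (Q a b) a b" if "a \<in> ?I" "b \<in> ?I" "a \<le> b" for a b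
    unfolding Q_def by (rule has_rs_spectral_integral[OF that(3) dv[OF that(1,2)] ct[OF that(1,2)]])
  have add: "Q a b + Q b c = Q a c" if "a \<in> ?I" "c \<in> ?I" "a \<le> b" "b \<le> c" for a b c
    using parts_integral_increment[OF order_trans[OF that(3,4)] dv[OF that(1,2)] ct[OF that(1,2)] that(3,4) order_refl]
    by (simp add: Q_def)
  have range: "E {a..<b} (Q a b) = Q a b" if "a \<in> ?I" "b \<in> ?I" "a \<le> b" for a b
    using parts_integral_cell[OF that(3) dv[OF that(1,2)] ct[OF that(1,2)] order_refl that(3) order_refl]
    by (simp add: Q_def E_idem)
  have bound: "norm (Q a b) \<le> C1 + C2 * pi" if "a \<in> ?I" "b \<in> ?I" "a \<le> b" for a b
    unfolding Q_def
    by (rule norm_parts_integral_le[OF that(3) dv[OF that(1,2)] ct[OF that(1,2)] C(1)[OF that(2)] C(2) C(3)])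
      (use einterval_between[OF that(1,2)] in auto)
  obtain u l :: "nat \<Rightarrow> real" where ul: "?I = (\<Union>i. {l i .. u i})" "incseq u" "decseq l"
    "\<And>i. l i < u i" "\<And>i. \<alpha> < l i" "\<And>i. u i < \<beta>"
    by (rule einterval_Icc_approximation[OF \<alpha>\<beta>], rule that)
  have lu_I: "l i \<in> ?I" "u i \<in> ?I" for i
    using ul(4-6)[of i] by (auto simp: einterval_def intro: less_trans[of \<alpha> "ereal (l i)"] less_trans[of _ "ereal (u i)"])
  have piece: "E {a..<b} (Q a' b') = Q a b" if "a' \<in> ?I" "b' \<in> ?I" "a' \<le> a" "a \<le> b" "b \<le> b'" for a b a' b'
  proof -
    have I: "a \<in> ?I" "b \<in> ?I" using that by (auto intro: einterval_convex[of a' _ _ b'])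
    have e1: "E {a..<b} (Q a' a) = 0"
      using E_disjoint[of "{a..<b}" "{a'..<a}" "Q a' a"] range[OF that(1) I(1) that(3)] by simp
    have e2: "E {a..<b} (Q b b') = 0"
      using E_disjoint[of "{a..<b}" "{b..<b'}" "Q b b'"] range[OF I(2) that(2) that(5)] by simp
    have "Q a' b' = Q a' a + (Q a b + Q b b')"
      using add[OF that(1,2) that(3)] add[OF I(1) that(2) that(4,5)] that by (metis order_trans)
    then show ?thesis using e1 e2 range[OF I that(4)] by (simp add: E_add)
  qed
  define z where "z = (\<lambda>n. Q (l n) (u n))"
  have lu_mono: "l m \<le> l n" "u n \<le> u m" if "n \<le> m" for n m
    using ul(2,3) that by (auto simp: incseq_def decseq_def)
  have z_piece: "E {l n..<u n} (z m) = z n" if "n \<le> m" for n m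
    unfolding z_def using lu_mono[OF that] ul(4)[of n] by (intro piece lu_I) auto
  have pyth: "(norm (z m - z n))\<^sup>2 = (norm (z m))\<^sup>2 - (norm (z n))\<^sup>2" if "n \<le> m" for n m
  proof -
    have "cinner (z n) (z m) = cinner (z n) (z n)"
      unfolding z_piece[OF that, symmetric] by (simp add: E_sym E_idem)
    then have "(norm (z n + (z m - z n)))\<^sup>2 = (norm (z n))\<^sup>2 + (norm (z m - z n))\<^sup>2"
      unfolding norm_add_square cinner_diff_right by simp
    then show ?thesis by simp
  qed
  have "convergent (\<lambda>n. (norm (z n))\<^sup>2)"
  proof (rule Bseq_monoseq_convergent)
    have "(norm (z n))\<^sup>2 \<le> (C1 + C2 * pi)\<^sup>2" for n
      unfolding z_def using ul(4)[of n] by (intro power_mono bound lu_I) auto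
    then show "Bseq (\<lambda>n. (norm (z n))\<^sup>2)" by (intro BseqI'[of _ "(C1 + C2 * pi)\<^sup>2"]) simp
    have "(norm (z n))\<^sup>2 \<le> (norm (z m))\<^sup>2" if "n \<le> m" for n m
      using pyth[OF that] zero_le_power2[of "norm (z m - z n)"] by linarith
    then show "monoseq (\<lambda>n. (norm (z n))\<^sup>2)" unfolding monoseq_def by blast
  qed
  then have cau: "Cauchy (\<lambda>n. (norm (z n))\<^sup>2)" by (rule convergent_Cauchy)
  have "Cauchy z"
  proof (rule metric_CauchyI)
    fix e :: real assume e: "e > 0"
    obtain N where N: "\<And>m n. m \<ge> N \<Longrightarrow> n \<ge> N \<Longrightarrow> dist ((norm (z m))\<^sup>2) ((norm (z n))\<^sup>2) < e\<^sup>2"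
      using metric_CauchyD[OF cau, of "e\<^sup>2"] e by auto
    have *: "dist (z m) (z n) < e" if "n \<ge> N" "n \<le> m" for m n
    proof -
      have "(norm (z m - z n))\<^sup>2 < e\<^sup>2"
        using N[of m n] that unfolding pyth[OF that(2)] dist_real_def by linarith
      then show ?thesis unfolding dist_norm by (rule power2_less_imp_less) (use e in simp)
    qed
    show "\<exists>N. \<forall>m\<ge>N. \<forall>n\<ge>N. dist (z m) (z n) < e"
    proof (intro exI allI impI)
      fix m n assume "N \<le> m" "N \<le> n"
      then show "dist (z m) (z n) < e" using *[of n m] *[of m n] by (cases "n \<le> m") (auto simp: dist_commute)
    qed
  qed
  then obtain y where y: "z \<longlonglongrightarrow> y" using Cauchy_convergent convergent_def by blast
  have bI: "?I \<in> sets borel" by simp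
  have Ey: "E ?I y = y"
  proof -
    have "E ?I (z n) = z n" for n
    proof -
      have "{l n..<u n} \<subseteq> ?I" using einterval_between[OF lu_I(1) lu_I(2), of n n] by auto
      then show ?thesis
        using E_superset[of "{l n..<u n}" ?I "z n"] z_piece[of n n] by simp
    qed
    then have "z \<longlonglongrightarrow> E ?I y" using bounded_linear.tendsto[OF E_linear[OF bI] y] by simp
    then show ?thesis using y LIMSEQ_unique by blast
  qed
  have Eab: "E {a..<b} y = Q a b" if ab: "a \<in> ?I" "b \<in> ?I" "a \<le> b" for a b
  proof -
    obtain i j where "a \<in> {l i..u i}" "b \<in> {l j..u j}" using ab ul(1) by blast
    then have N: "l n \<le> a" "b \<le> u n" if "n \<ge> max i j" for n
      using lu_mono[of i n] lu_mono[of j n] that by auto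
    have "\<forall>\<^sub>F n in sequentially. E {a..<b} (z n) = Q a b"
      unfolding eventually_sequentially z_def
      using N ab(3) by (intro exI[of _ "max i j"] allI impI piece lu_I)
    then have "(\<lambda>n. E {a..<b} (z n)) \<longlonglongrightarrow> Q a b" by (rule tendsto_eventually)
    moreover have "(\<lambda>n. E {a..<b} (z n)) \<longlonglongrightarrow> E {a..<b} y" by (rule bounded_linear.tendsto[OF E_linear y]) simp
    ultimately show ?thesis using LIMSEQ_unique by blast
  qed
  have rs': "has_rs_integral (\<lambda>s u v. E {u..<v} (\<Phi> s)) (E {a..<b} y) a b" if "a \<in> ?I" "b \<in> ?I" "a \<le> b" for a b
    unfolding Eab[OF that] by (rule rs[OF that])
  show thesis
  proof (rule that[OF Ey _ rs'])
    have "norm (z n) \<le> C1 + C2 * pi" for n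
      unfolding z_def using ul(4)[of n] by (intro bound lu_I) auto
    then show "norm y \<le> C1 + C2 * pi" using tendsto_norm[OF y] by (intro LIMSEQ_le_const2) auto
    show "has_improper_rs_integral (\<lambda>s u v. E {u..<v} (\<Phi> s)) y \<alpha> \<beta>"
      unfolding has_improper_rs_integral_def
      by (rule exI[of _ "\<lambda>(a, b). E {a..<b} y"]) (use rs' E_exhaust_interval[OF \<alpha>\<beta> Ey] in auto)
  qed
qed

end

section \<open>Self-adjoint operators and their spectral measures\<close>

locale spectral_operator = continuous_pvm E for E :: "real set \<Rightarrow> 'a::complex_hilbert_space \<Rightarrow> 'a" +
  fixes Dom :: "'a set" and A :: "'a \<Rightarrow> 'a"
  assumes sa: "selfadjoint_op Dom A" and sp: "spectral_measure_of E Dom A"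
begin

lemma has_rs_integral_E_const:
  assumes "a \<le> b"
  shows "has_rs_integral (\<lambda>s u v. E {u..<v} c) (E {a..<b} c) a b"
proof -
  have "has_rs_integral (\<lambda>s u v. E {u..<v} c) (E {..<b} c - E {..<a} c) a b"
  proof (rule has_rs_integral_increments[where m = "\<lambda>_ _. 0" and M = 0, OF assms])
    show "\<exists>\<delta>>0. \<forall>s u v. a \<le> u \<and> u \<le> s \<and> s \<le> v \<and> v \<le> b \<and> v - u < \<delta> \<longrightarrow>
        norm (E {u..<v} c - (E {..<v} c - E {..<u} c)) \<le> e * 0" for e
      by (intro exI[of _ 1]) (simp add: E_lessThan_diff)
  qed simp_all
  then show ?thesis by (simp add: E_lessThan_diff assms)
qed

lemma Dom_add: "x \<in> Dom \<Longrightarrow> y \<in> Dom \<Longrightarrow> x + y \<in> Dom"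
  and Dom_scaleC: "x \<in> Dom \<Longrightarrow> c *\<^sub>C x \<in> Dom"
  using sa by (simp_all add: selfadjoint_op_def csubspace_def)

lemma Dom_dense: "closure Dom = UNIV"
  using sa by (simp add: selfadjoint_op_def)

lemma A_add: "x \<in> Dom \<Longrightarrow> y \<in> Dom \<Longrightarrow> A (x + y) = A x + A y"
  and A_scaleC: "x \<in> Dom \<Longrightarrow> A (c *\<^sub>C x) = c *\<^sub>C A x"
  using sa by (simp_all add: selfadjoint_op_def)

lemma A_adjoint_iff: "(\<forall>x\<in>Dom. cinner (A x) y = cinner x z) \<longleftrightarrow> y \<in> Dom \<and> A y = z"
  using sa by (simp add: selfadjoint_op_def)

lemma A_sym: "x \<in> Dom \<Longrightarrow> y \<in> Dom \<Longrightarrow> cinner (A x) y = cinner x (A y)"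
  using A_adjoint_iff[of y "A y"] by simp

lemma Dom_diff: "x \<in> Dom \<Longrightarrow> y \<in> Dom \<Longrightarrow> x - y \<in> Dom"
  using Dom_add[of x "(-1) *\<^sub>C y"] Dom_scaleC[of y "-1"] by (simp add: scaleC_minus_one)

lemma A_diff: "x \<in> Dom \<Longrightarrow> y \<in> Dom \<Longrightarrow> A (x - y) = A x - A y"
  using A_add[of x "(-1) *\<^sub>C y"] Dom_scaleC[of y "-1"] A_scaleC[of y "-1"] by (simp add: scaleC_minus_one)

lemma Dom_iff: "x \<in> Dom \<longleftrightarrow> (\<integral>\<^sup>+t. ennreal (t\<^sup>2) \<partial>M x) < \<infinity>"
  using sp by (simp add: spectral_measure_of_def)

lemma A_form: "x \<in> Dom \<Longrightarrow> cinner (A x) x = complex_of_real (\<integral>t. t \<partial>M x)"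
  using sp by (simp add: spectral_measure_of_def)

lemma AE_M_interval:
  assumes x: "E {u..<v} x = x"
  shows "AE t in M x. u \<le> t \<and> t < v"
proof (rule AE_I)
  have "E (- {u..<v}) (E {u..<v} x) = 0" by (rule E_disjoint) auto
  then show "emeasure (M x) (- {u..<v}) = 0" by (simp add: emeasure_M x)
qed auto

lemma interval_range_in_Dom:
  assumes x: "E {u..<v} x = x"
  shows "x \<in> Dom"
proof -
  have "(\<integral>\<^sup>+t. ennreal (t\<^sup>2) \<partial>M x) \<le> (\<integral>\<^sup>+t. ennreal ((max \<bar>u\<bar> \<bar>v\<bar>)\<^sup>2) \<partial>M x)"
  proof (rule nn_integral_mono_AE)
    show "AE t in M x. ennreal (t\<^sup>2) \<le> ennreal ((max \<bar>u\<bar> \<bar>v\<bar>)\<^sup>2)"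
      using AE_M_interval[OF x]
    proof eventually_elim
      fix t assume "u \<le> t \<and> t < v"
      then have "\<bar>t\<bar> \<le> max \<bar>u\<bar> \<bar>v\<bar>" by auto
      then have "t\<^sup>2 \<le> (max \<bar>u\<bar> \<bar>v\<bar>)\<^sup>2" by (metis abs_ge_zero power2_abs power_mono)
      then show "ennreal (t\<^sup>2) \<le> ennreal ((max \<bar>u\<bar> \<bar>v\<bar>)\<^sup>2)" by (rule ennreal_leI)
    qed
  qed
  also have "\<dots> = ennreal ((max \<bar>u\<bar> \<bar>v\<bar>)\<^sup>2) * ennreal ((norm x)\<^sup>2)"
    by (simp add: emeasure_M E_UNIV)
  also have "\<dots> < \<infinity>" by (simp add: ennreal_mult_less_top)
  finally show ?thesis unfolding Dom_iff .
qed

text \<open>The spectral measure of \<open>x\<close> lives on the interval, where \<open>t - s\<close> is at most its length.\<close>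

lemma form_bound_interval:
  assumes x: "E {u..<v} x = x" and s: "u \<le> s" "s \<le> v"
  shows "cmod (cinner (A x - of_real s *\<^sub>C x) x) \<le> (v - u) * (norm x)\<^sup>2"
proof -
  interpret finite_measure "M x" by (rule finite_measure_M)
  have mUNIV: "measure (M x) UNIV = (norm x)\<^sup>2" by (simp add: measure_M E_UNIV)
  have bd: "AE t in M x. norm (t - s) \<le> v - u"
    using AE_M_interval[OF x] by eventually_elim (use s in auto)
  have i1: "integrable (M x) (\<lambda>t. t - s)"
    by (rule integrable_const_bound[OF bd]) (simp add: measurable_cong_sets[OF sets_M refl])
  have i2: "integrable (M x) (\<lambda>t. s)" by simp
  have "integrable (M x) (\<lambda>t. (t - s) + s)" by (rule Bochner_Integration.integrable_add[OF i1 i2])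
  then have i3: "integrable (M x) (\<lambda>t. t)" by simp
  have "(\<integral>t. t - s \<partial>M x) = (\<integral>t. t \<partial>M x) - s * (norm x)\<^sup>2"
    by (subst Bochner_Integration.integral_diff[OF i3 i2]) (simp add: mUNIV mult.commute)
  moreover have "cinner (A x - of_real s *\<^sub>C x) x = of_real ((\<integral>t. t \<partial>M x) - s * (norm x)\<^sup>2)"
    by (simp add: cinner_diff_left cinner_scaleC_left A_form[OF interval_range_in_Dom[OF x]] cinner_norm)
  ultimately have "cmod (cinner (A x - of_real s *\<^sub>C x) x) = \<bar>\<integral>t. t - s \<partial>M x\<bar>"
    by (metis norm_of_real)
  also have "\<dots> \<le> (\<integral>t. norm (t - s) \<partial>M x)" using integral_norm_bound[of "M x" "\<lambda>t. t - s"] by simp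
  also have "\<dots> \<le> (\<integral>t. v - u \<partial>M x)"
    by (rule integral_mono_AE[OF integrable_norm[OF i1] _ bd]) simp
  also have "\<dots> = (v - u) * (norm x)\<^sup>2" by (simp add: mUNIV mult.commute)
  finally show ?thesis .
qed

lemma Dom_of_E: "E {u..<v} x \<in> Dom"
  by (rule interval_range_in_Dom[of u v]) (simp add: E_idem)

text \<open>If \<open>x\<close> lies in the range of a spectral projection and \<open>y\<close> in its kernel, then the spectral measures of
  \<open>x + c y\<close> coincide for all \<open>c\<close> of modulus one, hence so do the values of the quadratic form, and the mixed terms
  vanish.\<close>

lemma A_reduces:
  assumes T: "T \<in> sets borel" and x: "x \<in> Dom" "E T x = x" and y: "y \<in> Dom" "E T y = 0"
  shows "cinner (A x) y = 0"
proof -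
  have orth: "cinner (E U x) (E U y) = 0" if U: "U \<in> sets borel" for U
  proof -
    have "cinner (E U x) (E U y) = cinner (E U x) y" using E_sym[OF U, of "E U x" y] E_idem[OF U] by simp
    also have "\<dots> = cinner (E T (E U x)) y"
      using E_Int[OF T U, of x] E_Int[OF U T, of x] x(2) by (simp add: Int_commute)
    also have "\<dots> = 0" using E_sym[OF T] y(2) by simp
    finally show ?thesis .
  qed
  have q: "cinner (A (x + c *\<^sub>C y)) (x + c *\<^sub>C y) = cinner (A (x + y)) (x + y)" if c: "cmod c = 1" for c
  proof -
    have "M (x + c *\<^sub>C y) = M (x + y)"
    proof (rule measure_eqI)
      fix U assume "U \<in> sets (M (x + c *\<^sub>C y))"
      then have U: "U \<in> sets borel" by simp
      have "(norm (E U (x + d *\<^sub>C y)))\<^sup>2 = (norm (E U x))\<^sup>2 + (norm (E U y))\<^sup>2" if "cmod d = 1" for d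
        unfolding E_add[OF U] E_scaleC[OF U] norm_add_square
        using orth[OF U] that by (simp add: cinner_scaleC_right norm_scaleC)
      from this[OF c] this[of 1]
      show "emeasure (M (x + c *\<^sub>C y)) U = emeasure (M (x + y)) U"
        by (simp add: emeasure_M[OF U] scaleC_one)
    qed simp
    then show ?thesis using x(1) y(1) by (simp add: A_form Dom_add Dom_scaleC)
  qed
  have ex: "cinner (A (x + c *\<^sub>C y)) (x + c *\<^sub>C y) = cinner (A x) x + cnj c * cinner (A x) y + c * cinner (A y) x + c * cnj c * cinner (A y) y" for c
    using x(1) y(1) by (simp add: A_add A_scaleC Dom_scaleC cinner_add_left cinner_add_right cinner_scaleC_left cinner_scaleC_right algebra_simps)
  let ?p = "cinner (A x) y" and ?q = "cinner (A y) x"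
  have q0: "cnj c * ?p + c * ?q = cinner (A (x + y)) (x + y) - cinner (A x) x - cinner (A y) y" if "cmod c = 1" for c
  proof -
    have "c * cnj c = 1" using that by (simp add: complex_norm_square[symmetric])
    then show ?thesis unfolding q[OF that, symmetric] ex by simp
  qed
  have q1: "cnj c * ?p + c * ?q = cnj d * ?p + d * ?q" if "cmod c = 1" "cmod d = 1" for c d
    by (rule trans[OF q0[OF that(1)] q0[OF that(2), symmetric]])
  have "?p + ?q = - ?p - ?q" using q1[of 1 "-1"] by simp
  moreover have "- (\<i> * ?p) + \<i> * ?q = \<i> * ?p - \<i> * ?q" using q1[of \<i> "-\<i>"] by simp
  then have "?p = ?q" by (simp add: algebra_simps)
  ultimately have "4 * ?p = 0" by simp
  then show ?thesis by simp
qed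

text \<open>Polarization of the bound for the quadratic form. The right-hand side is kept additive in the two vectors, because it is going to be summed over
  orthogonal cells.\<close>

lemma A_interval_bound:
  assumes x: "E {u..<v} x = x" and w: "E {u..<v} w = w" and s: "u \<le> s" "s \<le> v"
  shows "cmod (cinner (A x - of_real s *\<^sub>C x) w) \<le> (v - u) * ((norm x)\<^sup>2 + (norm w)\<^sup>2)"
proof -
  define q where "q = (\<lambda>c. cinner (A (x + c *\<^sub>C w) - of_real s *\<^sub>C (x + c *\<^sub>C w)) (x + c *\<^sub>C w))"
  have xD: "x \<in> Dom" "w \<in> Dom" using x w interval_range_in_Dom by blast+
  let ?f = "\<lambda>a b. cinner (A a - of_real s *\<^sub>C a) b"
  have ex: "q c = ?f x x + cnj c * ?f x w + c * ?f w x + c * cnj c * ?f w w" for c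
    unfolding q_def using xD
    by (simp add: A_add A_scaleC Dom_scaleC scaleC_add_right scaleC_scaleC cinner_diff_left cinner_add_left cinner_add_right
        cinner_scaleC_left cinner_scaleC_right algebra_simps)
  have "4 * ?f x w = q 1 - q (-1) + \<i> * q \<i> - \<i> * q (-\<i>)"
    unfolding ex by (simp add: algebra_simps)
  also have "cmod \<dots> \<le> cmod (q 1) + cmod (q (-1)) + cmod (q \<i>) + cmod (q (-\<i>))"
  proof -
    have "cmod (q 1 - q (-1) + \<i> * q \<i> - \<i> * q (-\<i>)) \<le> cmod (q 1 - q (-1) + \<i> * q \<i>) + cmod (\<i> * q (-\<i>))"
      by (rule norm_triangle_ineq4)
    also have "\<dots> \<le> (cmod (q 1 - q (-1)) + cmod (\<i> * q \<i>)) + cmod (\<i> * q (-\<i>))"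
      by (intro add_right_mono norm_triangle_ineq)
    also have "\<dots> \<le> ((cmod (q 1) + cmod (q (-1))) + cmod (\<i> * q \<i>)) + cmod (\<i> * q (-\<i>))"
      by (intro add_right_mono norm_triangle_ineq4)
    finally show ?thesis by (simp add: norm_mult)
  qed
  also have "\<dots> \<le> (v - u) * (norm (x + w))\<^sup>2 + (v - u) * (norm (x - w))\<^sup>2 + (v - u) * (norm (x + \<i> *\<^sub>C w))\<^sup>2 + (v - u) * (norm (x - \<i> *\<^sub>C w))\<^sup>2"
  proof -
    have b: "cmod (q c) \<le> (v - u) * (norm (x + c *\<^sub>C w))\<^sup>2" for c
      unfolding q_def by (rule form_bound_interval[OF _ s]) (simp add: E_add E_scaleC x w)
    show ?thesis using b[of 1] b[of "-1"] b[of \<i>] b[of "-\<i>"]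
      by (simp add: scaleC_one scaleC_minus_one scaleC_minus_left)
  qed
  also have "\<dots> = (v - u) * (4 * ((norm x)\<^sup>2 + (norm w)\<^sup>2))"
  proof -
    have p: "(norm (x + z))\<^sup>2 + (norm (x - z))\<^sup>2 = 2 * (norm x)\<^sup>2 + 2 * (norm z)\<^sup>2" for z
      using norm_add_square[of x z] norm_add_square[of x "- z"] by (simp add: cinner_minus_right)
    have arith: "n = w' \<Longrightarrow> a + b = 2 * x' + 2 * w' \<Longrightarrow> c + d = 2 * x' + 2 * n \<Longrightarrow> a + b + c + d = 4 * (x' + w')"
      for n w' x' a b c d :: real by simp
    have "(norm (\<i> *\<^sub>C w))\<^sup>2 = (norm w)\<^sup>2" by (simp add: norm_scaleC)
    then have "(norm (x + w))\<^sup>2 + (norm (x - w))\<^sup>2 + (norm (x + \<i> *\<^sub>C w))\<^sup>2 + (norm (x - \<i> *\<^sub>C w))\<^sup>2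
        = 4 * ((norm x)\<^sup>2 + (norm w)\<^sup>2)"
      using arith[OF _ p[of w] p[of "\<i> *\<^sub>C w"]] by blast
    then show ?thesis unfolding distrib_left[symmetric] by (rule arg_cong)
  qed
  finally have "4 * cmod (?f x w) \<le> 4 * ((v - u) * ((norm x)\<^sup>2 + (norm w)\<^sup>2))"
    unfolding norm_mult by (simp add: algebra_simps)
  then show ?thesis by (rule mult_left_le_imp_le) simp
qed

text \<open>On the range of the projection of a short interval around \<open>t0\<close> the operator \<open>A - t0\<close> has small norm, which contradicts the
  boundedness of its inverse unless the range is trivial.\<close>

lemma E_null_outside_spectrum:
  assumes t0: "complex_of_real t0 \<notin> spectrum Dom A"
  shows "\<exists>r>0. \<forall>x. E {t0 - r..<t0 + r} x = 0"
proof -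
  obtain R where R: "bounded_clinear R" "\<And>x. x \<in> Dom \<Longrightarrow> R (A x - of_real t0 *\<^sub>C x) = x"
    using t0 unfolding spectrum_def by blast
  obtain N where N: "N > 0" "\<And>x. norm (R x) \<le> norm x * N"
    using bounded_linear.pos_bounded[OF bounded_clinear_bounded_linear[OF R(1)]] by blast
  \<comment> \<open>On the range of the projection the norm of \<open>A - t0\<close> will turn out to be at most \<open>4 r\<close>, that is, half of what the
    bound \<open>N\<close> for the inverse permits.\<close>
  define r where "r = 1 / (8 * N)"
  have r: "r > 0" using N by (simp add: r_def)
  have "E {t0 - r..<t0 + r} x0 = 0" for x0
  proof (rule ccontr)
    define x where "x = E {t0 - r..<t0 + r} x0"
    assume "E {t0 - r..<t0 + r} x0 \<noteq> 0"
    then have nx: "norm x > 0" by (simp add: x_def)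
    have Ex: "E {t0 - r..<t0 + r} x = x" by (simp add: x_def E_idem)
    have xD: "x \<in> Dom" by (rule interval_range_in_Dom[OF Ex])
    define T where "T = A x - of_real t0 *\<^sub>C x"
    have b: "cmod (cinner T w) \<le> 2 * r * ((norm x)\<^sup>2 + (norm w)\<^sup>2)" if w: "w \<in> Dom" for w
    proof -
      let ?w = "E {t0 - r..<t0 + r} w"
      have wD: "w - ?w \<in> Dom" by (rule Dom_diff[OF w Dom_of_E])
      have "cinner (A x) (w - ?w) = 0" by (rule A_reduces[OF _ xD Ex wD]) (simp_all add: E_diff E_idem)
      moreover have "cinner x (w - ?w) = 0"
        using E_sym[of "{t0 - r..<t0 + r}" x "w - ?w"] Ex by (simp add: E_diff E_idem)
      ultimately have "cinner T w = cinner T ?w"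
        unfolding T_def by (simp add: cinner_diff_left cinner_diff_right cinner_scaleC_left)
      also have "cmod \<dots> \<le> ((t0 + r) - (t0 - r)) * ((norm x)\<^sup>2 + (norm ?w)\<^sup>2)"
        unfolding T_def by (rule A_interval_bound[OF Ex]) (use r in \<open>auto simp: E_idem\<close>)
      also have "\<dots> \<le> 2 * r * ((norm x)\<^sup>2 + (norm w)\<^sup>2)"
        using r norm_E_le[of "{t0 - r..<t0 + r}" w] by (simp add: power_mono)
      finally show ?thesis .
    qed
    have b': "cmod (cinner T w) \<le> 2 * r * ((norm x)\<^sup>2 + (norm w)\<^sup>2)" for w
    proof -
      have "w \<in> closure Dom" using Dom_dense by simp
      then obtain f where f: "\<And>n. f n \<in> Dom" "f \<longlonglongrightarrow> w" unfolding closure_sequential by blast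
      have l1: "(\<lambda>n. cmod (cinner T (f n))) \<longlonglongrightarrow> cmod (cinner T w)"
        by (intro tendsto_norm tendsto_cinner tendsto_const f)
      have l2: "(\<lambda>n. 2 * r * ((norm x)\<^sup>2 + (norm (f n))\<^sup>2)) \<longlonglongrightarrow> 2 * r * ((norm x)\<^sup>2 + (norm w)\<^sup>2)"
        by (intro tendsto_mult tendsto_add tendsto_const tendsto_power tendsto_norm f)
      show ?thesis by (rule LIMSEQ_le[OF l1 l2]) (use b f(1) in blast)
    qed
    have RT: "R T = x" unfolding T_def by (rule R(2)[OF xD])
    have nT: "norm T > 0" using RT nx N(2)[of T] by (cases "T = 0") auto
    define w where "w = complex_of_real (norm x / norm T) *\<^sub>C T"
    have nw: "norm w = norm x" using nT by (simp add: w_def norm_scaleC norm_divide)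
    have "cinner T w = of_real (norm x * norm T)"
      using nT by (simp add: w_def cinner_scaleC_right cinner_norm power2_eq_square)
    then have "norm x * norm T \<le> 2 * r * ((norm x)\<^sup>2 + (norm x)\<^sup>2)"
      using b'[of w] by (simp add: nw norm_mult)
    then have "norm x * norm T \<le> norm x * (4 * r * norm x)" by (simp add: power2_eq_square mult_ac)
    then have "norm T \<le> 4 * r * norm x" using nx by simp
    then have "norm T * N \<le> 4 * r * norm x * N" using N(1) by (intro mult_right_mono) auto
    also have "\<dots> = norm x / 2" using N(1) by (simp add: r_def)
    finally show False using N(2)[of T] RT nx by simp
  qed
  then show ?thesis using r by blast
qed

text \<open>Countably many of these null intervals cover the complement of the spectrum; the end points carry no mass because the
  spectral measures are absolutely continuous.\<close>

lemma E_concentrated_on_interval: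
  assumes \<sigma>: "spectrum Dom A = complex_of_real ` closure (einterval \<alpha> \<beta>)"
  shows "E (einterval \<alpha> \<beta>) x = x"
proof -
  let ?I = "einterval \<alpha> \<beta>"
  let ?U = "- closure ?I"
  have "\<exists>r>0. \<forall>x. E {t - r..<t + r} x = 0" if "t \<in> ?U" for t
  proof (rule E_null_outside_spectrum)
    show "complex_of_real t \<notin> spectrum Dom A" unfolding \<sigma> using that by auto
  qed
  then obtain r where r: "\<And>t. t \<in> ?U \<Longrightarrow> r t > 0" "\<And>t x. t \<in> ?U \<Longrightarrow> E {t - r t..<t + r t} x = 0" by metis
  define \<F> where "\<F> = (\<lambda>t. {t - r t<..<t + r t}) ` ?U"
  obtain \<F>' where F': "\<F>' \<subseteq> \<F>" "countable \<F>'" "\<Union>\<F>' = \<Union>\<F>"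
    by (rule Lindelof[of \<F>]) (auto simp: \<F>_def)
  have cover: "(\<Union>S\<in>\<F>'. S) \<in> null_sets (M x)"
  proof (rule null_sets_UN'[OF F'(2)])
    fix S assume "S \<in> \<F>'"
    then obtain t where t: "t \<in> ?U" "S = {t - r t<..<t + r t}" using F'(1) by (auto simp: \<F>_def)
    have "E S x = E S (E {t - r t..<t + r t} x)" unfolding t(2) by (rule E_subset[symmetric]) auto
    also have "\<dots> = 0" unfolding r(2)[OF t(1)] by (rule E_zero) (simp add: t(2))
    finally show "S \<in> null_sets (M x)" by (simp add: null_sets_def emeasure_M t(2))
  qed
  have "?U \<subseteq> \<Union>\<F>" using r(1) unfolding \<F>_def by fastforce
  then have "?U \<in> null_sets (M x)"
    by (intro null_sets_subset[OF cover[unfolded image_ident F'(3)]]) simp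
  then have 1: "E ?U x = 0" by (auto simp: null_sets_def emeasure_M ennreal_eq_0_iff)
  have conv: "convex ?I" by (intro is_interval_convex) (auto simp: is_interval_1 intro: einterval_convex)
  have "frontier ?I \<in> null_sets lborel"
  proof -
    have "negligible (frontier ?I)" by (rule negligible_convex_frontier[OF conv])
    then have "frontier ?I \<in> null_sets lebesgue" by (simp add: negligible_iff_null_sets)
    then show ?thesis using null_sets_completion_iff[of "frontier ?I" lborel] by simp
  qed
  then have 2: "E (frontier ?I) x = 0" by (rule E_null)
  have "E (frontier ?I \<union> ?U) x = E (frontier ?I) x + E ?U x"
    by (rule E_disjoint_union) (auto simp: frontier_def)
  moreover have "E (?I \<union> (frontier ?I \<union> ?U)) x = E ?I x + E (frontier ?I \<union> ?U) x"
    by (rule E_disjoint_union) (use interior_open[OF open_einterval] closure_subset[of ?I] in \<open>auto simp: frontier_def\<close>)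
  moreover have "?I \<union> (frontier ?I \<union> ?U) = UNIV"
    using interior_open[OF open_einterval, of \<alpha> \<beta>] by (auto simp: frontier_def)
  ultimately show ?thesis using 1 2 by (simp add: E_UNIV)
qed

text \<open>On a cell of length \<open>h\<close> around \<open>s\<close> the operator \<open>A\<close> differs from multiplication by \<open>s\<close> by \<open>O(h)\<close>, so
  applying \<open>A\<close> amounts to multiplying the integrand by the variable.\<close>

lemma A_spectral_integral_compact:
  assumes x: "x \<in> Dom" and ab: "a \<le> b"
    and y: "has_rs_integral (\<lambda>s u v. E {u..<v} (g s)) (E {a..<b} y) a b"
    and w: "has_rs_integral (\<lambda>s u v. E {u..<v} (of_real s *\<^sub>C g s)) (E {a..<b} w) a b"
  shows "cinner (A x) (E {a..<b} y) = cinner x (E {a..<b} w)"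
proof -
  let ?\<phi> = "\<lambda>s u v. cinner (A x) (E {u..<v} (g s)) - cinner x (E {u..<v} (of_real s *\<^sub>C g s))"
  have rs: "has_rs_integral ?\<phi> (cinner (A x) (E {a..<b} y) - cinner x (E {a..<b} w)) a b"
    by (intro has_rs_integral_diff has_rs_integral_linear[OF bounded_linear_cinner_right] y w)
  have "has_rs_integral ?\<phi> 0 a b"
    unfolding has_rs_integral_def
  proof (intro allI impI)
    fix e :: real assume e: "e > 0"
    obtain d0 where d0: "d0 > 0" "\<And>p. p tagged_division_of {a..b} \<and> (\<forall>(s, k)\<in>p. diameter k < d0) \<Longrightarrow>
        norm ((\<Sum>(s, k)\<in>p. E {Inf k..<Sup k} (g s)) - E {a..<b} y) < 1"
      using y unfolding has_rs_integral_def by (meson zero_less_one)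
    define C where "C = (norm x)\<^sup>2 + (norm (E {a..<b} y) + 1)\<^sup>2"
    have C: "C > 0" unfolding C_def by (intro add_nonneg_pos zero_less_power) (auto simp: add_nonneg_pos)
    define d where "d = min d0 (e / (2 * C))"
    have d: "d > 0" "d \<le> d0" "d * C < e" using d0(1) e C by (auto simp: d_def min_def field_simps)
    show "\<exists>\<delta>>0. \<forall>p. p tagged_division_of {a..b} \<and> (\<forall>(s, k)\<in>p. diameter k < \<delta>) \<longrightarrow>
        norm ((\<Sum>(s, k)\<in>p. ?\<phi> s (Inf k) (Sup k)) - 0) < e"
    proof (intro exI conjI allI impI)
      fix p assume p: "p tagged_division_of {a..b} \<and> (\<forall>(s, k)\<in>p. diameter k < d)"
      note pt = conjunct1[OF p]
      note c = tagged_division_cell[OF pt]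
      let ?S = "\<Sum>(s, k)\<in>p. E {Inf k..<Sup k} (g s)"
      have "norm (?S - E {a..<b} y) < 1" by (rule d0(2)) (use p d(2) in fastforce)
      then have nS: "norm ?S \<le> norm (E {a..<b} y) + 1" using norm_triangle_sub[of ?S "E {a..<b} y"] by linarith
      have sx: "(\<Sum>(s, k)\<in>p. (norm (E {Inf k..<Sup k} x))\<^sup>2) \<le> (norm x)\<^sup>2"
      proof -
        have "(\<Sum>(s, k)\<in>p. (norm (E {Inf k..<Sup k} x))\<^sup>2) = (norm (\<Sum>(s, k)\<in>p. E {Inf k..<Sup k} x))\<^sup>2"
          using norm_square_tagged_sum[OF pt, of "\<lambda>s k. x"] by simp
        also have "(\<Sum>(s, k)\<in>p. E {Inf k..<Sup k} x) = (\<Sum>(s, k)\<in>p. E {..<Sup k} x - E {..<Inf k} x)"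
          by (rule sum.cong[OF refl]) (use c in \<open>force simp: E_lessThan_diff\<close>)
        also have "\<dots> = E {..<b} x - E {..<a} x" by (rule additive_tagged_division_1[OF ab pt])
        also have "\<dots> = E {a..<b} x" by (rule E_lessThan_diff[OF ab])
        also have "(norm (E {a..<b} x))\<^sup>2 \<le> (norm x)\<^sup>2" by (intro power_mono norm_E_le) auto
        finally show ?thesis .
      qed
      have "norm (\<Sum>(s, k)\<in>p. ?\<phi> s (Inf k) (Sup k))
          \<le> (\<Sum>(s, k)\<in>p. d * ((norm (E {Inf k..<Sup k} x))\<^sup>2 + (norm (E {Inf k..<Sup k} (g s)))\<^sup>2))"
      proof (rule sum_norm_le, clarify)
        fix s k assume sk: "(s, k) \<in> p"
        note ck = c[OF sk]
        let ?E = "E {Inf k..<Sup k}"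
        have "x - ?E x \<in> Dom" by (rule Dom_diff[OF x Dom_of_E])
        then have "cinner (A (?E (g s))) (x - ?E x) = 0"
          by (intro A_reduces[of "{Inf k..<Sup k}"]) (simp_all add: Dom_of_E E_diff E_idem)
        then have "cinner (A (x - ?E x)) (?E (g s)) = 0"
          using A_sym[OF \<open>x - ?E x \<in> Dom\<close> Dom_of_E] cinner_commute by (metis complex_cnj_zero)
        then have 1: "cinner (A x) (?E (g s)) = cinner (A (?E x)) (?E (g s))"
          by (simp add: A_diff[OF x Dom_of_E] cinner_diff_left)
        have 2: "cinner x (?E (of_real s *\<^sub>C g s)) = cinner (of_real s *\<^sub>C ?E x) (?E (g s))"
          by (simp add: E_scaleC cinner_scaleC_left cinner_scaleC_right E_sym E_idem)
        have "?\<phi> s (Inf k) (Sup k) = cinner (A (?E x) - of_real s *\<^sub>C ?E x) (?E (g s))"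
          unfolding 1 2 cinner_diff_left ..
        also have "cmod \<dots> \<le> (Sup k - Inf k) * ((norm (?E x))\<^sup>2 + (norm (?E (g s)))\<^sup>2)"
          by (rule A_interval_bound[OF _ _ ck(2,3)]) (simp_all add: E_idem)
        also have "\<dots> \<le> d * ((norm (?E x))\<^sup>2 + (norm (?E (g s)))\<^sup>2)"
        proof (rule mult_right_mono)
          show "Sup k - Inf k \<le> d" using p sk ck(6) by fastforce
        qed simp
        finally show "cmod (?\<phi> s (Inf k) (Sup k)) \<le> d * ((norm (?E x))\<^sup>2 + (norm (?E (g s)))\<^sup>2)" .
      qed
      also have "\<dots> = d * ((\<Sum>(s, k)\<in>p. (norm (E {Inf k..<Sup k} x))\<^sup>2) + (\<Sum>(s, k)\<in>p. (norm (E {Inf k..<Sup k} (g s)))\<^sup>2))"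
        by (simp add: sum.distrib sum_distrib_left case_prod_unfold distrib_left)
      also have "(\<Sum>(s, k)\<in>p. (norm (E {Inf k..<Sup k} (g s)))\<^sup>2) = (norm ?S)\<^sup>2"
        by (rule norm_square_tagged_sum[OF pt, symmetric])
      also have "d * ((\<Sum>(s, k)\<in>p. (norm (E {Inf k..<Sup k} x))\<^sup>2) + (norm ?S)\<^sup>2) \<le> d * C"
        unfolding C_def using sx nS d(1) by (intro mult_left_mono add_mono power_mono) auto
      finally show "norm ((\<Sum>(s, k)\<in>p. ?\<phi> s (Inf k) (Sup k)) - 0) < e" using d(3) by simp
    qed (rule d)
  qed
  from has_rs_integral_unique[OF rs this] show ?thesis by simp
qed

text \<open>Self-adjointness turns the weak identity into a statement on the domain of \<open>A\<close>.\<close>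

lemma A_spectral_integral:
  assumes \<alpha>\<beta>: "\<alpha> < \<beta>" and y: "E (einterval \<alpha> \<beta>) y = y" and w: "E (einterval \<alpha> \<beta>) w = w"
    and rs: "\<And>a b. a \<in> einterval \<alpha> \<beta> \<Longrightarrow> b \<in> einterval \<alpha> \<beta> \<Longrightarrow> a \<le> b \<Longrightarrow>
        has_rs_integral (\<lambda>s u v. E {u..<v} (g s)) (E {a..<b} y) a b"
      "\<And>a b. a \<in> einterval \<alpha> \<beta> \<Longrightarrow> b \<in> einterval \<alpha> \<beta> \<Longrightarrow> a \<le> b \<Longrightarrow>
        has_rs_integral (\<lambda>s u v. E {u..<v} (of_real s *\<^sub>C g s)) (E {a..<b} w) a b"
  shows "y \<in> Dom \<and> A y = w"
  unfolding A_adjoint_iff[symmetric]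
proof
  fix x assume x: "x \<in> Dom"
  let ?F = "lower_end \<alpha> \<times>\<^sub>F upper_end \<beta>"
  have t1: "((\<lambda>ab. cinner (A x) (case ab of (a, b) \<Rightarrow> E {a..<b} y)) \<longlongrightarrow> cinner (A x) y) ?F"
    by (intro tendsto_cinner tendsto_const E_exhaust_interval[OF \<alpha>\<beta> y])
  have t2: "((\<lambda>ab. cinner x (case ab of (a, b) \<Rightarrow> E {a..<b} w)) \<longlongrightarrow> cinner x w) ?F"
    by (intro tendsto_cinner tendsto_const E_exhaust_interval[OF \<alpha>\<beta> w])
  have ev: "\<forall>\<^sub>F ab in ?F. cinner (A x) (case ab of (a, b) \<Rightarrow> E {a..<b} y) = cinner x (case ab of (a, b) \<Rightarrow> E {a..<b} w)"
    using eventually_end_pairs[OF \<alpha>\<beta>]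
  proof eventually_elim
    fix ab assume ab: "case ab of (a, b) \<Rightarrow> a \<in> einterval \<alpha> \<beta> \<and> b \<in> einterval \<alpha> \<beta> \<and> a \<le> b"
    obtain a b where eq: "ab = (a, b)" by (cases ab)
    then have I: "a \<in> einterval \<alpha> \<beta>" "b \<in> einterval \<alpha> \<beta>" "a \<le> b" using ab by simp_all
    show "cinner (A x) (case ab of (a, b) \<Rightarrow> E {a..<b} y) = cinner x (case ab of (a, b) \<Rightarrow> E {a..<b} w)"
      unfolding eq prod.case by (rule A_spectral_integral_compact[OF x I(3) rs(1)[OF I] rs(2)[OF I]])
  qed
  have "((\<lambda>ab. cinner x (case ab of (a, b) \<Rightarrow> E {a..<b} w)) \<longlongrightarrow> cinner (A x) y) ?F"
    by (rule iffD1[OF tendsto_cong[OF ev] t1])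
  moreover have "?F \<noteq> bot" using ends_not_bot[OF \<alpha>\<beta>] by (simp add: prod_filter_eq_bot)
  ultimately show "cinner (A x) y = cinner x w" using t2 tendsto_unique by blast
qed

end

section \<open>Integrals along deformed contours\<close>

lemma fixes_end_escape:
  assumes "fixes_end K H F e" "bounded C" "\<And>m. ereal m = e \<Longrightarrow> complex_of_real m \<notin> closure C"
  shows "\<forall>\<^sub>F x in F. \<forall>t\<in>{0..1}. H (t, x) \<notin> C"
proof (cases "\<bar>e\<bar> = \<infinity>")
  case False
  then obtain m where m: "e = ereal m" by (cases e) auto
  have "uniform_limit {0..1} (\<lambda>x t. H (t, x)) (\<lambda>t. complex_of_real m) F"
    using assms(1) unfolding fixes_end_def m by simp
  moreover have "open (- closure C)" "complex_of_real m \<in> - closure C" using assms(3) m by auto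
  then obtain r where r: "r > 0" "ball (complex_of_real m) r \<subseteq> - closure C" by (rule openE)
  ultimately have "\<forall>\<^sub>F x in F. \<forall>t\<in>{0..1}. dist (H (t, x)) (of_real m) < r" unfolding uniform_limit_iff by blast
  then show ?thesis
  proof eventually_elim
    fix x assume *: "\<forall>t\<in>{0..1}. dist (H (t, x)) (of_real m) < r"
    show "\<forall>t\<in>{0..1}. H (t, x) \<notin> C"
    proof
      fix t :: real assume "t \<in> {0..1}"
      then have "H (t, x) \<in> ball (of_real m) r" using * by (simp add: dist_commute)
      then show "H (t, x) \<notin> C" using r(2) closure_subset by blast
    qed
  qed
next
  case True
  obtain r where r: "\<And>z. z \<in> C \<Longrightarrow> norm z \<le> r" using assms(2) unfolding bounded_iff by blast
  have "\<forall>\<^sub>F x in F. \<forall>t\<in>{0..1}. r + 1 \<le> norm (H (t, x))"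
    using assms(1) True unfolding fixes_end_def by simp
  then show ?thesis by eventually_elim (use r in fastforce)
qed

text \<open>The finite and the infinite case together, in the terms in which deformations with fixed ends are given.\<close>

lemma (in swept_region) end_gap:
  assumes \<sigma>: "\<sigma> \<in> {1, -1}" and fixd: "fixes_end K H (end_filter \<sigma>) (endpoint \<sigma>)"
    and F: "strict_primitive_on F f S" "\<And>z. z \<in> D \<Longrightarrow> (F has_field_derivative f z) (at z)" and f: "continuous_on S f"
    and finite_bound: "\<And>m. ereal m = endpoint \<sigma> \<Longrightarrow> \<exists>C>0. \<exists>g>-1. \<exists>r>0. \<forall>z\<in>D.
      dist z (of_real m) < r \<longrightarrow> norm (f z) \<le> C * dist z (of_real m) powr g"
    and decay: "C \<ge> 0" "\<And>z. z \<in> S \<Longrightarrow> r0 \<le> norm z \<Longrightarrow> norm (f z) \<le> C * (onorm (K z) / norm z)"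
    and P: "eventually P (end_filter \<sigma>)" and \<epsilon>: "\<epsilon> > 0"
  shows "\<exists>x\<in>I. \<exists>y\<in>I. P x \<and> P y \<and> norm (F (\<gamma> y) - F (of_real x)) < \<epsilon>"
proof (cases "\<bar>endpoint \<sigma>\<bar> = \<infinity>")
  case False
  then obtain m where m: "ereal m = endpoint \<sigma>" by (cases "endpoint \<sigma>") auto
  obtain Cf g r where Cf: "Cf > 0" "g > -1" "r > 0"
    "\<forall>z\<in>D. dist z (of_real m) < r \<longrightarrow> norm (f z) \<le> Cf * dist z (of_real m) powr g"
    using finite_bound[OF m] by (elim exE conjE)
  obtain c where c: "c \<in> I" "\<forall>x\<in>I. \<sigma> * x < \<sigma> * c \<longrightarrow> P x"
    using P unfolding eventually_end_filter[OF \<sigma>] by (elim bexE)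
  have ul: "uniform_limit {0..1} (\<lambda>x t. H (t, x)) (\<lambda>t. complex_of_real m) (end_filter \<sigma>)"
    using fixd False unfolding fixes_end_def m[symmetric] by simp
  have "\<exists>x\<in>I. \<exists>y\<in>I. \<sigma> * x < \<sigma> * c \<and> \<sigma> * y < \<sigma> * c \<and> norm (F (\<gamma> y) - F (of_real x)) < \<epsilon>"
  proof (rule finite_end_gap[OF F(2) strict_primitive_continuous[OF F(1)] \<sigma> m Cf(1-3) _ _ \<epsilon> c(1)])
    show "norm (f z) \<le> Cf * dist z (of_real m) powr g" if "z \<in> D" "dist z (of_real m) < r" for z
      using Cf(4) that by simp
    fix \<rho> :: real assume "\<rho> > 0"
    then have "\<forall>\<^sub>F x in end_filter \<sigma>. \<forall>t\<in>{0..1}. dist (H (t, x)) (of_real m) < \<rho>"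
      using ul unfolding uniform_limit_iff by simp
    then obtain c' where c': "c' \<in> I" "\<forall>x\<in>I. \<sigma> * x < \<sigma> * c' \<longrightarrow> (\<forall>t\<in>{0..1}. dist (H (t, x)) (of_real m) < \<rho>)"
      unfolding eventually_end_filter[OF \<sigma>] by (elim bexE)
    have "dist (\<gamma> y) (of_real m) < \<rho>" if "y \<in> I" "\<sigma> * y < \<sigma> * c'" for y
      using c'(2)[rule_format, OF that, of 1] H_1[OF that(1)] by simp
    then show "\<exists>c\<in>I. \<forall>y\<in>I. \<sigma> * y < \<sigma> * c \<longrightarrow> dist (\<gamma> y) (of_real m) < \<rho>" using c'(1) by auto
  qed
  then show ?thesis using c(2) by auto
next
  case True
  have ne: "\<forall>\<^sub>F x in end_filter \<sigma>. x \<in> I"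
    unfolding eventually_end_filter[OF \<sigma>] using ereal_dense2[OF ends_less] by (auto simp: einterval_def)
  have "\<forall>\<^sub>F x in end_filter \<sigma>. \<forall>t\<in>{0..1}. r0 \<le> norm (H (t, x))"
    using fixd True unfolding fixes_end_def by simp
  with ne have far: "\<forall>\<^sub>F x in end_filter \<sigma>. x \<in> I \<and> (\<forall>t\<in>{0..1}. r0 \<le> norm (H (t, x)))"
    by (rule eventually_conj)
  have arcs: "\<exists>\<^sub>F x in end_filter \<sigma>. rectifiable_on {0..1} (\<lambda>t. H (t, x)) \<and>
      (\<exists>v<\<epsilon>. has_rs_integral (arc_length_form (\<lambda>z. onorm (K z) / norm z) (\<lambda>t. H (t, x))) v 0 1)" if "\<epsilon> > 0" for \<epsilon>
    using fixd True that unfolding fixes_end_def by simp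
  have "\<exists>x\<in>I. P x \<and> norm (F (\<gamma> x) - F (of_real x)) < \<epsilon>"
    by (rule infinite_end_gap[OF F(1) f decay(1) _ far _ P \<epsilon>]) (fact decay(2), fact arcs)
  then show ?thesis by blast
qed

lemma lower_contour_deformation:
  assumes D: "open D" "simply_connected D" "D \<subseteq> {z. Im z < 0}" and \<alpha>\<beta>: "\<alpha> < \<beta>"
    and \<gamma>: "deformed_contour K D \<alpha> \<beta> \<gamma>"
    and f: "f holomorphic_on D" "continuous_on (D \<union> complex_of_real ` einterval \<alpha> \<beta>) f"
    and finite_bound: "\<And>m. ereal m \<in> {\<alpha>, \<beta>} \<Longrightarrow> \<exists>C>0. \<exists>g>-1. \<exists>r>0. \<forall>z\<in>D.
      dist z (of_real m) < r \<longrightarrow> norm (f z) \<le> C * dist z (of_real m) powr g"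
    and decay: "C \<ge> 0" "\<And>z. z \<in> D \<union> complex_of_real ` einterval \<alpha> \<beta> \<Longrightarrow> r0 \<le> norm z \<Longrightarrow>
      norm (f z) \<le> C * (onorm (K z) / norm z)"
    and J1: "has_improper_rs_integral (\<lambda>s u v. f (of_real s) * of_real (v - u)) J1 \<alpha> \<beta>"
    and J2: "has_improper_rs_integral (\<lambda>s u v. f (\<gamma> s) * (\<gamma> v - \<gamma> u)) J2 \<alpha> \<beta>"
  shows "J1 = J2"
proof -
  obtain H where H: "continuous_on ({0..1} \<times> einterval \<alpha> \<beta>) H"
    "H ` ({0..1} \<times> einterval \<alpha> \<beta>) \<subseteq> D \<union> complex_of_real ` einterval \<alpha> \<beta>"
    "\<forall>x\<in>einterval \<alpha> \<beta>. H (0, x) = complex_of_real x \<and> H (1, x) = \<gamma> x"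
    "fixes_end K H (lower_end \<alpha>) \<alpha>" "fixes_end K H (upper_end \<beta>) \<beta>"
    using \<gamma> unfolding deformed_contour_def by (elim conjE exE)
  have \<gamma>D: "\<gamma> ` einterval \<alpha> \<beta> \<subseteq> D" and rect: "\<And>r. rectifiable_on (einterval \<alpha> \<beta> \<inter> {-r..r}) \<gamma>"
    using \<gamma> unfolding deformed_contour_def by blast+
  interpret swept_region D \<alpha> \<beta> \<gamma> H
  proof
    show "\<forall>\<^sub>F x in lower_end \<alpha>. \<forall>t\<in>{0..1}. H (t, x) \<notin> C"
      if "bounded C" "\<And>m. ereal m = \<alpha> \<Longrightarrow> complex_of_real m \<notin> closure C" for C
      by (rule fixes_end_escape[OF H(4) that])
    show "\<forall>\<^sub>F x in upper_end \<beta>. \<forall>t\<in>{0..1}. H (t, x) \<notin> C"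
      if "bounded C" "\<And>m. ereal m = \<beta> \<Longrightarrow> complex_of_real m \<notin> closure C" for C
      by (rule fixes_end_escape[OF H(5) that])
  qed (use D \<alpha>\<beta> H \<gamma>D in auto)
  obtain F where F: "strict_primitive_on F f S" "\<And>z. z \<in> D \<Longrightarrow> (F has_field_derivative f z) (at z)"
    by (rule strict_primitive_exists[OF D(2) f], rule that)
  have e: "end_filter 1 = lower_end \<alpha>" "endpoint 1 = \<alpha>" "end_filter (-1) = upper_end \<beta>" "endpoint (-1) = \<beta>"
    by (simp_all add: end_filter_def endpoint_def)
  show ?thesis
  proof (rule integrals_agree[OF F(1) f(2) rect _ _ J1 J2])
    show "\<exists>x\<in>I. \<exists>y\<in>I. P x \<and> P y \<and> norm (F (\<gamma> y) - F (of_real x)) < \<epsilon>"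
      if "eventually P (lower_end \<alpha>)" "\<epsilon> > 0" for P \<epsilon>
      by (rule end_gap[of 1 K, unfolded e, OF _ H(4) F f(2) _ decay(1) _ that])
        (simp, assumption, simp add: finite_bound, fact decay(2))
    show "\<exists>x\<in>I. \<exists>y\<in>I. P x \<and> P y \<and> norm (F (\<gamma> y) - F (of_real x)) < \<epsilon>"
      if "eventually P (upper_end \<beta>)" "\<epsilon> > 0" for P \<epsilon>
      by (rule end_gap[of "-1" K, unfolded e, OF _ H(5) F f(2) _ decay(1) _ that])
        (simp, assumption, simp add: finite_bound, fact decay(2))
  qed
qed

lemma dist_cnj: "dist (cnj z) (cnj w) = dist z w"
  by (metis complex_cnj_diff complex_mod_cnj dist_norm)

lemma rectifiable_on_cnj: "rectifiable_on T (\<lambda>t. cnj (p t)) = rectifiable_on T p"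
  unfolding rectifiable_on_def by (simp add: dist_norm[symmetric] dist_cnj)

lemma arc_length_form_cnj: "arc_length_form g (\<lambda>t. cnj (p t)) = arc_length_form (\<lambda>z. g (cnj z)) p"
  unfolding arc_length_form_def by (simp add: dist_norm[symmetric] dist_cnj)

lemma fixes_end_cnj:
  assumes "fixes_end K H F e"
  shows "fixes_end (\<lambda>z. K (cnj z)) (\<lambda>tx. cnj (H tx)) F e"
proof (cases "\<bar>e\<bar> = \<infinity>")
  case True
  then show ?thesis using assms unfolding fixes_end_def
    by (simp add: rectifiable_on_cnj arc_length_form_cnj)
next
  case False
  have "dist (cnj z) (of_real m) = dist z (of_real m)" for z m using dist_cnj[of z "of_real m"] by simp
  then show ?thesis using assms False unfolding fixes_end_def uniform_limit_iff by simp
qed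

lemma deformed_contour_cnj:
  assumes "deformed_contour K D \<alpha> \<beta> \<gamma>"
  shows "deformed_contour (\<lambda>z. K (cnj z)) (cnj ` D) \<alpha> \<beta> (\<lambda>x. cnj (\<gamma> x))"
proof -
  obtain H where H: "continuous_on ({0..1} \<times> einterval \<alpha> \<beta>) H"
    "H ` ({0..1} \<times> einterval \<alpha> \<beta>) \<subseteq> D \<union> complex_of_real ` einterval \<alpha> \<beta>"
    "\<forall>x\<in>einterval \<alpha> \<beta>. H (0, x) = complex_of_real x \<and> H (1, x) = \<gamma> x"
    "fixes_end K H (lower_end \<alpha>) \<alpha>" "fixes_end K H (upper_end \<beta>) \<beta>"
    and inj: "inj_on \<gamma> (einterval \<alpha> \<beta>)" and im: "\<gamma> ` einterval \<alpha> \<beta> \<subseteq> D"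
    and rect: "\<forall>r. rectifiable_on (einterval \<alpha> \<beta> \<inter> {-r..r}) \<gamma>"
    using assms unfolding deformed_contour_def by (elim conjE exE)
  let ?H = "\<lambda>tx. cnj (H tx)"
  have "continuous_on ({0..1} \<times> einterval \<alpha> \<beta>) ?H" using H(1) by (intro continuous_intros)
  moreover have "?H ` ({0..1} \<times> einterval \<alpha> \<beta>) \<subseteq> cnj ` D \<union> complex_of_real ` einterval \<alpha> \<beta>"
  proof
    fix w assume "w \<in> ?H ` ({0..1} \<times> einterval \<alpha> \<beta>)"
    then obtain tx where tx: "w = cnj (H tx)" "tx \<in> {0..1} \<times> einterval \<alpha> \<beta>" by blast
    then have "H tx \<in> D \<union> complex_of_real ` einterval \<alpha> \<beta>" using H(2) by blast
    then show "w \<in> cnj ` D \<union> complex_of_real ` einterval \<alpha> \<beta>" unfolding tx(1) by auto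
  qed
  moreover have "\<forall>x\<in>einterval \<alpha> \<beta>. ?H (0, x) = complex_of_real x \<and> ?H (1, x) = cnj (\<gamma> x)" using H(3) by simp
  moreover have "inj_on (\<lambda>x. cnj (\<gamma> x)) (einterval \<alpha> \<beta>)" using inj by (simp add: inj_on_def)
  ultimately show ?thesis
    unfolding deformed_contour_def rectifiable_on_cnj
    using im rect fixes_end_cnj[OF H(4)] fixes_end_cnj[OF H(5)] by blast
qed

text \<open>A domain in the upper half-plane is reflected to the lower one. The function \<open>f\<close> becomes \<open>cnj (f (cnj z))\<close>, and both integrals are
  conjugated.\<close>

lemma contour_deformation:
  assumes D: "open D" "simply_connected D" "D \<subseteq> {z. Im z < 0} \<or> D \<subseteq> {z. Im z > 0}" and \<alpha>\<beta>: "\<alpha> < \<beta>"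
    and \<gamma>: "deformed_contour K D \<alpha> \<beta> \<gamma>"
    and f: "f holomorphic_on D" "continuous_on (D \<union> complex_of_real ` einterval \<alpha> \<beta>) f"
    and finite_bound: "\<And>m. ereal m \<in> {\<alpha>, \<beta>} \<Longrightarrow> \<exists>C>0. \<exists>g>-1. \<exists>r>0. \<forall>z\<in>D.
      dist z (of_real m) < r \<longrightarrow> norm (f z) \<le> C * dist z (of_real m) powr g"
    and decay: "C \<ge> 0" "\<And>z. z \<in> D \<union> complex_of_real ` einterval \<alpha> \<beta> \<Longrightarrow> r0 \<le> norm z \<Longrightarrow>
      norm (f z) \<le> C * (onorm (K z) / norm z)"
    and J1: "has_improper_rs_integral (\<lambda>s u v. f (of_real s) * of_real (v - u)) J1 \<alpha> \<beta>"
    and J2: "has_improper_rs_integral (\<lambda>s u v. f (\<gamma> s) * (\<gamma> v - \<gamma> u)) J2 \<alpha> \<beta>"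
  shows "J1 = J2"
  using D(3)
proof
  assume "D \<subseteq> {z. Im z < 0}"
  show ?thesis
    by (rule lower_contour_deformation[OF D(1,2) \<open>D \<subseteq> {z. Im z < 0}\<close> \<alpha>\<beta> \<gamma> f _ decay(1) _ J1 J2])
      (fact finite_bound, fact decay(2))
next
  assume upper: "D \<subseteq> {z. Im z > 0}"
  let ?D = "cnj ` D" and ?f = "\<lambda>z. cnj (f (cnj z))"
  let ?S = "D \<union> complex_of_real ` einterval \<alpha> \<beta>"
  have inD: "w \<in> ?D \<longleftrightarrow> cnj w \<in> D" for w by (metis complex_cnj_cnj image_iff)
  have inS: "w \<in> ?D \<union> complex_of_real ` einterval \<alpha> \<beta> \<Longrightarrow> cnj w \<in> ?S" for w
    using inD by auto
  have D': "open ?D"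
  proof -
    have "?D = cnj -` D" using inD by blast
    then show ?thesis using D(1) by (simp add: continuous_open_vimage)
  qed
  have "?D homeomorphic D"
    unfolding homeomorphic_def homeomorphism_def
    by (intro exI[of _ cnj]) (auto intro!: continuous_intros simp: image_image)
  then have sc: "simply_connected ?D" using D(2) homeomorphic_simply_connected_eq by blast
  have low: "?D \<subseteq> {z. Im z < 0}" using upper by auto
  have holo: "?f holomorphic_on ?D"
  proof -
    have "cnj ` ?D = D" by (simp add: image_image)
    then have "cnj \<circ> f \<circ> cnj holomorphic_on ?D"
      using f(1) by (intro holomorphic_on_compose_cnj_cnj D') simp
    then show ?thesis by (simp add: o_def)
  qed
  have cont: "continuous_on (?D \<union> complex_of_real ` einterval \<alpha> \<beta>) ?f"
  proof -
    have "continuous_on (?D \<union> complex_of_real ` einterval \<alpha> \<beta>) (\<lambda>z. f (cnj z))"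
      by (rule continuous_on_compose2[OF f(2)]) (use inS in \<open>auto intro!: continuous_intros\<close>)
    then show ?thesis by (rule continuous_on_cnj)
  qed
  have fb: "\<exists>C>0. \<exists>g>-1. \<exists>r>0. \<forall>z\<in>?D. dist z (of_real m) < r \<longrightarrow> norm (?f z) \<le> C * dist z (of_real m) powr g"
    if m: "ereal m \<in> {\<alpha>, \<beta>}" for m
  proof -
    obtain C g r where C: "C > 0" "g > -1" "r > 0"
      "\<forall>z\<in>D. dist z (of_real m) < r \<longrightarrow> norm (f z) \<le> C * dist z (of_real m) powr g"
      using finite_bound[OF m] by (elim exE conjE)
    have "norm (?f z) \<le> C * dist z (of_real m) powr g" if "z \<in> ?D" "dist z (of_real m) < r" for z
    proof -
      have d: "dist (cnj z) (of_real m) = dist z (of_real m)" using dist_cnj[of z "of_real m"] by simp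
      have "cnj z \<in> D" using that(1) inD by simp
      from C(4)[rule_format, OF this] that(2) show ?thesis unfolding d by simp
    qed
    then show ?thesis using C(1-3) by blast
  qed
  have dec: "norm (?f z) \<le> C * (onorm ((\<lambda>z. K (cnj z)) z) / norm z)"
    if "z \<in> ?D \<union> complex_of_real ` einterval \<alpha> \<beta>" "r0 \<le> norm z" for z
    using decay(2)[OF inS[OF that(1)]] that(2) by simp
  have J1': "has_improper_rs_integral (\<lambda>s u v. ?f (of_real s) * of_real (v - u)) (cnj J1) \<alpha> \<beta>"
    using has_improper_rs_integral_linear[OF bounded_linear_cnj J1] by simp
  have J2': "has_improper_rs_integral (\<lambda>s u v. ?f (cnj (\<gamma> s)) * (cnj (\<gamma> v) - cnj (\<gamma> u))) (cnj J2) \<alpha> \<beta>"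
    using has_improper_rs_integral_linear[OF bounded_linear_cnj J2] by simp
  have "cnj J1 = cnj J2"
    by (rule lower_contour_deformation[OF D' sc low \<alpha>\<beta> deformed_contour_cnj[OF \<gamma>] holo cont _ decay(1) _ J1' J2'])
      (fact fb, fact dec)
  then show ?thesis by simp
qed

section \<open>Resolvents of bounded operators\<close>

lemma norm_le_onorm: "bounded_clinear T \<Longrightarrow> norm x \<le> c \<Longrightarrow> norm (T x) \<le> onorm T * c"
  by (meson bounded_clinear_bounded_linear bounded_clinear_norm_le mult_left_mono onorm_pos_le order_trans)

lemma onorm_nonneg: "bounded_clinear T \<Longrightarrow> 0 \<le> onorm T"
  by (rule onorm_pos_le[OF bounded_clinear_bounded_linear])

lemma
  assumes "z \<notin> spectrum UNIV Z"
  shows bounded_clinear_resolvent: "bounded_clinear (resolvent Z z)"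
    and resolvent_right: "Z (resolvent Z z x) - z *\<^sub>C resolvent Z z x = x"
    and resolvent_left: "resolvent Z z (Z x - z *\<^sub>C x) = x"
proof -
  obtain R where R: "bounded_clinear R" "\<And>y. Z (R y) - z *\<^sub>C R y = y" "\<And>x. R (Z x - z *\<^sub>C x) = x"
    using assms unfolding spectrum_def by blast
  have "resolvent Z z = R"
    unfolding resolvent_def by (rule inv_equality) (rule R(3), rule R(2))
  then show "bounded_clinear (resolvent Z z)" "Z (resolvent Z z x) - z *\<^sub>C resolvent Z z x = x"
    "resolvent Z z (Z x - z *\<^sub>C x) = x" using R by simp_all
qed

lemma resolvent_identity:
  assumes z: "z \<notin> spectrum UNIV Z" and w: "w \<notin> spectrum UNIV Z"
  shows "resolvent Z z x - resolvent Z w x = (z - w) *\<^sub>C resolvent Z z (resolvent Z w x)"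
proof -
  let ?u = "resolvent Z w x"
  note bc = bounded_clinear_resolvent[OF z]
  have "resolvent Z z (Z ?u - z *\<^sub>C ?u) = ?u" by (rule resolvent_left[OF z])
  moreover have "Z ?u - z *\<^sub>C ?u = x - (z - w) *\<^sub>C ?u"
    using resolvent_right[OF w, of x] by (simp add: scaleC_diff_left algebra_simps)
  ultimately have "resolvent Z z (x - (z - w) *\<^sub>C ?u) = ?u" by simp
  moreover have "resolvent Z z (x - (z - w) *\<^sub>C ?u) = resolvent Z z x - (z - w) *\<^sub>C resolvent Z z ?u"
    using bc by (simp add: linear_diff[OF bounded_linear.linear[OF bounded_clinear_bounded_linear]] bounded_clinear_scaleC)
  ultimately show ?thesis by (simp add: algebra_simps)
qed

text \<open>The resolvent identity bounds the norm of one resolvent by that of another one nearby, given that both exist; this replaces the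
  Neumann series.\<close>

lemma onorm_resolvent_near:
  assumes z: "z \<notin> spectrum UNIV Z" and w: "w \<notin> spectrum UNIV Z"
    and near: "cmod (w - z) * onorm (resolvent Z z) \<le> 1 / 2"
  shows "onorm (resolvent Z w) \<le> 2 * onorm (resolvent Z z)"
proof (rule onorm_bound)
  let ?N = "onorm (resolvent Z z)"
  note bc = bounded_clinear_resolvent[OF z]
  show "0 \<le> 2 * ?N" using onorm_nonneg[OF bc] by simp
  fix x
  let ?u = "resolvent Z w x"
  have "?u = resolvent Z z x - (z - w) *\<^sub>C resolvent Z z ?u"
    using resolvent_identity[OF z w, of x] by (simp add: algebra_simps)
  then have "norm ?u \<le> norm (resolvent Z z x) + norm ((z - w) *\<^sub>C resolvent Z z ?u)"
    by (metis norm_triangle_ineq4)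
  also have "\<dots> \<le> ?N * norm x + cmod (w - z) * (?N * norm ?u)"
    unfolding norm_scaleC using bounded_clinear_norm_le[OF bc]
    by (intro add_mono mult_mono) (simp_all add: norm_minus_commute)
  also have "cmod (w - z) * (?N * norm ?u) \<le> 1 / 2 * norm ?u"
    unfolding mult.assoc[symmetric] by (rule mult_right_mono[OF near]) simp
  finally show "norm ?u \<le> 2 * ?N * norm x" by simp
qed

lemma tendsto_resolvent:
  assumes G: "G \<inter> spectrum UNIV Z = {}" and z: "z \<in> G"
  shows "((\<lambda>w. resolvent Z w x) \<longlongrightarrow> resolvent Z z x) (at z within G)"
proof -
  have zs: "z \<notin> spectrum UNIV Z" using G z by blast
  let ?N = "onorm (resolvent Z z)"
  note bc = bounded_clinear_resolvent[OF zs]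
  define d where "d = 1 / (2 * (?N + 1))"
  have N: "?N \<ge> 0" by (rule onorm_nonneg[OF bc])
  have d: "d > 0" using N by (simp add: d_def)
  have b: "norm (resolvent Z w x - resolvent Z z x) \<le> cmod (w - z) * (?N * (2 * ?N * norm x))"
    if w: "w \<in> G" "dist w z < d" for w
  proof -
    have ws: "w \<notin> spectrum UNIV Z" using G w by blast
    have "cmod (w - z) * ?N \<le> d * (?N + 1)"
      using w(2) N d by (intro mult_mono) (auto simp: dist_norm)
    also have "\<dots> = 1 / 2" using N by (simp add: d_def)
    finally have o: "onorm (resolvent Z w) \<le> 2 * ?N" by (rule onorm_resolvent_near[OF zs ws])
    have "norm (resolvent Z w x) \<le> 2 * ?N * norm x"
      using bounded_clinear_norm_le[OF bounded_clinear_resolvent[OF ws], of x] mult_right_mono[OF o, of "norm x"]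
      by simp
    then have "norm (resolvent Z z (resolvent Z w x)) \<le> ?N * (2 * ?N * norm x)" by (rule norm_le_onorm[OF bc])
    then have "cmod (z - w) * norm (resolvent Z z (resolvent Z w x)) \<le> cmod (z - w) * (?N * (2 * ?N * norm x))"
      by (intro mult_left_mono) auto
    moreover have "norm (resolvent Z z x - resolvent Z w x) = cmod (z - w) * norm (resolvent Z z (resolvent Z w x))"
      unfolding resolvent_identity[OF zs ws] norm_scaleC ..
    ultimately show ?thesis by (simp add: norm_minus_commute)
  qed
  have "((\<lambda>w. cmod (w - z) * (?N * (2 * ?N * norm x))) \<longlongrightarrow> cmod (z - z) * (?N * (2 * ?N * norm x))) (at z within G)"
    by (intro tendsto_intros)
  then have lim: "((\<lambda>w. cmod (w - z) * (?N * (2 * ?N * norm x))) \<longlongrightarrow> 0) (at z within G)" by simp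
  have "\<forall>\<^sub>F w in at z within G. norm (resolvent Z w x - resolvent Z z x) \<le> cmod (w - z) * (?N * (2 * ?N * norm x))"
    unfolding eventually_at using d b by blast
  then have "((\<lambda>w. resolvent Z w x - resolvent Z z x) \<longlongrightarrow> 0) (at z within G)"
    by (rule Lim_null_comparison) (rule lim)
  then show ?thesis by (simp add: LIM_zero_iff)
qed

lemma onorm_resolvent_far:
  assumes Z: "bounded_clinear Z" and z: "z \<notin> spectrum UNIV Z" "2 * onorm Z \<le> cmod z" "z \<noteq> 0"
  shows "onorm (resolvent Z z) \<le> 2 / cmod z"
proof (rule onorm_bound)
  fix x
  let ?u = "resolvent Z z x"
  have "cmod z * norm ?u = norm (z *\<^sub>C ?u)" by (simp add: norm_scaleC)
  also have "z *\<^sub>C ?u = Z ?u - x" using resolvent_right[OF z(1), of x] by (simp add: algebra_simps)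
  also have "norm (Z ?u - x) \<le> norm (Z ?u) + norm x" by (rule norm_triangle_ineq4)
  also have "norm (Z ?u) \<le> onorm Z * norm ?u" by (rule bounded_clinear_norm_le[OF Z])
  also have "onorm Z * norm ?u \<le> cmod z / 2 * norm ?u" using z(2) by (intro mult_right_mono) auto
  finally have "cmod z * norm ?u \<le> 2 * norm x" by simp
  then show "norm ?u \<le> 2 / cmod z * norm x" using z(3) by (simp add: field_simps)
qed simp

text \<open>Local boundedness suffices on a compact part of \<open>G\<close>, and the decay of the resolvent far away from the origin takes care of the rest.\<close>

lemma onorm_resolvent_uniform:
  assumes Z: "bounded_clinear Z" and G: "closed G" "G \<inter> spectrum UNIV Z = {}"
  shows "\<exists>C\<ge>0. \<forall>z\<in>G. onorm (resolvent Z z) \<le> C / sqrt (1 + (cmod z)\<^sup>2)"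
proof -
  define N0 where "N0 = 2 * onorm Z + 1"
  have N0: "N0 \<ge> 1" using onorm_nonneg[OF Z] by (simp add: N0_def)
  let ?R = "\<lambda>z. onorm (resolvent Z z)"
  have R0: "?R z \<ge> 0" if "z \<in> G" for z
    by (rule onorm_nonneg[OF bounded_clinear_resolvent]) (use that G in blast)
  have cK: "compact (G \<inter> cball 0 N0)" using G(1) by (intro closed_Int_compact) auto
  have cov: "G \<inter> cball 0 N0 \<subseteq> (\<Union>z\<in>G \<inter> cball 0 N0. ball z (1 / (2 * (?R z + 1))))"
  proof
    fix z assume z: "z \<in> G \<inter> cball 0 N0"
    then have "z \<in> ball z (1 / (2 * (?R z + 1)))" using R0[of z] by simp
    with z show "z \<in> (\<Union>z\<in>G \<inter> cball 0 N0. ball z (1 / (2 * (?R z + 1))))" by blast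
  qed
  obtain F where F: "F \<subseteq> G \<inter> cball 0 N0" "finite F"
    "G \<inter> cball 0 N0 \<subseteq> (\<Union>z\<in>F. ball z (1 / (2 * (?R z + 1))))"
    by (rule compactE_image[OF cK _ cov]) auto
  define M where "M = (\<Sum>c\<in>F. 2 * ?R c)"
  have M0: "M \<ge> 0" unfolding M_def using R0 F(1) by (intro sum_nonneg) auto
  have near: "?R z \<le> M" if z: "z \<in> G" "cmod z \<le> N0" for z
  proof -
    have "z \<in> G \<inter> cball 0 N0" using z by simp
    then obtain c where c: "c \<in> F" "z \<in> ball c (1 / (2 * (?R c + 1)))" using F(3) by blast
    have cG: "c \<in> G" using c F(1) by blast
    have "cmod (z - c) * ?R c \<le> 1 / (2 * (?R c + 1)) * (?R c + 1)"
      using c(2) R0[OF cG] by (intro mult_mono) (auto simp: dist_norm norm_minus_commute)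
    also have "\<dots> = 1 / 2" using R0[OF cG] by simp
    finally have "?R z \<le> 2 * ?R c"
      by (intro onorm_resolvent_near) (use z cG G(2) in auto)
    also have "\<dots> \<le> M" unfolding M_def
      by (rule member_le_sum[OF c(1)]) (use F R0 in auto)
    finally show ?thesis .
  qed
  define C where "C = M * sqrt (1 + N0\<^sup>2) + 4"
  have C0: "C \<ge> 0" using M0 by (simp add: C_def)
  have "?R z \<le> C / sqrt (1 + (cmod z)\<^sup>2)" if z: "z \<in> G" for z
  proof -
    have s: "sqrt (1 + (cmod z)\<^sup>2) > 0" by (simp add: add_pos_nonneg)
    have "?R z * sqrt (1 + (cmod z)\<^sup>2) \<le> C"
    proof (cases "cmod z \<le> N0")
      case True
      have "?R z * sqrt (1 + (cmod z)\<^sup>2) \<le> M * sqrt (1 + N0\<^sup>2)"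
        using near[OF z True] True M0 by (intro mult_mono) (auto intro: power_mono)
      then show ?thesis by (simp add: C_def)
    next
      case False
      then have z1: "cmod z > 1" "2 * onorm Z \<le> cmod z" using N0 by (auto simp: N0_def)
      then have z0: "z \<noteq> 0" by auto
      have "sqrt (1 + (cmod z)\<^sup>2) \<le> sqrt ((2 * cmod z)\<^sup>2)"
      proof (rule real_sqrt_le_mono)
        have "1 \<le> (cmod z)\<^sup>2" using z1(1) by (simp add: one_le_power)
        then show "1 + (cmod z)\<^sup>2 \<le> (2 * cmod z)\<^sup>2" by (simp add: power_mult_distrib)
      qed
      also have "\<dots> = 2 * cmod z" by (rule real_sqrt_unique) simp_all
      finally have "sqrt (1 + (cmod z)\<^sup>2) \<le> 2 * cmod z" .
      then have "?R z * sqrt (1 + (cmod z)\<^sup>2) \<le> 2 / cmod z * (2 * cmod z)"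
        using z G(2) z1 z0 by (intro mult_mono onorm_resolvent_far[OF Z]) auto
      also have "\<dots> = 4" using z0 by simp
      also have "4 \<le> C" using M0 by (simp add: C_def)
      finally show ?thesis .
    qed
    then show ?thesis using s by (simp add: pos_le_divide_eq)
  qed
  then show ?thesis using C0 by blast
qed

lemma has_vector_derivative_quotient:
  fixes f :: "real \<Rightarrow> 'a::real_normed_vector"
  assumes "((\<lambda>h. (1 / h) *\<^sub>R (f (t + h) - f t)) \<longlongrightarrow> f') (at 0)"
  shows "(f has_vector_derivative f') (at t)"
  unfolding has_vector_derivative_def has_derivative_at
proof
  have "((\<lambda>h. norm ((1 / h) *\<^sub>R (f (t + h) - f t) - f')) \<longlongrightarrow> 0) (at 0)"
    using assms by (simp add: tendsto_norm_zero_iff LIM_zero_iff)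
  then show "((\<lambda>h. norm (f (t + h) - f t - h *\<^sub>R f') / norm h) \<longlongrightarrow> 0) (at 0)"
  proof (rule Lim_transform_eventually)
    show "\<forall>\<^sub>F h in at 0. norm ((1 / h) *\<^sub>R (f (t + h) - f t) - f') = norm (f (t + h) - f t - h *\<^sub>R f') / norm h"
      unfolding eventually_at
    proof (intro exI[of _ 1] conjI ballI impI)
      fix h :: real assume "h \<noteq> 0 \<and> dist h 0 < 1"
      then have "(1 / h) *\<^sub>R (f (t + h) - f t) - f' = (1 / h) *\<^sub>R (f (t + h) - f t - h *\<^sub>R f')"
        by (simp add: scaleR_diff_right)
      then show "norm ((1 / h) *\<^sub>R (f (t + h) - f t) - f') = norm (f (t + h) - f t - h *\<^sub>R f') / norm h"
        by (simp add: divide_inverse mult.commute)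
    qed simp
  qed
qed (rule bounded_linear_scaleR_left)

lemma resolvent_has_vector_derivative:
  assumes J: "open J" "complex_of_real ` J \<inter> spectrum UNIV Z = {}" and t: "t \<in> J"
  shows "((\<lambda>t. resolvent Z (of_real t) x) has_vector_derivative
    resolvent Z (of_real t) (resolvent Z (of_real t) x)) (at t)"
proof (rule has_vector_derivative_quotient)
  let ?R = "\<lambda>t. resolvent Z (complex_of_real t)"
  have "((\<lambda>s. resolvent Z (of_real s) (?R t x)) \<longlongrightarrow> ?R t (?R t x)) (at t within J)"
  proof (rule filterlim_compose[OF tendsto_resolvent[OF J(2)]])
    show "filterlim complex_of_real (at (complex_of_real t) within complex_of_real ` J) (at t within J)"
      unfolding filterlim_at using t
      by (auto intro!: tendsto_intros simp: eventually_at intro: exI[of _ 1])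
  qed (use t in blast)
  then have "((\<lambda>s. ?R s (?R t x)) \<longlongrightarrow> ?R t (?R t x)) (at t)"
    unfolding at_within_open[OF t J(1)] .
  then have lim: "((\<lambda>h. ?R (t + h) (?R t x)) \<longlongrightarrow> ?R t (?R t x)) (at 0)"
    by (rule LIM_offset_zero)
  obtain d where d: "d > 0" "ball t d \<subseteq> J" by (rule openE[OF J(1) t])
  have "\<forall>\<^sub>F h in at 0. ?R (t + h) (?R t x) = (1 / h) *\<^sub>R (?R (t + h) x - ?R t x)"
    unfolding eventually_at
  proof (intro exI[of _ d] conjI ballI impI)
    fix h :: real assume h: "h \<noteq> 0 \<and> dist h 0 < d"
    then have "t + h \<in> J" using d(2) by (force simp: dist_norm)
    then have "of_real (t + h) \<notin> spectrum UNIV Z" "of_real t \<notin> spectrum UNIV Z" using J(2) t by blast+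
    from resolvent_identity[OF this, of x]
    have "?R (t + h) x - ?R t x = h *\<^sub>R ?R (t + h) (?R t x)" by (simp add: scaleR_scaleC)
    then show "?R (t + h) (?R t x) = (1 / h) *\<^sub>R (?R (t + h) x - ?R t x)" using h by simp
  qed (rule d)
  then show "((\<lambda>h. (1 / h) *\<^sub>R (?R (t + h) x - ?R t x)) \<longlongrightarrow> ?R t (?R t x)) (at 0)"
    by (rule Lim_transform_eventually[OF lim])
qed

section \<open>Holomorphic operator functions\<close>

lemma op_continuous_on_dist:
  assumes "op_continuous_on S K" "z \<in> S" "e > 0"
  shows "\<exists>d>0. \<forall>w\<in>S. dist w z < d \<longrightarrow> onorm (\<lambda>x. K w x - K z x) < e"
proof -
  have "((\<lambda>w. onorm (\<lambda>x. K w x - K z x)) \<longlongrightarrow> 0) (at z within S)"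
    using assms unfolding op_continuous_on_def by blast
  from order_tendstoD(2)[OF this assms(3)]
  obtain d where d: "d > 0" "\<forall>w\<in>S. w \<noteq> z \<and> dist w z < d \<longrightarrow> onorm (\<lambda>x. K w x - K z x) < e"
    unfolding eventually_at by blast
  have "onorm (\<lambda>x. K w x - K z x) < e" if "w \<in> S" "dist w z < d" for w
    using d(2) that assms(3) by (cases "w = z") (auto simp: onorm_zero)
  with d(1) show ?thesis by blast
qed

lemma op_uniformly_continuous_on_segment:
  assumes K: "op_continuous_on S K" "\<And>z. z \<in> S \<Longrightarrow> bounded_clinear (K z)"
    and ab: "complex_of_real ` {a..b} \<subseteq> S" and e: "e > 0"
  shows "\<exists>\<delta>>0. \<forall>s\<in>{a..b}. \<forall>t\<in>{a..b}. \<bar>s - t\<bar> < \<delta> \<longrightarrow>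
    onorm (\<lambda>x. K (of_real s) x - K (of_real t) x) \<le> e"
proof -
  have in_S: "complex_of_real t \<in> S" if "t \<in> {a..b}" for t using ab that by blast
  have "\<exists>d>0. \<forall>s\<in>{a..b}. \<bar>s - t\<bar> < d \<longrightarrow> onorm (\<lambda>x. K (of_real s) x - K (of_real t) x) < e / 2" if t: "t \<in> {a..b}" for t
  proof -
    obtain d where d: "d > 0" "\<forall>w\<in>S. dist w (of_real t) < d \<longrightarrow> onorm (\<lambda>x. K w x - K (of_real t) x) < e / 2"
      using op_continuous_on_dist[OF K(1) in_S[OF t], of "e / 2"] e by auto
    have "dist (complex_of_real s) (of_real t) = \<bar>s - t\<bar>" for s by (simp add: dist_of_real dist_real_def)
    then show ?thesis using d in_S by (intro exI[of _ d]) simp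
  qed
  then obtain d where d: "\<And>t. t \<in> {a..b} \<Longrightarrow> d t > 0"
    "\<And>t s. t \<in> {a..b} \<Longrightarrow> s \<in> {a..b} \<Longrightarrow> \<bar>s - t\<bar> < d t \<Longrightarrow> onorm (\<lambda>x. K (of_real s) x - K (of_real t) x) < e / 2"
    by metis
  have cov: "{a..b} \<subseteq> \<Union>((\<lambda>t. ball t (d t)) ` {a..b})" using d(1) by force
  obtain \<delta> where \<delta>: "\<delta> > 0" "\<And>x. x \<in> {a..b} \<Longrightarrow> \<exists>G\<in>(\<lambda>t. ball t (d t)) ` {a..b}. ball x \<delta> \<subseteq> G"
    using Heine_Borel_lemma[OF compact_Icc cov] by blast
  show ?thesis
  proof (intro exI conjI ballI impI)
    fix s t assume st: "s \<in> {a..b}" "t \<in> {a..b}" "\<bar>s - t\<bar> < \<delta>"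
    obtain c where c: "c \<in> {a..b}" "ball s \<delta> \<subseteq> ball c (d c)" using \<delta>(2)[OF st(1)] by blast
    have "s \<in> ball s \<delta>" "t \<in> ball s \<delta>" using \<delta>(1) st(3) by (auto simp: dist_real_def)
    then have "s \<in> ball c (d c)" "t \<in> ball c (d c)" using c(2) by blast+
    then have "\<bar>s - c\<bar> < d c" "\<bar>t - c\<bar> < d c" by (simp_all add: dist_real_def abs_minus_commute)
    then have o: "onorm (\<lambda>x. K (of_real s) x - K (of_real c) x) < e / 2" "onorm (\<lambda>x. K (of_real t) x - K (of_real c) x) < e / 2"
      using d(2)[OF c(1)] st by blast+
    have bl: "bounded_linear (\<lambda>x. K (of_real r) x - K (of_real c) x)" if "r \<in> {a..b}" for r
      by (intro bounded_clinear_bounded_linear bounded_clinear_diff K(2) in_S that c(1))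
    have "onorm (\<lambda>x. (K (of_real s) x - K (of_real c) x) + - (K (of_real t) x - K (of_real c) x)) \<le> e"
    proof (rule onorm_triangle_le[OF bl[OF st(1)] bounded_linear_minus[OF bl[OF st(2)]]])
      show "onorm (\<lambda>x. K (of_real s) x - K (of_real c) x) + onorm (\<lambda>x. - (K (of_real t) x - K (of_real c) x)) \<le> e"
        unfolding onorm_neg using o by linarith
    qed
    then show "onorm (\<lambda>x. K (of_real s) x - K (of_real t) x) \<le> e" by simp
  qed (rule \<delta>)
qed

lemma norm_cinner_op_le:
  assumes "bounded_clinear T" "bounded_clinear R"
  shows "cmod (cinner (T (R x)) y) \<le> onorm T * (onorm R * norm x) * norm y"
  by (rule order_trans[OF cauchy_schwarz_cinner], rule mult_right_mono)
    (use assms in \<open>simp_all add: norm_le_onorm bounded_clinear_norm_le\<close>)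

lemma continuous_on_op_resolvent:
  assumes K: "op_continuous_on S K" "\<And>z. z \<in> S \<Longrightarrow> bounded_clinear (K z)"
    and S: "S \<inter> spectrum UNIV Z = {}"
  shows "continuous_on S (\<lambda>z. cinner (K z (resolvent Z z x)) y)"
  unfolding continuous_on_def
proof
  fix z assume z: "z \<in> S"
  have R: "((\<lambda>w. resolvent Z w x) \<longlongrightarrow> resolvent Z z x) (at z within S)" by (rule tendsto_resolvent[OF S z])
  have o: "((\<lambda>w. onorm (\<lambda>x. K w x - K z x)) \<longlongrightarrow> 0) (at z within S)"
    using K(1) z unfolding op_continuous_on_def by blast
  have "((\<lambda>w. onorm (\<lambda>x. K w x - K z x) * norm (resolvent Z w x)) \<longlongrightarrow> 0 * norm (resolvent Z z x)) (at z within S)"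
    by (intro tendsto_mult o tendsto_norm R)
  then have "((\<lambda>w. onorm (\<lambda>x. K w x - K z x) * norm (resolvent Z w x)) \<longlongrightarrow> 0) (at z within S)" by simp
  moreover have "\<forall>\<^sub>F w in at z within S. norm (K w (resolvent Z w x) - K z (resolvent Z w x))
      \<le> onorm (\<lambda>x. K w x - K z x) * norm (resolvent Z w x)"
    unfolding eventually_at
    using bounded_clinear_norm_le[OF bounded_clinear_diff[OF K(2) K(2)[OF z]]] by (intro exI[of _ 1]) simp
  ultimately have 1: "((\<lambda>w. K w (resolvent Z w x) - K z (resolvent Z w x)) \<longlongrightarrow> 0) (at z within S)"
    by (rule Lim_null_comparison[rotated])
  have 2: "((\<lambda>w. K z (resolvent Z w x)) \<longlongrightarrow> K z (resolvent Z z x)) (at z within S)"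
    by (rule bounded_linear.tendsto[OF bounded_clinear_bounded_linear[OF K(2)[OF z]] R])
  have "((\<lambda>w. K w (resolvent Z w x)) \<longlongrightarrow> K z (resolvent Z z x)) (at z within S)"
    using tendsto_add[OF 1 2] by simp
  then show "((\<lambda>w. cinner (K w (resolvent Z w x)) y) \<longlongrightarrow> cinner (K z (resolvent Z z x)) y) (at z within S)"
    by (intro tendsto_cinner tendsto_const)
qed

lemma holomorphic_on_op_resolvent:
  assumes D: "open D" "D \<inter> spectrum UNIV Z = {}"
    and K: "op_holomorphic_on K D" "\<And>z. z \<in> D \<Longrightarrow> bounded_clinear (K z)"
  shows "(\<lambda>z. cinner (K z (resolvent Z z x)) y) holomorphic_on D"
  unfolding holomorphic_on_def
proof
  fix z assume z: "z \<in> D"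
  obtain K1 where K1: "bounded_clinear K1"
    "((\<lambda>h. onorm (\<lambda>x. (1 / h) *\<^sub>C (K (z + h) x - K z x) - K1 x)) \<longlongrightarrow> 0) (at 0)"
    using K(1) z unfolding op_holomorphic_on_def by blast
  let ?R = "resolvent Z"
  define Q where "Q = (\<lambda>h x. (1 / h) *\<^sub>C (K (z + h) x - K z x) - K1 x)"
  obtain d where d: "d > 0" "ball z d \<subseteq> D" by (rule openE[OF D(1) z])
  have near: "z + h \<in> D" if "dist h 0 < d" for h :: complex using d(2) that by (force simp: dist_norm)
  have lim: "((\<lambda>h::complex. ?R (z + h) v) \<longlongrightarrow> ?R z v) (at 0)" for v
    using tendsto_resolvent[OF D(2) z, of v] unfolding at_within_open[OF z D(1)] by (rule LIM_offset_zero)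
  have Qlim: "((\<lambda>h::complex. Q h (?R (z + h) x)) \<longlongrightarrow> 0) (at 0)"
  proof (rule Lim_null_comparison)
    show "\<forall>\<^sub>F h in at (0::complex). norm (Q h (?R (z + h) x)) \<le> onorm (Q h) * norm (?R (z + h) x)"
      unfolding eventually_at
    proof (intro exI[of _ d] conjI ballI impI)
      fix h :: complex assume "h \<noteq> 0 \<and> dist h 0 < d"
      then have "bounded_clinear (Q h)" unfolding Q_def
        by (intro bounded_clinear_diff bounded_clinear_scaleC_left K(2) near z K1(1)) simp
      then show "norm (Q h (?R (z + h) x)) \<le> onorm (Q h) * norm (?R (z + h) x)" by (rule bounded_clinear_norm_le)
    qed (rule d)
    have "((\<lambda>h::complex. onorm (Q h) * norm (?R (z + h) x)) \<longlongrightarrow> 0 * norm (?R z x)) (at 0)"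
      by (intro tendsto_mult tendsto_norm lim) (use K1(2) in \<open>simp add: Q_def\<close>)
    then show "((\<lambda>h::complex. onorm (Q h) * norm (?R (z + h) x)) \<longlongrightarrow> 0) (at 0)" by simp
  qed
  let ?f = "\<lambda>z. cinner (K z (?R z x)) y"
  have "((\<lambda>h::complex. cinner (Q h (?R (z + h) x) + K1 (?R (z + h) x) + K z (?R (z + h) (?R z x))) y)
      \<longlongrightarrow> cinner (0 + K1 (?R z x) + K z (?R z (?R z x))) y) (at 0)"
    by (rule tendsto_cinner[OF tendsto_add[OF tendsto_add[OF Qlim
        bounded_linear.tendsto[OF bounded_clinear_bounded_linear[OF K1(1)] lim]]
        bounded_linear.tendsto[OF bounded_clinear_bounded_linear[OF K(2)[OF z]] lim]] tendsto_const])
  moreover have "\<forall>\<^sub>F h in at (0::complex). cinner (Q h (?R (z + h) x) + K1 (?R (z + h) x) + K z (?R (z + h) (?R z x))) y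
      = (?f (z + h) - ?f z) / h"
    unfolding eventually_at
  proof (intro exI[of _ d] conjI ballI impI)
    fix h :: complex assume h: "h \<noteq> 0 \<and> dist h 0 < d"
    then have sp: "z + h \<notin> spectrum UNIV Z" "z \<notin> spectrum UNIV Z" using near z D(2) by blast+
    have "?R (z + h) x - ?R z x = h *\<^sub>C ?R (z + h) (?R z x)" using resolvent_identity[OF sp, of x] by simp
    then have "K z (?R (z + h) x) - K z (?R z x) = h *\<^sub>C K z (?R (z + h) (?R z x))"
      using bounded_clinear_scaleC[OF K(2)[OF z]]
        linear_diff[OF bounded_linear.linear[OF bounded_clinear_bounded_linear[OF K(2)[OF z]]],
          of "?R (z + h) x" "?R z x"] by simp
    then have "K z (?R (z + h) (?R z x)) = (1 / h) *\<^sub>C (K z (?R (z + h) x) - K z (?R z x))"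
      using h by (simp add: scaleC_scaleC scaleC_one)
    then have "Q h (?R (z + h) x) + K1 (?R (z + h) x) + K z (?R (z + h) (?R z x))
        = (1 / h) *\<^sub>C (K (z + h) (?R (z + h) x) - K z (?R z x))"
      by (simp add: Q_def scaleC_diff_right)
    then show "cinner (Q h (?R (z + h) x) + K1 (?R (z + h) x) + K z (?R (z + h) (?R z x))) y = (?f (z + h) - ?f z) / h"
      by (simp add: cinner_scaleC_left cinner_diff_left)
  qed (rule d)
  ultimately have "((\<lambda>h::complex. (?f (z + h) - ?f z) / h) \<longlongrightarrow> cinner (0 + K1 (?R z x) + K z (?R z (?R z x))) y) (at 0)"
    by (rule Lim_transform_eventually)
  then have "(?f has_field_derivative cinner (0 + K1 (?R z x) + K z (?R z (?R z x))) y) (at z)"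
    unfolding DERIV_def .
  then show "?f field_differentiable at z within D"
    using field_differentiable_at_within unfolding field_differentiable_def by blast
qed

lemma cadjoint_diff:
  assumes "bounded_clinear f" "bounded_clinear g"
  shows "cadjoint (\<lambda>x. f x - g x) = (\<lambda>y. cadjoint f y - cadjoint g y)"
  by (rule cadjoint_unique) (simp add: cinner_diff_left cinner_diff_right cinner_cadjoint assms)

lemma cadjoint_scaleC:
  assumes "bounded_clinear f"
  shows "cadjoint (\<lambda>x. c *\<^sub>C f x) = (\<lambda>y. cnj c *\<^sub>C cadjoint f y)"
  by (rule cadjoint_unique) (simp add: cinner_scaleC_left cinner_scaleC_right cinner_cadjoint assms)

lemma op_holomorphic_on_cnj:
  assumes D: "open D" and K: "op_holomorphic_on K D" "\<And>z. z \<in> D \<Longrightarrow> bounded_clinear (K z)"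
    and sym: "\<And>z. z \<in> D \<Longrightarrow> K (cnj z) = cadjoint (K z)"
  shows "op_holomorphic_on K (cnj ` D)"
  unfolding op_holomorphic_on_def
proof
  fix w assume "w \<in> cnj ` D"
  then obtain z where z: "z \<in> D" "w = cnj z" by blast
  obtain K1 where K1: "bounded_clinear K1"
    "((\<lambda>h. onorm (\<lambda>x. (1 / h) *\<^sub>C (K (z + h) x - K z x) - K1 x)) \<longlongrightarrow> 0) (at 0)"
    using K(1) z(1) unfolding op_holomorphic_on_def by blast
  obtain d where d: "d > 0" "ball z d \<subseteq> D" by (rule openE[OF D z(1)])
  have "(cnj \<longlongrightarrow> cnj 0) (at 0)" by (rule tendsto_cnj[OF tendsto_ident_at])
  moreover have "\<forall>\<^sub>F h in at (0::complex). cnj h \<noteq> 0" unfolding eventually_at by (intro exI[of _ 1]) simp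
  ultimately have fl: "filterlim cnj (at 0) (at 0)" unfolding filterlim_at by simp
  have "((\<lambda>h::complex. onorm (\<lambda>x. (1 / cnj h) *\<^sub>C (K (z + cnj h) x - K z x) - K1 x)) \<longlongrightarrow> 0) (at 0)"
    by (rule filterlim_compose[OF K1(2) fl])
  moreover have "\<forall>\<^sub>F h in at (0::complex). onorm (\<lambda>x. (1 / cnj h) *\<^sub>C (K (z + cnj h) x - K z x) - K1 x)
      = onorm (\<lambda>x. (1 / h) *\<^sub>C (K (w + h) x - K w x) - cadjoint K1 x)"
    unfolding eventually_at
  proof (intro exI[of _ d] conjI ballI impI)
    fix h :: complex assume "h \<noteq> 0 \<and> dist h 0 < d"
    then have zh: "z + cnj h \<in> D" using d(2) by (force simp: dist_norm)
    let ?g = "\<lambda>x. (1 / cnj h) *\<^sub>C (K (z + cnj h) x - K z x)"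
    have bc: "bounded_clinear (\<lambda>x. K (z + cnj h) x - K z x)" "bounded_clinear ?g"
      by (intro bounded_clinear_scaleC_left bounded_clinear_diff K(2) zh z(1))+
    have "K (w + h) = cadjoint (K (z + cnj h))" "K w = cadjoint (K z)"
      using sym[OF zh] sym[OF z(1)] by (simp_all add: z(2))
    then have "cadjoint (\<lambda>x. ?g x - K1 x) = (\<lambda>x. (1 / h) *\<^sub>C (K (w + h) x - K w x) - cadjoint K1 x)"
      by (simp add: cadjoint_diff[OF bc(2) K1(1)] cadjoint_scaleC[OF bc(1)] cadjoint_diff[OF K(2)[OF zh] K(2)[OF z(1)]])
    then show "onorm (\<lambda>x. ?g x - K1 x) = onorm (\<lambda>x. (1 / h) *\<^sub>C (K (w + h) x - K w x) - cadjoint K1 x)"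
      using onorm_cadjoint[OF bounded_clinear_diff[OF bc(2) K1(1)]] by simp
  qed (rule d)
  ultimately have "((\<lambda>h::complex. onorm (\<lambda>x. (1 / h) *\<^sub>C (K (w + h) x - K w x) - cadjoint K1 x)) \<longlongrightarrow> 0) (at 0)"
    by (rule Lim_transform_eventually)
  then show "\<exists>K1. bounded_clinear K1 \<and> ((\<lambda>h::complex. onorm (\<lambda>x. (1 / h) *\<^sub>C (K (w + h) x - K w x) - K1 x)) \<longlongrightarrow> 0) (at 0)"
    using bounded_clinear_cadjoint[OF K1(1)] by blast
qed

lemma op_continuous_on_cnj:
  assumes K: "op_continuous_on S K" "\<And>z. z \<in> S \<Longrightarrow> bounded_clinear (K z)"
    and sym: "\<And>z. z \<in> S \<Longrightarrow> K (cnj z) = cadjoint (K z)"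
  shows "op_continuous_on (cnj ` S) K"
  unfolding op_continuous_on_def
proof
  fix w assume "w \<in> cnj ` S"
  then obtain z where z: "z \<in> S" "w = cnj z" by blast
  have o: "((\<lambda>u. onorm (\<lambda>x. K u x - K z x)) \<longlongrightarrow> 0) (at z within S)"
    using K(1) z(1) unfolding op_continuous_on_def by blast
  have fl: "filterlim cnj (at z within S) (at w within cnj ` S)"
    unfolding filterlim_at
  proof
    have "(cnj \<longlongrightarrow> cnj w) (at w within cnj ` S)" by (rule tendsto_cnj[OF tendsto_ident_at])
    then show "(cnj \<longlongrightarrow> z) (at w within cnj ` S)" by (simp add: z(2))
    show "\<forall>\<^sub>F v in at w within cnj ` S. cnj v \<in> S \<and> cnj v \<noteq> z"
      unfolding eventually_at z(2) by (intro exI[of _ 1]) auto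
  qed
  have "((\<lambda>v. onorm (\<lambda>x. K (cnj v) x - K z x)) \<longlongrightarrow> 0) (at w within cnj ` S)"
    by (rule filterlim_compose[OF o fl])
  moreover have "\<forall>\<^sub>F v in at w within cnj ` S. onorm (\<lambda>x. K (cnj v) x - K z x) = onorm (\<lambda>x. K v x - K w x)"
    unfolding eventually_at
  proof (intro exI[of _ 1] conjI ballI impI)
    fix v assume "v \<in> cnj ` S"
    then obtain u where u: "u \<in> S" "v = cnj u" by blast
    have "cadjoint (\<lambda>x. K u x - K z x) = (\<lambda>x. K v x - K w x)"
      by (simp add: cadjoint_diff[OF K(2)[OF u(1)] K(2)[OF z(1)]] u(2) z(2) sym[OF u(1)] sym[OF z(1)])
    then show "onorm (\<lambda>x. K (cnj v) x - K z x) = onorm (\<lambda>x. K v x - K w x)"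
      using onorm_cadjoint[OF bounded_clinear_diff[OF K(2)[OF u(1)] K(2)[OF z(1)]]] by (simp add: u(2))
  qed simp
  ultimately show "((\<lambda>v. onorm (\<lambda>x. K v x - K w x)) \<longlongrightarrow> 0) (at w within cnj ` S)"
    by (rule Lim_transform_eventually)
qed

section \<open>Passing to the density\<close>

lemma op_derivative_quotient_tendsto:
  assumes K: "has_op_derivative_real KB K1 t" and KB: "\<And>t. bounded_clinear (KB t)"
  shows "((\<lambda>h. (1 / h) *\<^sub>R (KB (t + h) w - KB t w)) \<longlongrightarrow> K1 w) (at 0)"
proof -
  define Q where "Q = (\<lambda>h x. (1 / h) *\<^sub>R (KB (t + h) x - KB t x) - K1 x)"
  have K1: "bounded_clinear K1" and lim: "((\<lambda>h. onorm (Q h)) \<longlongrightarrow> 0) (at 0)"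
    using K unfolding has_op_derivative_real_def Q_def by auto
  have "bounded_linear (Q h)" for h
    unfolding Q_def using bounded_clinear_bounded_linear[OF KB] bounded_clinear_bounded_linear[OF K1]
    by (intro bounded_linear_sub bounded_linear_const_scaleR)
  then have "norm (Q h w) \<le> onorm (Q h) * norm w" for h by (rule onorm)
  moreover have "((\<lambda>h. onorm (Q h) * norm w) \<longlongrightarrow> 0) (at 0)" using tendsto_mult_left_zero[OF lim] .
  ultimately have "((\<lambda>h. Q h w) \<longlongrightarrow> 0) (at 0)"
    by (intro Lim_null_comparison[of "\<lambda>h. Q h w" "\<lambda>h. onorm (Q h) * norm w"]) simp_all
  then show ?thesis unfolding Q_def by (rule LIM_zero_cancel)
qed

text \<open>The difference quotients are symmetric, and symmetry passes to the limit.\<close>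

lemma op_derivative_selfadjoint:
  assumes K: "has_op_derivative_real KB K1 t" and KB: "\<And>t. bounded_clinear (KB t)"
    and sym: "\<And>t x y. cinner (KB t x) y = cinner x (KB t y)"
  shows "cadjoint K1 = K1"
proof (rule cadjoint_unique)
  fix x y
  note lim = op_derivative_quotient_tendsto[OF K KB]
  have "((\<lambda>h. cinner ((1 / h) *\<^sub>R (KB (t + h) x - KB t x)) y) \<longlongrightarrow> cinner (K1 x) y) (at 0)"
    by (rule tendsto_cinner[OF lim tendsto_const])
  moreover have "((\<lambda>h. cinner x ((1 / h) *\<^sub>R (KB (t + h) y - KB t y))) \<longlongrightarrow> cinner x (K1 y)) (at 0)"
    by (rule tendsto_cinner[OF tendsto_const lim])
  moreover have "cinner ((1 / h) *\<^sub>R (KB (t + h) x - KB t x)) y = cinner x ((1 / h) *\<^sub>R (KB (t + h) y - KB t y))" for h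
    by (simp add: cinner_scaleR_left cinner_scaleR_right cinner_diff_left cinner_diff_right sym)
  ultimately show "cinner (K1 x) y = cinner x (K1 y)" using tendsto_unique[OF at_neq_bot] by simp
qed

text \<open>By the mean value theorem the increments of \<open>K\<^sub>B\<close> are those of its derivative, up to an error small compared with the
  length of the cell, uniformly in the cell.\<close>

lemma stieltjes_riemann_difference:
  fixes KB :: "real \<Rightarrow> 'b::complex_hilbert_space \<Rightarrow> 'b"
  assumes ab: "a \<le> b" and KB: "\<And>t. bounded_clinear (KB t)"
    and deriv: "\<And>t. t \<in> {a..b} \<Longrightarrow> has_op_derivative_real KB (K (of_real t)) t"
    and K: "op_continuous_on S K" "\<And>z. z \<in> S \<Longrightarrow> bounded_clinear (K z)" "complex_of_real ` {a..b} \<subseteq> S"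
    and r: "\<And>s. s \<in> {a..b} \<Longrightarrow> norm (r s) \<le> N" "N \<ge> 0"
  shows "has_rs_integral (\<lambda>s u v. cinner (KB v (r s) - KB u (r s)) y
    - cinner (K (of_real s) (r s)) y * of_real (v - u)) 0 a b"
    (is "has_rs_integral ?\<phi> 0 a b")
proof -
  have "has_rs_integral ?\<phi> ((\<lambda>_. 0) b - (\<lambda>_. 0) a) a b"
  proof (rule has_rs_integral_increments[where m = "\<lambda>u v. v - u" and M = "b - a", OF ab])
    show "0 \<le> b - a" using ab by simp
    show "(\<Sum>(s, k)\<in>p. Sup k - Inf k) \<le> b - a" if "p tagged_division_of {a..b}" for p
      using additive_tagged_division_1[OF ab that, of "\<lambda>x. x"] by simp
    fix e :: real assume e: "e > 0"
    define e' where "e' = e / (N * norm y + 1)"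
    have den: "N * norm y + 1 > 0" using r(2) by (simp add: add_nonneg_pos)
    have e': "e' > 0" using e den by (simp add: e'_def)
    have "\<exists>\<delta>>0. \<forall>s\<in>{a..b}. \<forall>t\<in>{a..b}. \<bar>s - t\<bar> < \<delta> \<longrightarrow>
        onorm (\<lambda>x. K (of_real s) x - K (of_real t) x) \<le> e'"
      by (rule op_uniformly_continuous_on_segment[OF K(1) _ K(3) e']) (rule K(2))
    then obtain \<delta> where \<delta>: "\<delta> > 0" "\<forall>s\<in>{a..b}. \<forall>t\<in>{a..b}. \<bar>s - t\<bar> < \<delta> \<longrightarrow>
        onorm (\<lambda>x. K (of_real s) x - K (of_real t) x) \<le> e'" by (elim exE conjE)
    have "norm (?\<phi> s u v - (0 - 0)) \<le> e * (v - u)" if o: "a \<le> u" "u \<le> s" "s \<le> v" "v \<le> b" "v - u < \<delta>" for s u v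
    proof -
      define w where "w = r s"
      have sab: "s \<in> {a..b}" using o by auto
      have w: "norm w \<le> N" unfolding w_def by (rule r(1)[OF sab])
      let ?g = "\<lambda>t. KB t w - t *\<^sub>R K (of_real s) w"
      have "norm (?g v - ?g u) \<le> (e' * norm w) * norm (v - u)"
      proof (rule differentiable_bound[where S = "{u..v}" and f' = "\<lambda>t h. h *\<^sub>R (K (of_real t) w - K (of_real s) w)"])
        fix t assume t: "t \<in> {u..v}"
        then have tab: "t \<in> {a..b}" using o by auto
        have "((\<lambda>t. KB t w) has_vector_derivative K (of_real t) w) (at t)"
          by (rule has_vector_derivative_quotient[OF op_derivative_quotient_tendsto[OF deriv[OF tab] KB]])
        moreover have "((\<lambda>t. t *\<^sub>R K (of_real s) w) has_vector_derivative K (of_real s) w) (at t)"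
          using has_vector_derivative_scaleR[OF DERIV_ident has_vector_derivative_const] by simp
        ultimately have "(?g has_vector_derivative K (of_real t) w - K (of_real s) w) (at t)"
          by (rule has_vector_derivative_diff)
        then show "(?g has_derivative (\<lambda>h. h *\<^sub>R (K (of_real t) w - K (of_real s) w))) (at t within {u..v})"
          unfolding has_vector_derivative_def by (rule has_derivative_at_withinI)
        have "\<bar>t - s\<bar> < \<delta>" using t o by auto
        then have "onorm (\<lambda>x. K (of_real t) x - K (of_real s) x) \<le> e'" using \<delta>(2) tab sab by blast
        moreover have "bounded_clinear (\<lambda>x. K (of_real t) x - K (of_real s) x)"
          by (intro bounded_clinear_diff K(2)) (use K(3) tab sab in blast)+
        ultimately have kd: "norm (K (of_real t) w - K (of_real s) w) \<le> e' * norm w"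
          using bounded_clinear_norm_le[of "\<lambda>x. K (of_real t) x - K (of_real s) x" w]
            mult_right_mono[of "onorm (\<lambda>x. K (of_real t) x - K (of_real s) x)" e' "norm w"] by simp
        show "onorm (\<lambda>h. h *\<^sub>R (K (of_real t) w - K (of_real s) w)) \<le> e' * norm w"
        proof (rule onorm_bound)
          show "norm (h *\<^sub>R (K (of_real t) w - K (of_real s) w)) \<le> e' * norm w * norm h" for h
            using mult_left_mono[OF kd, of "\<bar>h\<bar>"] by (simp add: mult.commute)
        qed (use e' in simp)
      qed (use o in auto)
      also have "\<dots> \<le> (e' * N) * (v - u)"
        using w e' o r(2) by (intro mult_mono mult_left_mono) auto
      finally have g: "norm (?g v - ?g u) \<le> e' * N * (v - u)" .
      have "?\<phi> s u v - (0 - 0) = cinner (?g v - ?g u) y"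
        unfolding w_def cinner_diff_left cinner_scaleR_left scaleR_conv_of_real by (simp add: algebra_simps)
      also have "norm \<dots> \<le> norm (?g v - ?g u) * norm y" by (rule cauchy_schwarz_cinner)
      also have "\<dots> \<le> e' * N * (v - u) * norm y" by (rule mult_right_mono[OF g]) simp
      also have "\<dots> = e' * (N * norm y) * (v - u)" by simp
      also have "\<dots> \<le> e' * (N * norm y + 1) * (v - u)"
        using e' o by (intro mult_right_mono mult_left_mono) auto
      also have "e' * (N * norm y + 1) = e" using den by (simp add: e'_def)
      finally show ?thesis .
    qed
    then show "\<exists>\<delta>>0. \<forall>s u v. a \<le> u \<and> u \<le> s \<and> s \<le> v \<and> v \<le> b \<and> v - u < \<delta> \<longrightarrow>
        norm (?\<phi> s u v - (0 - 0)) \<le> e * (v - u)"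
      using \<delta>(1) by (intro exI[of _ \<delta>]) blast
  qed
  then show ?thesis by simp
qed

lemma (in continuous_pvm) E_interval_ext:
  assumes "\<alpha> < \<beta>" and y: "E (einterval \<alpha> \<beta>) y = y" and w: "E (einterval \<alpha> \<beta>) w = w"
    and eq: "\<And>a b. a \<in> einterval \<alpha> \<beta> \<Longrightarrow> b \<in> einterval \<alpha> \<beta> \<Longrightarrow> a \<le> b \<Longrightarrow> E {a..<b} y = E {a..<b} w"
  shows "y = w"
proof -
  let ?F = "lower_end \<alpha> \<times>\<^sub>F upper_end \<beta>"
  have "\<forall>\<^sub>F ab in ?F. (case ab of (a, b) \<Rightarrow> E {a..<b} y) = (case ab of (a, b) \<Rightarrow> E {a..<b} w)"
    using eventually_end_pairs[OF assms(1)] by eventually_elim (use eq in auto)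
  then have "((\<lambda>(a, b). E {a..<b} w) \<longlongrightarrow> y) ?F"
    by (rule iffD1[OF tendsto_cong E_exhaust_interval[OF assms(1) y]])
  moreover have "?F \<noteq> bot" using ends_not_bot[OF assms(1)] by (simp add: prod_filter_eq_bot)
  ultimately show ?thesis using E_exhaust_interval[OF assms(1) w] tendsto_unique by blast
qed

section \<open>The solution given by the spectral integral\<close>

context spectral_operator
begin

context
  fixes \<alpha> \<beta> :: ereal and B :: "'b::complex_hilbert_space \<Rightarrow> 'a" and Z :: "'b \<Rightarrow> 'b" and C :: real
  assumes \<alpha>\<beta>: "\<alpha> < \<beta>" and B: "bounded_clinear B" and Z: "bounded_clinear Z"
    and off: "complex_of_real ` einterval \<alpha> \<beta> \<inter> spectrum UNIV Z = {}"
    and C: "C \<ge> 0" "\<And>t. t \<in> einterval \<alpha> \<beta> \<Longrightarrow> onorm (resolvent Z (of_real t)) \<le> C / sqrt (1 + t\<^sup>2)"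
begin

lemma resolvent_real:
  assumes "t \<in> einterval \<alpha> \<beta>"
  shows "of_real t \<notin> spectrum UNIV Z" "bounded_clinear (resolvent Z (of_real t))"
    "norm (resolvent Z (of_real t) x) \<le> C / sqrt (1 + t\<^sup>2) * norm x" "norm (resolvent Z (of_real t) x) \<le> C * norm x"
proof -
  show ns: "of_real t \<notin> spectrum UNIV Z" using off assms by blast
  show bc: "bounded_clinear (resolvent Z (of_real t))" by (rule bounded_clinear_resolvent[OF ns])
  show le: "norm (resolvent Z (of_real t) x) \<le> C / sqrt (1 + t\<^sup>2) * norm x"
    using bounded_clinear_norm_le[OF bc, of x] mult_right_mono[OF C(2)[OF assms] norm_ge_zero, of x] by linarith
  have "sqrt (1 + t\<^sup>2) \<ge> 1" by simp
  then have "C / sqrt (1 + t\<^sup>2) \<le> C / 1" using C(1) by (intro divide_left_mono) (auto simp: add_pos_nonneg)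
  then have "C / sqrt (1 + t\<^sup>2) * norm x \<le> C * norm x" by (intro mult_right_mono) auto
  then show "norm (resolvent Z (of_real t) x) \<le> C * norm x" using le by linarith
qed

lemma resolvent_square_bound:
  assumes "t \<in> einterval \<alpha> \<beta>"
  shows "norm (resolvent Z (of_real t) (resolvent Z (of_real t) x)) \<le> C\<^sup>2 * norm x / (1 + t\<^sup>2)"
proof -
  have "norm (resolvent Z (of_real t) (resolvent Z (of_real t) x)) \<le> C / sqrt (1 + t\<^sup>2) * (C / sqrt (1 + t\<^sup>2) * norm x)"
    by (rule order_trans[OF resolvent_real(3)[OF assms]], rule mult_left_mono[OF resolvent_real(3)[OF assms]]) (simp add: C(1))
  also have "\<dots> = C\<^sup>2 * norm x / (sqrt (1 + t\<^sup>2))\<^sup>2" by (simp add: power2_eq_square)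
  also have "(sqrt (1 + t\<^sup>2))\<^sup>2 = 1 + t\<^sup>2" by (simp add: add_nonneg_nonneg)
  finally show ?thesis .
qed

lemma continuous_resolvent_square:
  "continuous_on (einterval \<alpha> \<beta>) (\<lambda>t. resolvent Z (of_real t) (resolvent Z (of_real t) x))"
proof -
  let ?R = "\<lambda>t. resolvent Z (complex_of_real t)"
  have cR: "continuous_on (einterval \<alpha> \<beta>) (\<lambda>t. ?R t v)" for v
  proof (rule continuous_at_imp_continuous_on, rule ballI)
    fix t assume "t \<in> einterval \<alpha> \<beta>"
    from resolvent_has_vector_derivative[OF open_einterval off this]
    show "isCont (\<lambda>t. ?R t v) t" by (rule has_vector_derivative_continuous)
  qed
  show ?thesis unfolding continuous_on_def
  proof
    fix t assume t: "t \<in> einterval \<alpha> \<beta>"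
    let ?F = "at t within einterval \<alpha> \<beta>"
    have l: "((\<lambda>s. ?R s v) \<longlongrightarrow> ?R t v) ?F" for v using cR t by (simp add: continuous_on_def)
    have "((\<lambda>s. C * norm (?R s x - ?R t x)) \<longlongrightarrow> C * norm (?R t x - ?R t x)) ?F"
      by (intro tendsto_mult tendsto_const tendsto_norm tendsto_diff l)
    then have lim: "((\<lambda>s. C * norm (?R s x - ?R t x)) \<longlongrightarrow> 0) ?F" by simp
    have "\<forall>\<^sub>F s in ?F. norm (?R s (?R s x - ?R t x)) \<le> C * norm (?R s x - ?R t x)"
      unfolding eventually_at using resolvent_real(4) by (intro exI[of _ 1]) auto
    then have "((\<lambda>s. ?R s (?R s x - ?R t x)) \<longlongrightarrow> 0) ?F" by (rule Lim_null_comparison) (rule lim)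
    from tendsto_add[OF this l[of "?R t x"]]
    have "((\<lambda>s. ?R s (?R s x - ?R t x) + ?R s (?R t x)) \<longlongrightarrow> ?R t (?R t x)) ?F" by simp
    moreover have "\<forall>\<^sub>F s in ?F. ?R s (?R s x - ?R t x) + ?R s (?R t x) = ?R s (?R s x)"
      unfolding eventually_at
    proof (intro exI[of _ 1] conjI ballI impI)
      fix s assume "s \<in> einterval \<alpha> \<beta>"
      from linear_diff[OF bounded_linear.linear[OF bounded_clinear_bounded_linear[OF resolvent_real(2)[OF this]]], of "?R s x" "?R t x"]
      show "?R s (?R s x - ?R t x) + ?R s (?R t x) = ?R s (?R s x)" by simp
    qed simp
    ultimately show "((\<lambda>s. ?R s (?R s x)) \<longlongrightarrow> ?R t (?R t x)) ?F" by (rule Lim_transform_eventually)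
  qed
qed

abbreviation sylvester_solution :: "'b \<Rightarrow> 'a"
  where "sylvester_solution \<equiv> spectral_integral E \<alpha> \<beta> (\<lambda>t x. B (resolvent Z (of_real t) x))"

lemma
  shows sylvester_range: "E (einterval \<alpha> \<beta>) (sylvester_solution x) = sylvester_solution x"
    and sylvester_norm: "norm (sylvester_solution x) \<le> onorm B * (C + C\<^sup>2 * pi) * norm x"
    and sylvester_compact: "a \<in> einterval \<alpha> \<beta> \<Longrightarrow> b \<in> einterval \<alpha> \<beta> \<Longrightarrow> a \<le> b \<Longrightarrow>
      has_rs_integral (\<lambda>s u v. E {u..<v} (B (resolvent Z (of_real s) x))) (E {a..<b} (sylvester_solution x)) a b"
    and sylvester_integral:
      "has_spectral_integral E \<alpha> \<beta> (\<lambda>t x. B (resolvent Z (of_real t) x)) x (sylvester_solution x)"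
proof -
  let ?\<Phi> = "\<lambda>t. B (resolvent Z (of_real t) x)"
  let ?\<Phi>' = "\<lambda>t. B (resolvent Z (of_real t) (resolvent Z (of_real t) x))"
  note bl = bounded_clinear_bounded_linear[OF B]
  obtain y where y: "E (einterval \<alpha> \<beta>) y = y" "norm y \<le> onorm B * (C * norm x) + onorm B * (C\<^sup>2 * norm x) * pi"
    "\<And>a b. a \<in> einterval \<alpha> \<beta> \<Longrightarrow> b \<in> einterval \<alpha> \<beta> \<Longrightarrow> a \<le> b \<Longrightarrow>
      has_rs_integral (\<lambda>s u v. E {u..<v} (?\<Phi> s)) (E {a..<b} y) a b"
    "has_improper_rs_integral (\<lambda>s u v. E {u..<v} (?\<Phi> s)) y \<alpha> \<beta>"
  proof (rule improper_spectral_integral_exists[OF \<alpha>\<beta>, of ?\<Phi> ?\<Phi>' "onorm B * (C * norm x)" "onorm B * (C\<^sup>2 * norm x)"])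
    fix t assume t: "t \<in> einterval \<alpha> \<beta>"
    show "(?\<Phi> has_vector_derivative ?\<Phi>' t) (at t)"
      by (rule bounded_linear.has_vector_derivative[OF bl resolvent_has_vector_derivative[OF open_einterval off t]])
    show "norm (?\<Phi> t) \<le> onorm B * (C * norm x)" by (rule norm_le_onorm[OF B resolvent_real(4)[OF t]])
    show "norm (?\<Phi>' t) \<le> onorm B * (C\<^sup>2 * norm x) / (1 + t\<^sup>2)"
      using norm_le_onorm[OF B resolvent_square_bound[OF t, of x]] by simp
  next
    show "continuous_on (einterval \<alpha> \<beta>) ?\<Phi>'"
      by (rule bounded_linear.continuous_on[OF bl continuous_resolvent_square])
    show "0 \<le> onorm B * (C\<^sup>2 * norm x)" using onorm_nonneg[OF B] by simp
  qed (rule that)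
  have "sylvester_solution x = y"
    unfolding spectral_integral_def has_spectral_integral_def
  proof (rule the_equality)
    show "has_improper_rs_integral (\<lambda>s u v. E {u..<v} (?\<Phi> s)) y \<alpha> \<beta>" by (rule y(4))
    show "z = y" if "has_improper_rs_integral (\<lambda>s u v. E {u..<v} (?\<Phi> s)) z \<alpha> \<beta>" for z
      by (rule has_improper_rs_integral_unique[OF \<alpha>\<beta> that y(4)])
  qed
  then show "E (einterval \<alpha> \<beta>) (sylvester_solution x) = sylvester_solution x"
    "norm (sylvester_solution x) \<le> onorm B * (C + C\<^sup>2 * pi) * norm x"
    "has_spectral_integral E \<alpha> \<beta> (\<lambda>t x. B (resolvent Z (of_real t) x)) x (sylvester_solution x)"
    "a \<in> einterval \<alpha> \<beta> \<Longrightarrow> b \<in> einterval \<alpha> \<beta> \<Longrightarrow> a \<le> b \<Longrightarrow>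
      has_rs_integral (\<lambda>s u v. E {u..<v} (?\<Phi> s)) (E {a..<b} (sylvester_solution x)) a b"
    using y unfolding has_spectral_integral_def by (simp_all add: algebra_simps)
qed

lemma integrand_diff:
  assumes "t \<in> einterval \<alpha> \<beta>"
  shows "B (resolvent Z (of_real t) (x - x')) = B (resolvent Z (of_real t) x) - B (resolvent Z (of_real t) x')"
  using linear_diff[OF bounded_linear.linear[OF bounded_clinear_bounded_linear[OF bounded_clinear_compose[OF B resolvent_real(2)[OF assms]]]]] .

lemma bounded_clinear_sylvester: "bounded_clinear sylvester_solution"
proof (rule bounded_clinear_intro)
  let ?Y = sylvester_solution and ?I = "einterval \<alpha> \<beta>"
  have bI: "?I \<in> sets borel" by simp
  have diff: "?Y (x - x') = ?Y x - ?Y x'" for x x'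
  proof (rule E_interval_ext[OF \<alpha>\<beta> sylvester_range])
    show "E ?I (?Y x - ?Y x') = ?Y x - ?Y x'" by (simp add: E_diff sylvester_range)
    fix a b assume ab: "a \<in> ?I" "b \<in> ?I" "a \<le> b"
    have "has_rs_integral (\<lambda>s u v. E {u..<v} (B (resolvent Z (of_real s) (x - x')))) (E {a..<b} (?Y x) - E {a..<b} (?Y x')) a b"
    proof (rule iffD1[OF has_rs_integral_cong has_rs_integral_diff[OF sylvester_compact[OF ab, of x] sylvester_compact[OF ab, of x']]])
      fix s u v assume "a \<le> u" "u \<le> s" "s \<le> v" "v \<le> b"
      then have "s \<in> ?I" by (intro einterval_convex[OF ab(1,2)]) auto
      from integrand_diff[OF this]
      show "E {u..<v} (B (resolvent Z (of_real s) x)) - E {u..<v} (B (resolvent Z (of_real s) x'))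
        = E {u..<v} (B (resolvent Z (of_real s) (x - x')))" by (simp add: E_diff)
    qed
    from has_rs_integral_unique[OF sylvester_compact[OF ab] this]
    show "E {a..<b} (?Y (x - x')) = E {a..<b} (?Y x - ?Y x')" by (simp add: E_diff)
  qed
  show "?Y (c *\<^sub>C x) = c *\<^sub>C ?Y x" for c x
  proof (rule E_interval_ext[OF \<alpha>\<beta> sylvester_range])
    show "E ?I (c *\<^sub>C ?Y x) = c *\<^sub>C ?Y x" by (simp add: E_scaleC sylvester_range)
    fix a b assume ab: "a \<in> ?I" "b \<in> ?I" "a \<le> b"
    have "has_rs_integral (\<lambda>s u v. E {u..<v} (B (resolvent Z (of_real s) (c *\<^sub>C x)))) (c *\<^sub>C E {a..<b} (?Y x)) a b"
    proof (rule iffD1[OF has_rs_integral_cong has_rs_integral_linear[OF bounded_linear_scaleC sylvester_compact[OF ab, of x]]])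
      fix s u v assume "a \<le> u" "u \<le> s" "s \<le> v" "v \<le> b"
      then have "s \<in> ?I" by (intro einterval_convex[OF ab(1,2)]) auto
      from bounded_clinear_scaleC[OF resolvent_real(2)[OF this]]
      show "c *\<^sub>C E {u..<v} (B (resolvent Z (of_real s) x)) = E {u..<v} (B (resolvent Z (of_real s) (c *\<^sub>C x)))"
        by (simp add: E_scaleC bounded_clinear_scaleC[OF B])
    qed
    from has_rs_integral_unique[OF sylvester_compact[OF ab] this]
    show "E {a..<b} (?Y (c *\<^sub>C x)) = E {a..<b} (c *\<^sub>C ?Y x)" by (simp add: E_scaleC)
  qed
  show "?Y (x + x') = ?Y x + ?Y x'" for x x'
    using diff[of "x + x'" x'] by (simp add: algebra_simps)
  show "norm (?Y x) \<le> onorm B * (C + C\<^sup>2 * pi) * norm x" for x by (rule sylvester_norm)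
qed

text \<open>By \<open>s R(s) x = R(s) Z x - x\<close>, multiplying the integrand by \<open>s\<close> gives the integrand for \<open>Z x\<close> minus the constant
  \<open>B x\<close>, whose spectral integral is \<open>B x\<close> itself.\<close>

lemma sylvester_equation:
  assumes conc: "\<And>x. E (einterval \<alpha> \<beta>) x = x"
  shows "sylvester_solution x \<in> Dom \<and> A (sylvester_solution x) = sylvester_solution (Z x) - B x"
proof (rule A_spectral_integral[OF \<alpha>\<beta> sylvester_range conc])
  let ?Y = sylvester_solution and ?I = "einterval \<alpha> \<beta>"
  fix a b assume ab: "a \<in> ?I" "b \<in> ?I" "a \<le> b"
  show "has_rs_integral (\<lambda>s u v. E {u..<v} (B (resolvent Z (of_real s) x))) (E {a..<b} (?Y x)) a b"
    by (rule sylvester_compact[OF ab])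
  have "has_rs_integral (\<lambda>s u v. E {u..<v} (of_real s *\<^sub>C B (resolvent Z (of_real s) x)))
      (E {a..<b} (?Y (Z x)) - E {a..<b} (B x)) a b"
  proof (rule iffD1[OF has_rs_integral_cong has_rs_integral_diff[OF sylvester_compact[OF ab, of "Z x"] has_rs_integral_E_const[OF ab(3), of "B x"]]])
    fix s u v assume "a \<le> u" "u \<le> s" "s \<le> v" "v \<le> b"
    then have s: "s \<in> ?I" by (intro einterval_convex[OF ab(1,2)]) auto
    have "B (resolvent Z (of_real s) (Z x)) - B (resolvent Z (of_real s) (of_real s *\<^sub>C x)) = B x"
      unfolding integrand_diff[OF s, symmetric] resolvent_left[OF resolvent_real(1)[OF s]] ..
    then have "of_real s *\<^sub>C B (resolvent Z (of_real s) x) = B (resolvent Z (of_real s) (Z x)) - B x"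
      by (simp add: bounded_clinear_scaleC[OF resolvent_real(2)[OF s]] bounded_clinear_scaleC[OF B] algebra_simps)
    then show "E {u..<v} (B (resolvent Z (of_real s) (Z x))) - E {u..<v} (B x)
      = E {u..<v} (of_real s *\<^sub>C B (resolvent Z (of_real s) x))" by (simp add: E_diff)
  qed
  then show "has_rs_integral (\<lambda>s u v. E {u..<v} (of_real s *\<^sub>C B (resolvent Z (of_real s) x)))
      (E {a..<b} (?Y (Z x) - B x)) a b" by (simp add: E_diff)
qed

text \<open>Paired with \<open>B y\<close>, the Stieltjes sums of the spectral integral involve the increments of \<open>B\<^sup>* E {..<t} B\<close>, which the
  density \<open>K\<close> replaces.\<close>

lemma sylvester_density:
  assumes K: "\<And>t. t \<in> einterval \<alpha> \<beta> \<Longrightarrow>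
      has_op_derivative_real (\<lambda>t x. cadjoint B (E {..<t} (B x))) (K (of_real t)) t"
      "op_continuous_on S K" "\<And>z. z \<in> S \<Longrightarrow> bounded_clinear (K z)"
      "complex_of_real ` einterval \<alpha> \<beta> \<subseteq> S"
  shows "has_improper_rs_integral
    (\<lambda>s u v. cinner (K (of_real s) (resolvent Z (of_real s) x)) y * of_real (v - u))
    (cinner (sylvester_solution x) (B y)) \<alpha> \<beta>"
proof -
  let ?I = "einterval \<alpha> \<beta>" and ?R = "\<lambda>s. resolvent Z (complex_of_real s)"
  let ?KB = "\<lambda>t x. cadjoint B (E {..<t} (B x))"
  have KB: "bounded_clinear (?KB t)" for t
    by (intro bounded_clinear_compose[OF bounded_clinear_cadjoint[OF B]] bounded_clinear_compose[OF E_clinear B]) simp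
  have "has_rs_integral (\<lambda>s u v. cinner (K (of_real s) (?R s x)) y * of_real (v - u))
      (cinner (E {a..<b} (sylvester_solution x)) (B y)) a b" if ab: "a \<in> ?I" "b \<in> ?I" "a \<le> b" for a b
  proof -
    note sub = einterval_between[OF ab(1,2)]
    have d: "has_rs_integral (\<lambda>s u v. cinner (?KB v (?R s x) - ?KB u (?R s x)) y
        - cinner (K (of_real s) (?R s x)) y * of_real (v - u)) 0 a b"
    proof (rule stieltjes_riemann_difference[OF ab(3) KB _ K(2)])
      show "has_op_derivative_real ?KB (K (of_real t)) t" if "t \<in> {a..b}" for t using K(1) sub that by blast
      show "complex_of_real ` {a..b} \<subseteq> S" using K(4) sub by blast
      show "norm (?R s x) \<le> C * norm x" if "s \<in> {a..b}" for s using resolvent_real(4) sub that by blast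
    qed (use K(3) C(1) in simp_all)
    have l: "has_rs_integral (\<lambda>s u v. cinner (E {u..<v} (B (?R s x))) (B y))
        (cinner (E {a..<b} (sylvester_solution x)) (B y)) a b"
      by (rule has_rs_integral_linear[OF bounded_linear_cinner_left sylvester_compact[OF ab]])
    have eq: "has_rs_integral (\<lambda>s u v. cinner (E {u..<v} (B (?R s x))) (B y) -
        (cinner (?KB v (?R s x) - ?KB u (?R s x)) y - cinner (K (of_real s) (?R s x)) y * of_real (v - u)))
        (cinner (E {a..<b} (sylvester_solution x)) (B y) - 0) a b"
      by (rule has_rs_integral_diff[OF l d])
    have "has_rs_integral (\<lambda>s u v. cinner (K (of_real s) (?R s x)) y * of_real (v - u))
        (cinner (E {a..<b} (sylvester_solution x)) (B y) - 0) a b"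
    proof (rule iffD1[OF has_rs_integral_cong eq])
      fix s u v :: real assume "u \<le> s" "s \<le> v"
      then have "E {u..<v} (B (?R s x)) = E {..<v} (B (?R s x)) - E {..<u} (B (?R s x))"
        by (simp add: E_lessThan_diff)
      then have "cinner (E {u..<v} (B (?R s x))) (B y) = cinner (?KB v (?R s x) - ?KB u (?R s x)) y"
        by (simp add: cinner_diff_left cinner_cadjoint_left[OF B])
      then show "cinner (E {u..<v} (B (?R s x))) (B y) -
        (cinner (?KB v (?R s x) - ?KB u (?R s x)) y - cinner (K (of_real s) (?R s x)) y * of_real (v - u))
        = cinner (K (of_real s) (?R s x)) y * of_real (v - u)" by simp
    qed
    then show ?thesis by simp
  qed
  moreover have "((\<lambda>ab. cinner (case ab of (a, b) \<Rightarrow> E {a..<b} (sylvester_solution x)) (B y))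
      \<longlongrightarrow> cinner (sylvester_solution x) (B y)) (lower_end \<alpha> \<times>\<^sub>F upper_end \<beta>)"
    by (intro tendsto_cinner tendsto_const E_exhaust_interval[OF \<alpha>\<beta> sylvester_range])
  ultimately show ?thesis
    unfolding has_improper_rs_integral_def
    by (intro exI[of _ "\<lambda>ab. cinner (case ab of (a, b) \<Rightarrow> E {a..<b} (sylvester_solution x)) (B y)"]) auto
qed

end
end

section \<open>The Riccati equation and invariant graphs\<close>

lemma graph_subspace:
  fixes T :: "'a::complex_hilbert_space \<Rightarrow> 'b::complex_hilbert_space"
  assumes T: "bounded_clinear T"
  shows "csubspace (graph0 T)" "closed (graph0 T)" "csubspace (graph1 T)" "closed (graph1 T)"
proof -
  note lin = bounded_linear.linear[OF bounded_clinear_bounded_linear[OF T]]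
  have g0: "graph0 T = {p. snd p = T (fst p)}" by (auto simp: graph0_def)
  have g1: "graph1 T = {p. fst p = T (snd p)}" by (auto simp: graph1_def)
  show "csubspace (graph0 T)" "csubspace (graph1 T)"
    unfolding csubspace_def g0 g1
    by (auto simp: linear_0[OF lin] linear_add[OF lin] scaleC_prod_def bounded_clinear_scaleC[OF T])
  have "continuous_on UNIV T"
    using bounded_clinear_bounded_linear[OF T] by (simp add: linear_continuous_on)
  then have c: "continuous_on UNIV (\<lambda>p. T (fst p))" "continuous_on UNIV (\<lambda>p. T (snd p))"
    by (auto intro!: continuous_on_compose2[of UNIV T] continuous_intros)
  show "closed (graph0 T)" unfolding g0 by (intro closed_Collect_eq continuous_on_snd continuous_on_id c)
  show "closed (graph1 T)" unfolding g1 by (intro closed_Collect_eq continuous_on_fst continuous_on_id c)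
qed

text \<open>The operator Riccati equation for \<open>Y\<^sup>*\<close> is the adjoint of the Sylvester equation \<open>A\<^sub>0 Y - Y Z = - B\<close>
  in which \<open>Z = A\<^sub>1 - B\<^sup>* Y\<close>; the two equations say that the two graphs are invariant.\<close>

lemma riccati_from_sylvester:
  fixes A0 :: "'a::complex_hilbert_space \<Rightarrow> 'a" and B Y :: "'b::complex_hilbert_space \<Rightarrow> 'a"
  assumes A0: "\<And>x y. x \<in> D0 \<Longrightarrow> y \<in> D0 \<Longrightarrow> cinner (A0 x) y = cinner x (A0 y)"
    and A1: "\<And>x y. cinner (A1 x) y = cinner x (A1 y)"
    and B: "bounded_clinear B" and Y: "bounded_clinear Y" and Z: "\<And>x. Z x = A1 x - cadjoint B (Y x)"
    and syl: "\<And>x. Y x \<in> D0" "\<And>x. A0 (Y x) = Y (Z x) - B x"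
  shows "strong_riccati_solution D0 A0 UNIV A1 B (cadjoint Y)"
    "\<forall>x\<in>graph0 (cadjoint Y). \<forall>y\<in>graph1 Y. cinner (J_op x) y = 0"
    "invariant_subspace (D0 \<times> UNIV) (block_op A0 A1 B) (graph0 (cadjoint Y))"
    "invariant_subspace (D0 \<times> UNIV) (block_op A0 A1 B) (graph1 Y)"
proof -
  note adj = cinner_cadjoint_left[OF Y] cinner_cadjoint_left[OF B]
  note Ylin = linear_diff[OF bounded_linear.linear[OF bounded_clinear_bounded_linear[OF Y]]]
  have ric: "cadjoint Y (A0 x) - A1 (cadjoint Y x) + cadjoint Y (B (cadjoint Y x)) = - cadjoint B x"
    if x: "x \<in> D0" for x
  proof (rule cinner_extensional)
    fix z
    have "cinner (cadjoint Y (A0 x)) z = cinner x (Y (Z z)) - cinner x (B z)"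
      by (simp add: adj A0[OF x syl(1)] syl(2) cinner_diff_right)
    moreover have "cinner (A1 (cadjoint Y x)) z = cinner x (Y (A1 z))" by (simp add: adj A1)
    moreover have "cinner (cadjoint Y (B (cadjoint Y x))) z = cinner x (Y (cadjoint B (Y z)))"
      by (simp add: adj cinner_cadjoint[OF B])
    moreover have "Y (Z z) = Y (A1 z) - Y (cadjoint B (Y z))" by (simp add: Z Ylin)
    ultimately show "cinner (cadjoint Y (A0 x) - A1 (cadjoint Y x) + cadjoint Y (B (cadjoint Y x))) z
        = cinner (- cadjoint B x) z"
      by (simp add: cinner_add_left cinner_diff_left cinner_minus_left cinner_diff_right adj)
  qed
  show "strong_riccati_solution D0 A0 UNIV A1 B (cadjoint Y)"
    unfolding strong_riccati_solution_def using bounded_clinear_cadjoint[OF Y] ric by simp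
  show "\<forall>x\<in>graph0 (cadjoint Y). \<forall>y\<in>graph1 Y. cinner (J_op x) y = 0"
    by (auto simp: graph0_def graph1_def J_op_def cinner_prod_def cinner_minus_left adj)
  have "block_op A0 A1 B p \<in> graph0 (cadjoint Y)" if p: "p \<in> (D0 \<times> UNIV) \<inter> graph0 (cadjoint Y)" for p
  proof -
    obtain x where x: "p = (x, cadjoint Y x)" using p unfolding graph0_def by blast
    with p have xD: "x \<in> D0" by simp
    have "cadjoint Y (A0 x + B (cadjoint Y x)) = cadjoint Y (A0 x) + cadjoint Y (B (cadjoint Y x))"
      by (rule linear_add[OF bounded_linear.linear[OF bounded_clinear_bounded_linear[OF bounded_clinear_cadjoint[OF Y]]]])
    also have "\<dots> = - cadjoint B x + A1 (cadjoint Y x)" using ric[OF xD] by (simp add: algebra_simps)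
    finally show ?thesis by (auto simp: x block_op_def graph0_def)
  qed
  then show "invariant_subspace (D0 \<times> UNIV) (block_op A0 A1 B) (graph0 (cadjoint Y))"
    unfolding invariant_subspace_def using graph_subspace(1,2)[OF bounded_clinear_cadjoint[OF Y]] by blast
  have "block_op A0 A1 B p \<in> graph1 Y" if p: "p \<in> (D0 \<times> UNIV) \<inter> graph1 Y" for p
  proof -
    obtain x where x: "p = (Y x, x)" using p unfolding graph1_def by blast
    have "A0 (Y x) + B x = Y (Z x)" "- cadjoint B (Y x) + A1 x = Z x" by (simp_all add: syl(2) Z)
    then show ?thesis by (auto simp: x block_op_def graph1_def)
  qed
  then show "invariant_subspace (D0 \<times> UNIV) (block_op A0 A1 B) (graph1 Y)"
    unfolding invariant_subspace_def using graph_subspace(3,4)[OF Y] by blast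
qed

text \<open>The two half-planes enter symmetrically, because the values of the derivative on the real interval are self-adjoint.\<close>

lemma continued_derivative_both_sides:
  assumes K: "continued_derivative KB K \<Delta> Dm" and KB: "\<And>t. bounded_clinear (KB t)"
    and sym: "\<And>t x y. cinner (KB t x) y = cinner x (KB t y)"
    and Dl: "Dl = Dm \<or> Dl = cnj ` Dm"
  shows "open Dl" "simply_connected Dl" "Dl \<subseteq> {z. Im z < 0} \<or> Dl \<subseteq> {z. Im z > 0}"
    "complex_of_real ` \<Delta> \<subseteq> closure Dl" "op_holomorphic_on K Dl"
    "op_continuous_on (Dl \<union> complex_of_real ` \<Delta>) K"
    "\<And>z. z \<in> Dl \<union> complex_of_real ` \<Delta> \<Longrightarrow> bounded_clinear (K z)"
proof -
  let ?S = "Dm \<union> complex_of_real ` \<Delta>"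
  have o: "open Dm" and sc: "simply_connected Dm" and low: "Dm \<subseteq> {z. Im z < 0}"
    and fr: "complex_of_real ` \<Delta> \<subseteq> frontier Dm"
    and der: "\<And>t. t \<in> \<Delta> \<Longrightarrow> has_op_derivative_real KB (K (complex_of_real t)) t"
    and bc: "\<And>z. z \<in> Dm \<Longrightarrow> bounded_clinear (K z)" and holo: "op_holomorphic_on K Dm"
    and cont: "op_continuous_on ?S K" and refl: "\<And>z. z \<in> Dm \<Longrightarrow> K (cnj z) = cadjoint (K z)"
    using K unfolding continued_derivative_def by blast+
  have cl: "complex_of_real ` \<Delta> \<subseteq> closure Dm" using fr by (auto simp: frontier_def)
  have bcS: "bounded_clinear (K z)" if "z \<in> ?S" for z
    using that bc der unfolding has_op_derivative_real_def by blast
  have reflS: "K (cnj z) = cadjoint (K z)" if "z \<in> ?S" for z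
    using that refl op_derivative_selfadjoint[OF der KB sym] by auto
  have img: "cnj ` ?S = cnj ` Dm \<union> complex_of_real ` \<Delta>" by (simp add: image_Un image_image)
  have cnjD: "open (cnj ` Dm) \<and> simply_connected (cnj ` Dm) \<and> cnj ` Dm \<subseteq> {z. Im z > 0} \<and>
      complex_of_real ` \<Delta> \<subseteq> closure (cnj ` Dm) \<and> op_holomorphic_on K (cnj ` Dm) \<and>
      op_continuous_on (cnj ` Dm \<union> complex_of_real ` \<Delta>) K \<and>
      (\<forall>z\<in>cnj ` Dm \<union> complex_of_real ` \<Delta>. bounded_clinear (K z))"
  proof (intro conjI ballI)
    have "cnj ` Dm = cnj -` Dm" by (force simp: image_iff)
    then show "open (cnj ` Dm)" using o by (simp add: continuous_open_vimage)
    have "cnj ` Dm homeomorphic Dm"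
      unfolding homeomorphic_def homeomorphism_def
      by (intro exI[of _ cnj]) (auto intro!: continuous_intros simp: image_image)
    then show "simply_connected (cnj ` Dm)" using sc homeomorphic_simply_connected_eq by blast
    show "cnj ` Dm \<subseteq> {z. Im z > 0}" using low by auto
    have "cnj ` closure Dm \<subseteq> closure (cnj ` Dm)"
      by (rule image_closure_subset) (auto intro!: continuous_intros closure_subset)
    moreover have "complex_of_real ` \<Delta> = cnj ` complex_of_real ` \<Delta>" by (simp add: image_image)
    ultimately show "complex_of_real ` \<Delta> \<subseteq> closure (cnj ` Dm)" using cl by blast
    show "op_holomorphic_on K (cnj ` Dm)" by (rule op_holomorphic_on_cnj[OF o holo bc refl])
    show "op_continuous_on (cnj ` Dm \<union> complex_of_real ` \<Delta>) K"
      unfolding img[symmetric] by (rule op_continuous_on_cnj[OF cont bcS reflS])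
    fix z assume "z \<in> cnj ` Dm \<union> complex_of_real ` \<Delta>"
    then obtain w where "w \<in> ?S" "z = cnj w" unfolding img[symmetric] by blast
    then show "bounded_clinear (K z)" using reflS bounded_clinear_cadjoint[OF bcS] by simp
  qed
  show "open Dl" "simply_connected Dl" "Dl \<subseteq> {z. Im z < 0} \<or> Dl \<subseteq> {z. Im z > 0}"
    "complex_of_real ` \<Delta> \<subseteq> closure Dl" "op_holomorphic_on K Dl"
    "op_continuous_on (Dl \<union> complex_of_real ` \<Delta>) K"
    "\<And>z. z \<in> Dl \<union> complex_of_real ` \<Delta> \<Longrightarrow> bounded_clinear (K z)"
    using Dl o sc low cl holo cont bcS cnjD by blast+
qed

theorem corollary4p4:
  fixes A0 :: "'a::complex_hilbert_space \<Rightarrow> 'a" and D0 :: "'a set"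
    and A1 :: "'b::complex_hilbert_space \<Rightarrow> 'b"
    and B :: "'b \<Rightarrow> 'a"
    and E0 :: "real set \<Rightarrow> 'a \<Rightarrow> 'a"
    and \<mu>\<^sub>1 \<mu>\<^sub>2 :: ereal and \<Delta>0 :: "real set"
    and K :: "complex \<Rightarrow> 'b \<Rightarrow> 'b"
    and Dm Dl :: "complex set" and l :: int
    and \<gamma> :: "real \<Rightarrow> complex" and d V :: real
    and X Z :: "'b \<Rightarrow> 'b" and Y :: "'b \<Rightarrow> 'a"
  assumes A0: "selfadjoint_op D0 A0" "spectral_measure_of E0 D0 A0"
    and A1: "bounded_clinear A1" "selfadjoint_op UNIV A1"
    and B: "bounded_clinear B"
    and \<Delta>0: "\<mu>\<^sub>1 < \<mu>\<^sub>2" "\<Delta>0 = einterval \<mu>\<^sub>1 \<mu>\<^sub>2"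
    and \<sigma>0_ac: "\<And>x. absolutely_continuous lborel (scalar_spectral_measure E0 x)"
    and \<sigma>0: "spectrum D0 A0 = complex_of_real ` closure \<Delta>0"
    and \<sigma>1: "spectrum UNIV A1 \<subseteq> complex_of_real ` \<Delta>0"
    and K: "continued_derivative (\<lambda>t x. cadjoint B (E0 {..<t} (B x))) K \<Delta>0 Dm"
    and ends: "finite_end_bound K (Dm \<union> cnj ` Dm) \<mu>\<^sub>1" "finite_end_bound K (Dm \<union> cnj ` Dm) \<mu>\<^sub>2"
    and l: "l \<in> {1, -1}" "Dl = (if l = 1 then cnj ` Dm else Dm)"
    and \<Gamma>: "deformed_contour K Dl \<mu>\<^sub>1 \<mu>\<^sub>2 \<gamma>" "has_variation K \<mu>\<^sub>1 \<mu>\<^sub>2 \<gamma> V"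
    and d: "d = setdist (spectrum UNIV A1) (\<gamma> ` \<Delta>0)" "V < d\<^sup>2 / 4"
    and X: "bounded_clinear X" "spectrum UNIV Z \<inter> \<gamma> ` \<Delta>0 = {}" "is_W1 K \<mu>\<^sub>1 \<mu>\<^sub>2 \<gamma> Z X"
      "onorm X \<le> d / 2 - sqrt (d\<^sup>2 / 4 - V)"
    and Z: "Z = (\<lambda>x. A1 x + X x)" "setdist (spectrum UNIV Z) Dl > 0"
    and Y: "Y = spectral_integral E0 \<mu>\<^sub>1 \<mu>\<^sub>2 (\<lambda>t x. B (resolvent Z (complex_of_real t) x))"
  shows "bounded_clinear Y \<and>
    (\<forall>x. has_spectral_integral E0 \<mu>\<^sub>1 \<mu>\<^sub>2 (\<lambda>t x. B (resolvent Z (complex_of_real t) x)) x (Y x)) \<and>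
    strong_riccati_solution D0 A0 UNIV A1 B (cadjoint Y) \<and>
    (\<forall>x\<in>graph0 (cadjoint Y). \<forall>y\<in>graph1 Y. cinner (J_op x) y = 0) \<and>
    invariant_subspace (D0 \<times> UNIV) (block_op A0 A1 B) (graph0 (cadjoint Y)) \<and>
    invariant_subspace (D0 \<times> UNIV) (block_op A0 A1 B) (graph1 Y)"
proof -
  have pvm: "projection_valued_measure E0" using A0(2) by (simp add: spectral_measure_of_def)
  interpret spectral_operator E0 D0 A0
    by unfold_locales (fact pvm, fact \<sigma>0_ac, fact A0(1), fact A0(2))
  let ?KB = "\<lambda>t x. cadjoint B (E0 {..<t} (B x))"
  let ?S = "Dl \<union> complex_of_real ` \<Delta>0"
  have KB: "bounded_clinear (?KB t)" for t
    by (intro bounded_clinear_compose[OF bounded_clinear_cadjoint[OF B]] bounded_clinear_compose[OF E_clinear B]) simp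
  have KB_sym: "cinner (?KB t x) y = cinner x (?KB t y)" for t x y
    by (simp add: cinner_cadjoint_left[OF B] E_sym cinner_cadjoint[OF B])
  have Dl: "Dl = Dm \<or> Dl = cnj ` Dm" using l(2) by auto
  note side = continued_derivative_both_sides[OF K KB KB_sym Dl]
  have bcZ: "bounded_clinear Z" unfolding Z(1) by (rule bounded_clinear_add[OF A1(1) X(1)])
  have off_closure: "closure Dl \<inter> spectrum UNIV Z = {}"
  proof (rule ccontr)
    assume "closure Dl \<inter> spectrum UNIV Z \<noteq> {}"
    then obtain z where "z \<in> spectrum UNIV Z" "z \<in> closure Dl" by blast
    then have "setdist (spectrum UNIV Z) (closure Dl) = 0" by (rule setdist_eq_0I)
    then show False using Z(2) by simp
  qed
  have sub: "?S \<subseteq> closure Dl" using side(4) closure_subset by blast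
  then have off: "?S \<inter> spectrum UNIV Z = {}" using off_closure by blast
  obtain C where C: "C \<ge> 0" "\<forall>z\<in>closure Dl. onorm (resolvent Z z) \<le> C / sqrt (1 + (cmod z)\<^sup>2)"
    using onorm_resolvent_uniform[OF bcZ closed_closure off_closure] by blast
  have off_real: "complex_of_real ` einterval \<mu>\<^sub>1 \<mu>\<^sub>2 \<inter> spectrum UNIV Z = {}" using off unfolding \<Delta>0(2) by blast
  have C_real: "onorm (resolvent Z (of_real t)) \<le> C / sqrt (1 + t\<^sup>2)" if "t \<in> einterval \<mu>\<^sub>1 \<mu>\<^sub>2" for t
  proof -
    have "complex_of_real t \<in> closure Dl" using side(4) that \<Delta>0(2) by blast
    from C(2)[rule_format, OF this] show ?thesis by simp
  qed
  note ctx = \<Delta>0(1) B bcZ off_real C(1) C_real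
  have conc: "E0 (einterval \<mu>\<^sub>1 \<mu>\<^sub>2) x = x" for x
    by (rule E_concentrated_on_interval) (simp add: \<sigma>0 \<Delta>0(2))
  have bcY: "bounded_clinear Y" unfolding Y by (rule bounded_clinear_sylvester[OF ctx])
  have syl: "Y x \<in> D0 \<and> A0 (Y x) = Y (Z x) - B x" for x
    unfolding Y by (rule sylvester_equation[OF ctx conc])
  have int: "has_spectral_integral E0 \<mu>\<^sub>1 \<mu>\<^sub>2 (\<lambda>t x. B (resolvent Z (complex_of_real t) x)) x (Y x)" for x
    unfolding Y by (rule sylvester_integral[OF ctx])
  have BY: "cadjoint B (Y x) = - X x" for x
  proof (rule cinner_extensional)
    fix y
    let ?f = "\<lambda>z. cinner (K z (resolvent Z z x)) y"
    have bcR: "bounded_clinear (resolvent Z z)" if "z \<in> ?S" for z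
      by (rule bounded_clinear_resolvent) (use that off in blast)
    have bound: "norm (?f z) \<le> onorm (K z) * (C / sqrt (1 + (cmod z)\<^sup>2)) * (norm x * norm y)" if z: "z \<in> ?S" for z
    proof -
      have "norm (?f z) \<le> onorm (K z) * (onorm (resolvent Z z) * norm x) * norm y"
        by (rule norm_cinner_op_le[OF side(7)[OF z] bcR[OF z]])
      also have "\<dots> \<le> onorm (K z) * (C / sqrt (1 + (cmod z)\<^sup>2) * norm x) * norm y"
        using C(2) sub z onorm_nonneg[OF side(7)[OF z]] by (intro mult_right_mono mult_left_mono) auto
      finally show ?thesis by (simp add: mult_ac)
    qed
    \<comment> \<open>The left-hand side is the integral of \<open>?f\<close> along the interval, the right-hand side that along the contour.\<close>
    have "cinner (Y x) (B y) = cinner (- X x) y"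
    proof (rule contour_deformation[where K = K and f = ?f and ?r0.0 = 1, OF side(1-3) \<Delta>0(1) \<Gamma>(1)])
      show "?f holomorphic_on Dl"
        by (rule holomorphic_on_op_resolvent[OF side(1) _ side(5) side(7)]) (use off in auto)
      show "continuous_on (Dl \<union> complex_of_real ` einterval \<mu>\<^sub>1 \<mu>\<^sub>2) ?f"
        unfolding \<Delta>0(2)[symmetric] by (rule continuous_on_op_resolvent[OF side(6,7) off])
      show "\<exists>C>0. \<exists>g>-1. \<exists>r>0. \<forall>z\<in>Dl. dist z (of_real m) < r \<longrightarrow> norm (?f z) \<le> C * dist z (of_real m) powr g"
        if m: "ereal m \<in> {\<mu>\<^sub>1, \<mu>\<^sub>2}" for m
      proof -
        have "finite_end_bound K (Dm \<union> cnj ` Dm) (ereal m)" using m ends by auto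
        then obtain Ck g r where Ck: "Ck > 0" "g \<in> {-1<..0}" "r > 0"
          "\<forall>z\<in>Dm \<union> cnj ` Dm. dist z (of_real m) < r \<longrightarrow> onorm (K z) \<le> Ck * dist z (of_real m) powr g"
          unfolding finite_end_bound_def by blast
        \<comment> \<open>The summand 1 only makes the constant positive.\<close>
        define C' where "C' = Ck * (C * (norm x * norm y) + 1)"
        have nn: "0 \<le> C * (norm x * norm y)" using C(1) by simp
        have C': "C' > 0" unfolding C'_def using Ck(1) nn by (intro mult_pos_pos) auto
        have "norm (?f z) \<le> C' * dist z (of_real m) powr g" if z: "z \<in> Dl" "dist z (of_real m) < r" for z
        proof -
          have k: "onorm (K z) \<le> Ck * dist z (of_real m) powr g" using Ck(4) z Dl by blast
          have s: "C / sqrt (1 + (cmod z)\<^sup>2) \<le> C"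
          proof -
            have "sqrt (1 + (cmod z)\<^sup>2) \<ge> 1" by simp
            then have "C / sqrt (1 + (cmod z)\<^sup>2) \<le> C / 1" using C(1) by (intro divide_left_mono) (auto simp: add_pos_nonneg)
            then show ?thesis by simp
          qed
          have "norm (?f z) \<le> onorm (K z) * (C / sqrt (1 + (cmod z)\<^sup>2)) * (norm x * norm y)"
            by (rule bound) (use z in blast)
          also have "\<dots> \<le> onorm (K z) * C * (norm x * norm y)"
            using onorm_nonneg[OF side(7)] z(1) by (intro mult_right_mono mult_left_mono s) auto
          also have "\<dots> = onorm (K z) * (C * (norm x * norm y))" by simp
          also have "\<dots> \<le> (Ck * dist z (of_real m) powr g) * (C * (norm x * norm y) + 1)"
            using k nn Ck(1) by (intro mult_mono) auto
          also have "\<dots> = C' * dist z (of_real m) powr g" by (simp add: C'_def)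
          finally show ?thesis .
        qed
        then show ?thesis using C' Ck(2,3) by auto
      qed
      show "0 \<le> C * (norm x * norm y)" using C(1) by simp
      show "norm (?f z) \<le> C * (norm x * norm y) * (onorm (K z) / norm z)"
        if z: "z \<in> Dl \<union> complex_of_real ` einterval \<mu>\<^sub>1 \<mu>\<^sub>2" "1 \<le> norm z" for z
      proof -
        have zS: "z \<in> ?S" using z(1) \<Delta>0(2) by simp
        have "cmod z \<le> sqrt (1 + (cmod z)\<^sup>2)" by (rule real_le_rsqrt) simp
        then have "C / sqrt (1 + (cmod z)\<^sup>2) \<le> C / cmod z"
          using C(1) z(2) by (intro divide_left_mono mult_pos_pos) (auto simp: add_pos_nonneg)
        then have "onorm (K z) * (C / sqrt (1 + (cmod z)\<^sup>2)) * (norm x * norm y) \<le> onorm (K z) * (C / cmod z) * (norm x * norm y)"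
          using onorm_nonneg[OF side(7)[OF zS]] by (intro mult_right_mono mult_left_mono) auto
        then show ?thesis using bound[OF zS] by (simp add: mult_ac)
      qed
      show "has_improper_rs_integral (\<lambda>s u v. ?f (of_real s) * of_real (v - u)) (cinner (Y x) (B y)) \<mu>\<^sub>1 \<mu>\<^sub>2"
        unfolding Y
      proof (rule sylvester_density[OF ctx])
        show "has_op_derivative_real ?KB (K (of_real t)) t" if "t \<in> einterval \<mu>\<^sub>1 \<mu>\<^sub>2" for t
          using K that unfolding continued_derivative_def \<Delta>0(2) by blast
        show "op_continuous_on ?S K" by (rule side(6))
        show "bounded_clinear (K z)" if "z \<in> ?S" for z by (rule side(7)[OF that])
        show "complex_of_real ` einterval \<mu>\<^sub>1 \<mu>\<^sub>2 \<subseteq> ?S" unfolding \<Delta>0(2) by blast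
      qed
      have "has_improper_rs_integral (\<lambda>s u v. (\<gamma> v - \<gamma> u) *\<^sub>C K (\<gamma> s) (resolvent Z (\<gamma> s) x)) (- X x) \<mu>\<^sub>1 \<mu>\<^sub>2"
        using X(3) unfolding is_W1_def by blast
      from has_improper_rs_integral_linear[OF bounded_linear_cinner_left[of y] this]
      show "has_improper_rs_integral (\<lambda>s u v. ?f (\<gamma> s) * (\<gamma> v - \<gamma> u)) (cinner (- X x) y) \<mu>\<^sub>1 \<mu>\<^sub>2"
        by (simp add: cinner_scaleC_left mult.commute)
    qed
    then show "cinner (cadjoint B (Y x)) y = cinner (- X x) y" by (simp add: cinner_cadjoint_left[OF B])
  qed
  have A1_sym: "cinner (A1 x) y = cinner x (A1 y)" for x y
    using A1(2) unfolding selfadjoint_op_def by blast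
  have Z_eq: "Z x = A1 x - cadjoint B (Y x)" for x by (simp add: Z(1) BY)
  have syl1: "Y x \<in> D0" and syl2: "A0 (Y x) = Y (Z x) - B x" for x using syl by blast+
  note riccati = riccati_from_sylvester[where ?A1.0 = A1 and ?D0.0 = D0 and ?A0.0 = A0]
  have "strong_riccati_solution D0 A0 UNIV A1 B (cadjoint Y)"
    by (rule riccati(1)[OF _ A1_sym B bcY Z_eq syl1 syl2]) (rule A_sym)
  moreover have "\<forall>x\<in>graph0 (cadjoint Y). \<forall>y\<in>graph1 Y. cinner (J_op x) y = 0"
    by (rule riccati(2)[OF _ A1_sym B bcY Z_eq syl1 syl2]) (rule A_sym)
  moreover have "invariant_subspace (D0 \<times> UNIV) (block_op A0 A1 B) (graph0 (cadjoint Y))"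
    by (rule riccati(3)[OF _ A1_sym B bcY Z_eq syl1 syl2]) (rule A_sym)
  moreover have "invariant_subspace (D0 \<times> UNIV) (block_op A0 A1 B) (graph1 Y)"
    by (rule riccati(4)[OF _ A1_sym B bcY Z_eq syl1 syl2]) (rule A_sym)
  ultimately show ?thesis using bcY int by blast
qed

end
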